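(* Let $(E,h)$ be a Hermitian holomorphic vector bundle over a complex manifold $M$. Suppose that $(E,h)$ is Griffiths negative and that its curvature splits. Let $g$ be the Kähler metric on $M$ induced by $-\mathrm{Ric}(E,h)$. If $(M,g)$ has constant Ricci eigenvalues, then the unit sphere bundle $S(E)=\{e\in E: |e|_h=1\}$ is obstruction flat.
   Context: **Bundle curvature.** Let $n=\dim_{\mathbb C}M$, $k=\mathrm{rank}\,E$. In local coordinates $z$ of $M$ and a local holomorphic frame $\{e_\alpha\}_{\alpha=1}^k$ of $E$, put $h_{\alpha\bar\beta}=h(e_\alpha,e_\beta)$. The Chern curvature $\Theta$ is viewed as a Hermitian form on $E_z\otimes T^{1,0}_zM$ with components $\Theta_{\alpha\bar\beta i\bar j}=-\frac{\partial^2 h_{\alpha\bar\beta}}{\partial z_i\partial\overline{z_j}}+\sum_{\gamma,\delta} h^{\gamma\bar\delta}\frac{\partial h_{\alpha\bar\delta}}{\partial z_i}\frac{\partial h_{\gamma\bar\beta}}{\partial\overline{z_j}}$. - $\mathrm{Ric}(E,h)$ is the Hermitian form on $T^{1,0}M$ with components $\sum_{\alpha,\beta}h^{\alpha\bar\beta}\Theta_{\alpha\bar\beta i\bar j}=-\frac{\partial^2\log\det(h_{\alpha\bar\beta})}{\partial z_i\partial\overline{z_j}}$. - $(E,h)$ is Griffiths negative if $\Theta_z(e\otimes v,e\otimes v)\le 0$ for all $z\in M$, $e\in E_z$, $v\in T_z^{1,0}M$, with equality iff $e=0$ or $v=0$. In that case $-\mathrm{Ric}(E,h)$ induces a Kähler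 metric $g$ on $M$, with $g_{i\bar j}=\frac{\partial^2\log\det(h_{\alpha\bar\beta})}{\partial z_i\partial\overline{z_j}}$, and $S(E)$ is a strongly pseudoconvex real hypersurface in $E$. - The curvature of $(E,h)$ splits if at every $z\in M$ there is a Hermitian form $H_z$ on $T_z^{1,0}M$ with $\Theta_z(e\otimes v,e\otimes v)=h(e,e)H_z(v,v)$ for all $e\in E_z$, $v\in T_z^{1,0}M$. - $|e|_h=\sqrt{h(e,e)}$. **Ricci eigenvalues.** For a Kähler manifold $(M,g)$, $\mathrm{Ric}=-i\partial\bar\partial\log\det(g_{i\bar j})$. The Ricci eigenvalues at $z$ are the (real) eigenvalues of the endomorphism $\mathrm{Ric}\cdot g^{-1}$ of $T^{1,0}_zM$, ordered $\lambda_1(z)\le\dots\le\lambda_n(z)$. $(M,g)$ has constant Ricci eigenvalues if each $\lambda_i$ is a constant function on $M$. **Obstruction flatness.** For a function $u$ on an open set of $\mathbb C^N$, $N\ge2$, let $J(u)=(-1)^N\det\begin{pmatrix} u & u_{\overline{z_k}} \\ u_{z_j} & u_{z_j\overline{z_k}} \end{pmatrix}$. For a smoothly bounded strongly pseudoconvex domain $\Omega\subset\mathbb C^N$, a Fefferman defining function is a smooth defining function $\rho$ ($\rho>0$ in $\Omega$) with $J(\rho)=1+O(\rho^{N+1})$. The solution $u>0$ of $J(u)=1$ in $\Omega$, $u=0$ on $\partial\Omega$ has an expansion $u\sim\rho\sum_{k\ge0}\eta_k(\rho^{N+1}\log\rho)^k$ with $\eta_k$ smooth up to $\partial\Omega$.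 The obstruction function is $\mathcal O=\eta_1|_{\partial\Omega}$. By Graham, it is a local CR invariant of $\partial\Omega$, hence is defined on every strongly pseudoconvex CR hypersurface $\Sigma$ in an $N$-dimensional complex manifold, and $\Sigma$ is called obstruction flat if $\mathcal O\equiv0$ on $\Sigma$. Equivalently (Graham), near each point of $\Sigma$, in local holomorphic coordinates, there is a smooth defining function $\rho$ of $\Sigma$, positive on the pseudoconvex side, with $J(\rho)=1+O(\rho^{N+2})$. *)

theory Defs
  imports "HOL-Analysis.Analysis"
begin

section \<open>Smooth and holomorphic maps, Wirtinger derivatives\<close>

primrec higher_differentiable_on ::
  "nat \<Rightarrow> ('a::real_normed_vector \<Rightarrow> 'b::real_normed_vector) \<Rightarrow> 'a set \<Rightarrow> bool" where
  "higher_differentiable_on 0 f S \<longleftrightarrow> continuous_on S f"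
| "higher_differentiable_on (Suc m) f S \<longleftrightarrow>
     (\<forall>x\<in>S. f differentiable (at x)) \<and>
     (\<forall>v. higher_differentiable_on m (\<lambda>x. frechet_derivative f (at x) v) S)"

text \<open>Only used on open sets \<open>S\<close>.\<close>

definition smooth_on :: "'a set \<Rightarrow> ('a::real_normed_vector \<Rightarrow> 'b::real_normed_vector) \<Rightarrow> bool" where
  "smooth_on S f \<longleftrightarrow> (\<forall>m. higher_differentiable_on m f S)"

text \<open>Holomorphic maps of several variables are smooth maps satisfying the Cauchy--Riemann
  equations, i.e. with complex linear differential.\<close>

definition holomorphic_map_on :: "(complex^'a) set \<Rightarrow> (complex^'a \<Rightarrow> complex^'b) \<Rightarrow> bool" where
  "holomorphic_map_on S f \<longleftrightarrow>
     smooth_on S f \<and>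
     (\<forall>z\<in>S. \<forall>c v. frechet_derivative f (at z) (c *s v) = c *s frechet_derivative f (at z) v)"

definition dz :: "'a \<Rightarrow> (complex^'a \<Rightarrow> complex) \<Rightarrow> complex^'a \<Rightarrow> complex" where
  "dz i f z =
     (frechet_derivative f (at z) (axis i 1) - \<i> * frechet_derivative f (at z) (axis i \<i>)) / 2"

definition dzbar :: "'a \<Rightarrow> (complex^'a \<Rightarrow> complex) \<Rightarrow> complex^'a \<Rightarrow> complex" where
  "dzbar i f z =
     (frechet_derivative f (at z) (axis i 1) + \<i> * frechet_derivative f (at z) (axis i \<i>)) / 2"

section \<open>Hermitian matrices and ordered eigenvalues\<close>

definition hermitian_matrix :: "complex^'a^'a \<Rightarrow> bool" where
  "hermitian_matrix A \<longleftrightarrow> (\<forall>i j. A $ i $ j = cnj (A $ j $ i))"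

text \<open>The value at \<open>(v, v)\<close> of the form \<open>(v, w) \<mapsto> \<Sum> A i j v\<^sub>i (cnj w\<^sub>j)\<close>.\<close>

definition sesq :: "complex^'a^'a \<Rightarrow> complex^'a \<Rightarrow> complex" where
  "sesq A v = (\<Sum>i\<in>UNIV. \<Sum>j\<in>UNIV. A $ i $ j * (v $ i) * cnj (v $ j))"

text \<open>\<open>xs\<close> lists the eigenvalues of \<open>A\<close>, all real, in increasing order and with algebraic
  multiplicity.\<close>

definition ordered_eigenvalues :: "complex^'a^'a \<Rightarrow> real list \<Rightarrow> bool" where
  "ordered_eigenvalues A xs \<longleftrightarrow>
     length xs = CARD('a) \<and> sorted xs \<and>
     (\<forall>t. det (mat t - A) = (\<Prod>x\<leftarrow>xs. t - complex_of_real x))"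

section \<open>Complex manifolds\<close>

type_synonym ('m, 'n) chart = "'m set \<times> ('m \<Rightarrow> complex^'n)"

text \<open>The inverse of a chart \<open>c\<close>, meaningful on \<open>snd c ` fst c\<close>.\<close>

definition chart_inv :: "('m, 'n::finite) chart \<Rightarrow> complex^'n \<Rightarrow> 'm" where
  "chart_inv c = inv_into (fst c) (snd c)"

definition compatible_charts :: "('m, 'n::finite) chart \<Rightarrow> ('m, 'n) chart \<Rightarrow> bool" where
  "compatible_charts c d \<longleftrightarrow>
     holomorphic_map_on (snd c ` (fst c \<inter> fst d)) (snd d \<circ> chart_inv c) \<and>
     holomorphic_map_on (snd d ` (fst c \<inter> fst d)) (snd c \<circ> chart_inv d)"

definition holomorphic_chart ::
  "('m::topological_space, 'n::finite) chart set \<Rightarrow> ('m, 'n) chart \<Rightarrow> bool" where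
  "holomorphic_chart A c \<longleftrightarrow>
     open (fst c) \<and> open (snd c ` fst c) \<and>
     homeomorphism (fst c) (snd c ` fst c) (snd c) (chart_inv c) \<and>
     (\<forall>d\<in>A. compatible_charts c d)"

text \<open>The underlying set of the manifold is the whole type; \<open>A\<close> need not be maximal.\<close>

definition complex_manifold ::
  "('m::{t2_space,second_countable_topology}, 'n::finite) chart set \<Rightarrow> bool" where
  "complex_manifold A \<longleftrightarrow> (\<Union>c\<in>A. fst c) = UNIV \<and> (\<forall>c\<in>A. holomorphic_chart A c)"

section \<open>Holomorphic vector bundles and Hermitian metrics\<close>

text \<open>A bundle of rank \<open>CARD('k)\<close> over an \<open>CARD('n)\<close>-dimensional base; the fibrewise operations
  are only meaningful for arguments in a common fibre.\<close>

record ('m, 'e, 'n::finite, 'k::finite) vbundle =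
  base_atlas :: "('m, 'n) chart set"
  total_atlas :: "('e, 'n + 'k) chart set"
  proj :: "'e \<Rightarrow> 'm"
  vadd :: "'e \<Rightarrow> 'e \<Rightarrow> 'e"
  vscale :: "complex \<Rightarrow> 'e \<Rightarrow> 'e"

definition vjoin :: "complex^'n \<Rightarrow> complex^'k \<Rightarrow> complex^('n + 'k)" where
  "vjoin z \<xi> = (\<chi> s. case s of Inl i \<Rightarrow> z $ i | Inr \<alpha> \<Rightarrow> \<xi> $ \<alpha>)"

text \<open>A trivialization over the open set \<open>U\<close> is given by the fibre coordinate \<open>\<phi>\<close>: the map
  \<open>e \<mapsto> (proj e, \<phi> e)\<close> is a biholomorphism onto \<open>U \<times> \<complex>\<^sup>k\<close>, linear on fibres. The linearity and
  bijectivity make every fibre a complex vector space.\<close>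

definition local_trivialization ::
  "('m::topological_space, 'e::topological_space, 'n::finite, 'k::finite) vbundle
     \<Rightarrow> 'm set \<Rightarrow> ('e \<Rightarrow> complex^'k) \<Rightarrow> bool" where
  "local_trivialization E U \<phi> \<longleftrightarrow>
     open U \<and>
     bij_betw (\<lambda>e. (proj E e, \<phi> e)) (proj E -` U) (U \<times> UNIV) \<and>
     (\<forall>e f. proj E e \<in> U \<and> proj E f = proj E e \<longrightarrow> \<phi> (vadd E e f) = \<phi> e + \<phi> f) \<and>
     (\<forall>e c. proj E e \<in> U \<longrightarrow> \<phi> (vscale E c e) = c *s \<phi> e) \<and>
     (\<forall>(W, \<psi>)\<in>base_atlas E.
        holomorphic_chart (total_atlas E)
          (proj E -` (U \<inter> W), \<lambda>e. vjoin (\<psi> (proj E e)) (\<phi> e)))"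

definition holomorphic_vector_bundle ::
  "('m::{t2_space,second_countable_topology}, 'e::{t2_space,second_countable_topology},
    'n::finite, 'k::finite) vbundle \<Rightarrow> bool" where
  "holomorphic_vector_bundle E \<longleftrightarrow>
     complex_manifold (base_atlas E) \<and> complex_manifold (total_atlas E) \<and>
     (\<forall>e f. proj E f = proj E e \<longrightarrow> proj E (vadd E e f) = proj E e) \<and>
     (\<forall>c e. proj E (vscale E c e) = proj E e) \<and>
     (\<forall>p. \<exists>U \<phi>. p \<in> U \<and> local_trivialization E U \<phi>)"

text \<open>The local holomorphic frame belonging to the trivialization \<open>\<phi>\<close>.\<close>

definition frame :: "('m, 'e, 'n::finite, 'k::finite) vbundle \<Rightarrow> ('e \<Rightarrow> complex^'k) \<Rightarrow> 'k \<Rightarrow> 'm \<Rightarrow> 'e" where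
  "frame E \<phi> \<alpha> p = (THE e. proj E e = p \<and> \<phi> e = axis \<alpha> 1)"

text \<open>The matrix of \<open>h (e\<^sub>\<alpha>, e\<^sub>\<beta>)\<close> as a function of the coordinates given by the chart \<open>c\<close>.\<close>

definition metric_matrix ::
  "('m, 'e, 'n::finite, 'k::finite) vbundle \<Rightarrow> ('e \<Rightarrow> 'e \<Rightarrow> complex) \<Rightarrow> ('m, 'n) chart
     \<Rightarrow> ('e \<Rightarrow> complex^'k) \<Rightarrow> complex^'n \<Rightarrow> complex^'k^'k" where
  "metric_matrix E h c \<phi> z =
     (\<chi> \<alpha> \<beta>. h (frame E \<phi> \<alpha> (chart_inv c z)) (frame E \<phi> \<beta> (chart_inv c z)))"

text \<open>\<open>h\<close> is linear in the first and antilinear in the second argument. The zero vector of the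
  fibre of \<open>e\<close> is \<open>vscale E 0 e\<close>.\<close>

definition hermitian_metric ::
  "('m::topological_space, 'e::topological_space, 'n::finite, 'k::finite) vbundle
     \<Rightarrow> ('e \<Rightarrow> 'e \<Rightarrow> complex) \<Rightarrow> bool" where
  "hermitian_metric E h \<longleftrightarrow>
     (\<forall>e f g. proj E f = proj E e \<and> proj E g = proj E e \<longrightarrow>
        h (vadd E e f) g = h e g + h f g) \<and>
     (\<forall>c e f. proj E f = proj E e \<longrightarrow> h (vscale E c e) f = c * h e f) \<and>
     (\<forall>e f. proj E f = proj E e \<longrightarrow> h f e = cnj (h e f)) \<and>
     (\<forall>e. e \<noteq> vscale E 0 e \<longrightarrow> Re (h e e) > 0) \<and>
     (\<forall>c\<in>base_atlas E. \<forall>U \<phi>. local_trivialization E U \<phi> \<longrightarrow>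
        (\<forall>\<alpha> \<beta>. smooth_on (snd c ` (fst c \<inter> U)) (\<lambda>z. metric_matrix E h c \<phi> z $ \<alpha> $ \<beta>)))"

definition hnorm :: "('e \<Rightarrow> 'e \<Rightarrow> complex) \<Rightarrow> 'e \<Rightarrow> real" where
  "hnorm h e = sqrt (Re (h e e))"

definition unit_sphere_bundle :: "('e \<Rightarrow> 'e \<Rightarrow> complex) \<Rightarrow> 'e set" where
  "unit_sphere_bundle h = {e. hnorm h e = 1}"

section \<open>Curvature of the bundle\<close>

text \<open>For \<open>H = (h\<^sub>\<alpha>\<^sub>\<beta>)\<close>, the entry of the inverse metric with upper indices \<open>\<gamma>\<close> and barred \<open>\<delta>\<close> is
  \<open>matrix_inv H $ \<delta> $ \<gamma>\<close>: the inverse metric is the transposed inverse matrix.\<close>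

definition chern_curvature ::
  "(complex^'n \<Rightarrow> complex^'k^'k) \<Rightarrow> complex^'n \<Rightarrow> 'k \<Rightarrow> 'k \<Rightarrow> 'n \<Rightarrow> 'n \<Rightarrow> complex" where
  "chern_curvature H z \<alpha> \<beta> i j =
     - dz i (dzbar j (\<lambda>w. H w $ \<alpha> $ \<beta>)) z
     + (\<Sum>\<gamma>\<in>UNIV. \<Sum>\<delta>\<in>UNIV. matrix_inv (H z) $ \<delta> $ \<gamma>
          * dz i (\<lambda>w. H w $ \<alpha> $ \<delta>) z * dzbar j (\<lambda>w. H w $ \<gamma> $ \<beta>) z)"

text \<open>\<open>\<Theta> (e \<otimes> v, e \<otimes> v)\<close> at the base point of \<open>e\<close>, where \<open>v\<close> is the tuple of components of a
  tangent vector with respect to \<open>\<partial>/\<partial>z\<^sub>i\<close> in the chart \<open>c\<close>.\<close>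

definition curvature_form ::
  "('m, 'e, 'n::finite, 'k::finite) vbundle \<Rightarrow> ('e \<Rightarrow> 'e \<Rightarrow> complex) \<Rightarrow> ('m, 'n) chart
     \<Rightarrow> ('e \<Rightarrow> complex^'k) \<Rightarrow> 'e \<Rightarrow> complex^'n \<Rightarrow> complex" where
  "curvature_form E h c \<phi> e v =
     (\<Sum>\<alpha>\<in>UNIV. \<Sum>\<beta>\<in>UNIV. \<Sum>i\<in>UNIV. \<Sum>j\<in>UNIV.
        chern_curvature (metric_matrix E h c \<phi>) (snd c (proj E e)) \<alpha> \<beta> i j
          * (\<phi> e $ \<alpha>) * cnj (\<phi> e $ \<beta>) * (v $ i) * cnj (v $ j))"

definition griffiths_negative ::
  "('m::topological_space, 'e::topological_space, 'n::finite, 'k::finite) vbundle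
     \<Rightarrow> ('e \<Rightarrow> 'e \<Rightarrow> complex) \<Rightarrow> bool" where
  "griffiths_negative E h \<longleftrightarrow>
     (\<forall>c\<in>base_atlas E. \<forall>U \<phi>. local_trivialization E U \<phi> \<longrightarrow>
        (\<forall>e v. proj E e \<in> fst c \<inter> U \<longrightarrow>
           Re (curvature_form E h c \<phi> e v) \<le> 0 \<and>
           (curvature_form E h c \<phi> e v = 0 \<longleftrightarrow> e = vscale E 0 e \<or> v = 0)))"

text \<open>The Hermitian form on the tangent space at \<open>p\<close> is given by its matrix in the chart \<open>c\<close>.\<close>

definition curvature_splits ::
  "('m::topological_space, 'e::topological_space, 'n::finite, 'k::finite) vbundle
     \<Rightarrow> ('e \<Rightarrow> 'e \<Rightarrow> complex) \<Rightarrow> bool" where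
  "curvature_splits E h \<longleftrightarrow>
     (\<forall>p. \<forall>c\<in>base_atlas E. p \<in> fst c \<longrightarrow>
        (\<exists>H. hermitian_matrix H \<and>
           (\<forall>U \<phi>. local_trivialization E U \<phi> \<and> p \<in> U \<longrightarrow>
              (\<forall>e v. proj E e = p \<longrightarrow> curvature_form E h c \<phi> e v = h e e * sesq H v))))"

definition bundle_ricci_in_frame ::
  "('m, 'e, 'n::finite, 'k::finite) vbundle \<Rightarrow> ('e \<Rightarrow> 'e \<Rightarrow> complex) \<Rightarrow> ('m, 'n) chart
     \<Rightarrow> ('e \<Rightarrow> complex^'k) \<Rightarrow> 'm \<Rightarrow> complex^'n^'n" where
  "bundle_ricci_in_frame E h c \<phi> p =
     (\<chi> i j. \<Sum>\<alpha>\<in>UNIV. \<Sum>\<beta>\<in>UNIV.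
        matrix_inv (metric_matrix E h c \<phi> (snd c p)) $ \<beta> $ \<alpha>
          * chern_curvature (metric_matrix E h c \<phi>) (snd c p) \<alpha> \<beta> i j)"

text \<open>The components of \<open>Ric(E,h)\<close> in the chart \<open>c\<close>, which are the same in all local frames.\<close>

definition bundle_ricci ::
  "('m::topological_space, 'e::topological_space, 'n::finite, 'k::finite) vbundle
     \<Rightarrow> ('e \<Rightarrow> 'e \<Rightarrow> complex) \<Rightarrow> ('m, 'n) chart \<Rightarrow> 'm \<Rightarrow> complex^'n^'n" where
  "bundle_ricci E h c p =
     (THE R. \<forall>U \<phi>. local_trivialization E U \<phi> \<and> p \<in> U \<longrightarrow> R = bundle_ricci_in_frame E h c \<phi> p)"

section \<open>Ricci eigenvalues of a Kaehler metric\<close>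

text \<open>A metric on the manifold is given by its matrix of components in each chart.\<close>

type_synonym ('m, 'n) metric = "('m, 'n) chart \<Rightarrow> 'm \<Rightarrow> complex^'n^'n"

definition induced_metric ::
  "('m::topological_space, 'e::topological_space, 'n::finite, 'k::finite) vbundle
     \<Rightarrow> ('e \<Rightarrow> 'e \<Rightarrow> complex) \<Rightarrow> ('m, 'n) metric" where
  "induced_metric E h c p = - bundle_ricci E h c p"

definition ricci_tensor :: "('m, 'n::finite) metric \<Rightarrow> ('m, 'n) metric" where
  "ricci_tensor g c p =
     (\<chi> i j. - dz i (dzbar j (\<lambda>z. complex_of_real (ln (Re (det (g c (chart_inv c z))))))) (snd c p))"

definition constant_ricci_eigenvalues ::
  "('m, 'n::finite) chart set \<Rightarrow> ('m, 'n) metric \<Rightarrow> bool" where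
  "constant_ricci_eigenvalues A g \<longleftrightarrow>
     (\<exists>ls. \<forall>p. \<forall>c\<in>A. p \<in> fst c \<longrightarrow>
        ordered_eigenvalues (ricci_tensor g c p ** matrix_inv (g c p)) ls)"

section \<open>Obstruction flatness\<close>

text \<open>The index \<open>None\<close> stands for the first row and column of the bordered matrix.\<close>

definition fefferman_J :: "(complex^'N \<Rightarrow> real) \<Rightarrow> complex^'N \<Rightarrow> complex" where
  "fefferman_J u z =
     (let f = (\<lambda>w. complex_of_real (u w)) in
      (- 1) ^ CARD('N) *
      det ((\<chi> a b. case a of
               None \<Rightarrow> (case b of None \<Rightarrow> f z | Some k \<Rightarrow> dzbar k f z)
             | Some j \<Rightarrow> (case b of None \<Rightarrow> dz j f z | Some k \<Rightarrow> dz j (dzbar k f) z))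
           :: complex^('N option)^('N option)))"

text \<open>\<open>\<rho>\<close> is a smooth defining function of \<open>\<Sigma>\<close> on the open set \<open>V\<close> of \<open>\<complex>\<^sup>N\<close>, such that \<open>\<Sigma>\<close> is
  strongly pseudoconvex as boundary of \<open>{\<rho> > 0}\<close>: the Levi form of \<open>- \<rho>\<close> is positive definite on
  the complex tangent spaces of \<open>\<Sigma>\<close>. Thus \<open>{\<rho> > 0}\<close> is the pseudoconvex side.\<close>

definition pseudoconvex_defining_function ::
  "(complex^'N) set \<Rightarrow> (complex^'N) set \<Rightarrow> (complex^'N \<Rightarrow> real) \<Rightarrow> bool" where
  "pseudoconvex_defining_function V \<Sigma> \<rho> \<longleftrightarrow>
     smooth_on V \<rho> \<and> {z\<in>V. \<rho> z = 0} = \<Sigma> \<inter> V \<and>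
     (\<forall>z\<in>\<Sigma> \<inter> V.
        frechet_derivative \<rho> (at z) \<noteq> (\<lambda>v. 0) \<and>
        (\<forall>w. w \<noteq> 0 \<and> (\<Sum>i\<in>UNIV. dz i (\<lambda>x. complex_of_real (\<rho> x)) z * w $ i) = 0 \<longrightarrow>
           Re (sesq (\<chi> i j. dz i (dzbar j (\<lambda>x. complex_of_real (- \<rho> x))) z) w) > 0))"

text \<open>Graham's local description of the vanishing of the obstruction function, for a subset
  \<open>\<Sigma>\<close> of a complex manifold with atlas \<open>A\<close>. The condition does not depend on the coordinates: if
  \<open>F\<close> is biholomorphic, then \<open>J (\<bar>det F'\<bar> powr (- 2 / (N + 1)) \<cdot> (\<rho> \<circ> F)) = J \<rho> \<circ> F\<close>. Strong
  pseudoconvexity of \<open>\<Sigma>\<close> is part of the condition.\<close>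

definition obstruction_flat :: "('x, 'N::finite) chart set \<Rightarrow> 'x set \<Rightarrow> bool" where
  "obstruction_flat A \<Sigma> \<longleftrightarrow>
     (\<forall>p\<in>\<Sigma>. \<forall>c\<in>A. p \<in> fst c \<longrightarrow>
        (\<exists>V \<rho>. open V \<and> snd c p \<in> V \<and> V \<subseteq> snd c ` fst c \<and>
           pseudoconvex_defining_function V (snd c ` (\<Sigma> \<inter> fst c)) \<rho> \<and>
           (\<exists>C. \<forall>z\<in>V. cmod (fefferman_J \<rho> z - 1) \<le> C * \<bar>\<rho> z\<bar> ^ (CARD('N) + 2))))"

end

theory Submission
  imports Defs
begin

text \<open>
Obstruction flatness of the sphere bundle asks for local defining functions \<open>\<rho>\<close> with \<open>J(\<rho>) = 1\<close> to high
order. The proof produces exact solutions of \<open>J(\<rho>) = 1\<close>.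

In a trivialization with base coordinates \<open>z\<close> and fibre coordinates \<open>\<xi>\<close>, let \<open>r = h(e, e)\<close>, let \<open>n\<close> and \<open>k\<close> be
the dimension of the base and the rank, and put \<open>N = n + k\<close>. The ansatz is \<open>\<rho> = G(r) exp(-\<psi>(z))\<close>
with \<open>\<psi> = log(det g det h) / (N + 1)\<close>. The weight can be removed from the bordered matrix in \<open>J\<close> by
unipotent matrices, at the price of subtracting \<open>G\<close> times its complex Hessian
(\<open>fefferman_J_warped\<close>). With respect to the horizontal lifts of \<open>\<partial>/\<partial>z\<^sub>i\<close> given by the Chern connection the
bordered matrix then becomes block diagonal (\<open>det_bordered_fibred\<close>):

  \<^item> the vertical block, which carries the border, has determinant \<open>det h\<close> times a function of \<open>r\<close>;

  \<^item> the horizontal block is \<open>- G'(r) \<Theta>(e, e) - G(r) \<psi>\<^sub>i\<^sub>j\<close>. Since the curvature splits,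
    \<open>\<Theta> = - (1/k) h \<otimes> g\<close>; since \<open>(log det h)\<^sub>i\<^sub>j = g\<^sub>i\<^sub>j\<close> (\<open>hessian_log_det\<close>) and
    \<open>(log det g)\<^sub>i\<^sub>j = - Ric\<^sub>i\<^sub>j\<close>, the block is a linear combination of \<open>g\<close> and \<open>Ric\<close> whose coefficients depend
    on \<open>r\<close>.

The determinant of the horizontal block is therefore \<open>det g\<close> times a polynomial in the Ricci
eigenvalues with coefficients depending on \<open>r\<close>. As these eigenvalues are constant and the weight
cancels \<open>det g det h\<close>, the equation \<open>J(\<rho>) = 1\<close> becomes an ordinary differential equation for \<open>G\<close>.
Its solution (\<open>radial_profile\<close>) rests on the substitution \<open>w = - G / (dG/ds)\<close>, \<open>s = log r\<close>, after
which the equation is autonomous with rational right-hand side, regular at \<open>w = 0\<close>; the reason why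
no logarithm appears at \<open>r = 1\<close> is a bound on a degree, which holds as \<open>k\<close> is at least 1.

Griffiths negativity makes \<open>g\<close> and hence the complex Hessian of \<open>r\<close> positive definite, which gives
strong pseudoconvexity. Finally \<open>\<rho>\<close> is moved to an arbitrary holomorphic chart of the total space with
the transformation law \<open>J(\<bar>det F'\<bar> powr (- 2 / (N + 1)) \<cdot> (\<rho> \<circ> F)) = J(\<rho>) \<circ> F\<close>
(\<open>defining_function_pullback\<close>).
\<close>

section \<open>Determinants of block matrices\<close>

lemma map_permutation_transpose_comp:
  fixes f :: "'a \<Rightarrow> 'b"
  assumes "inj f"
  shows "map_permutation UNIV f (Transposition.transpose a b \<circ> p)
           = Transposition.transpose (f a) (f b) \<circ> map_permutation UNIV f p"
proof
  fix x
  show "map_permutation UNIV f (Transposition.transpose a b \<circ> p) x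
           = (Transposition.transpose (f a) (f b) \<circ> map_permutation UNIV f p) x"
  proof (cases "x \<in> range f")
    case True
    then obtain y where "x = f y" by blast
    then show ?thesis
      using assms by (auto simp: map_permutation_apply Transposition.transpose_def inj_eq)
  next
    case False
    then have "x \<noteq> f a" "x \<noteq> f b" by auto
    with False show ?thesis
      by (simp add: map_permutation_def restrict_id_def Transposition.transpose_def)
  qed
qed

text \<open>Carrying a permutation along an injection carries a factorization into transpositions along,
  hence preserves the sign.\<close>

lemma sign_map_permutation:
  fixes f :: "'a::finite \<Rightarrow> 'b::finite"
  assumes f: "inj f" and p: "p permutes UNIV"
  shows "sign (map_permutation UNIV f p) = sign p"
  using p finite_class.finite_UNIV
proof (induction p rule: permutes_induct)
  case id
  then show ?case using f by (simp add: map_permutation_id' map_permutation_ident' id_def)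
next
  case (swap a b p)
  have p: "permutation p" using swap by (metis finite_class.finite_UNIV permutation_permutes)
  have bf: "bij_betw f UNIV (range f)" using f by (simp add: bij_betw_def)
  have "map_permutation UNIV f p permutes range f"
    using map_permutation_permutes[OF bf] swap by blast
  then have q: "permutation (map_permutation UNIV f p)"
    by (metis finite permutes_imp_permutation)
  show ?case
    using swap p q f
    by (simp only: map_permutation_transpose_comp sign_compose permutation_swap_id sign_swap_id)
       (simp add: inj_eq)
qed

lemma map_permutation_bij:
  fixes f :: "'a::finite \<Rightarrow> 'b::finite"
  assumes f: "inj f"
  shows "bij_betw (map_permutation UNIV f) {p. p permutes UNIV} {q. q permutes range f}"
proof (rule bij_betw_byWitness[where f' = "map_permutation (range f) (inv f)"])
  have bf: "bij_betw f UNIV (range f)" using f by (simp add: bij_betw_def)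
  have bg: "bij_betw (inv f) (range f) UNIV"
    using bf bij_betw_inv_into by blast
  show "\<forall>p\<in>{p. p permutes UNIV}. map_permutation (range f) (inv f) (map_permutation UNIV f p) = p"
    using map_permutation_compose_inv[OF bf] f by simp
  show "\<forall>q\<in>{q. q permutes range f}. map_permutation UNIV f (map_permutation (range f) (inv f) q) = q"
    using map_permutation_compose_inv[OF bg] f by (auto simp: f_inv_into_f)
  show "map_permutation UNIV f ` {p. p permutes UNIV} \<subseteq> {q. q permutes range f}"
    using map_permutation_permutes[OF bf] by auto
  show "map_permutation (range f) (inv f) ` {q. q permutes range f} \<subseteq> {p. p permutes UNIV}"
    using map_permutation_permutes[OF bg] by auto
qed

text \<open>A permutation contributes only if it maps the range of \<open>f\<close> into itself. It then permutes the
  complement, where the identity entries force it to be trivial.\<close>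

lemma det_extend:
  fixes f :: "'a::finite \<Rightarrow> 'b::finite" and M :: "'r::comm_ring_1^'b^'b"
  assumes f: "inj f"
    and zero: "\<And>i t. t \<notin> range f \<Longrightarrow> M $ f i $ t = 0"
    and unit: "\<And>s t. s \<notin> range f \<Longrightarrow> t \<notin> range f \<Longrightarrow> M $ s $ t = (if s = t then 1 else 0)"
  shows "det M = det (\<chi> i j. M $ f i $ f j)"
proof -
  let ?P = "{q. q permutes range f}"
  have sub: "?P \<subseteq> {q. q permutes (UNIV::'b set)}"
    by (auto intro: permutes_subset)
  have vanish: "of_int (sign p) * (\<Prod>s\<in>UNIV. M $ s $ p s) = 0"
    if p: "p permutes UNIV" and np: "\<not> p permutes range f" for p
  proof (cases "\<exists>i. p (f i) \<notin> range f")
    case True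
    then obtain i where "M $ f i $ p (f i) = 0" using zero by blast
    then have "(\<Prod>s\<in>UNIV. M $ s $ p s) = 0" by (intro prod_zero) auto
    then show ?thesis by simp
  next
    case False
    then have "p ` range f \<subseteq> range f" by auto
    then have img: "p ` range f = range f"
      by (metis endo_inj_surj finite permutes_inj_on p)
    have out: "p s \<notin> range f" if "s \<notin> range f" for s
    proof
      assume "p s \<in> range f"
      then have "p s \<in> p ` range f" using img by simp
      with that show False using permutes_inj[OF p] by (simp add: inj_image_mem_iff)
    qed
    have "\<exists>s. s \<notin> range f \<and> p s \<noteq> s"
    proof (rule ccontr)
      assume "\<not> ?thesis"
      then have "p permutes range f" by (intro permutes_superset[OF p]) auto
      with np show False by simp
    qed
    then obtain s where s: "s \<notin> range f" "p s \<noteq> s" by blast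
    then have "M $ s $ p s = 0" using out unit by simp
    then have "(\<Prod>s\<in>UNIV. M $ s $ p s) = 0" by (intro prod_zero) auto
    then show ?thesis by simp
  qed
  have "det M = (\<Sum>q\<in>?P. of_int (sign q) * (\<Prod>s\<in>UNIV. M $ s $ q s))"
    unfolding det_def by (rule sum.mono_neutral_right) (use sub vanish in auto)
  also have "\<dots> = (\<Sum>p\<in>{p. p permutes UNIV}. of_int (sign (map_permutation UNIV f p)) *
                    (\<Prod>s\<in>UNIV. M $ s $ (map_permutation UNIV f p) s))"
    by (rule sum.reindex_bij_betw[OF map_permutation_bij[OF f], symmetric])
  also have "\<dots> = (\<Sum>p\<in>{p. p permutes UNIV}. of_int (sign p) * (\<Prod>i\<in>UNIV. M $ f i $ f (p i)))"
  proof (rule sum.cong[OF refl], clarify)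
    fix p :: "'a \<Rightarrow> 'a" assume p: "p permutes UNIV"
    let ?q = "map_permutation UNIV f p"
    have "(\<Prod>s\<in>UNIV. M $ s $ ?q s) = (\<Prod>s\<in>range f. M $ s $ ?q s)"
      by (rule prod.mono_neutral_right) (auto simp: unit map_permutation_def restrict_id_def)
    also have "\<dots> = (\<Prod>i\<in>UNIV. M $ f i $ f (p i))"
      by (subst prod.reindex[OF f]) (simp add: map_permutation_apply[OF f])
    finally show "of_int (sign ?q) * (\<Prod>s\<in>UNIV. M $ s $ ?q s)
        = of_int (sign p) * (\<Prod>i\<in>UNIV. M $ f i $ f (p i))"
      by (simp add: sign_map_permutation[OF f p])
  qed
  also have "\<dots> = det (\<chi> i j. M $ f i $ f j)"
    by (simp add: det_def)
  finally show ?thesis .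
qed

lemma det_reindex:
  fixes f :: "'a::finite \<Rightarrow> 'b::finite" and M :: "'r::comm_ring_1^'b^'b"
  assumes "bij f"
  shows "det (\<chi> i j. M $ f i $ f j) = det M"
  using det_extend[of f M] assms by (auto simp: bij_def)

definition block :: "'r^'a^'a \<Rightarrow> 'r^'b^'a \<Rightarrow> 'r^'a^'b \<Rightarrow> 'r^'b^'b \<Rightarrow> 'r^('a + 'b)^('a + 'b)" where
  "block A B C D = (\<chi> s t. case s of
       Inl i \<Rightarrow> (case t of Inl j \<Rightarrow> A $ i $ j | Inr b \<Rightarrow> B $ i $ b)
     | Inr a \<Rightarrow> (case t of Inl j \<Rightarrow> C $ a $ j | Inr b \<Rightarrow> D $ a $ b))"

lemma block_nth [simp]:
  "block A B C D $ Inl i $ Inl j = A $ i $ j"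
  "block A B C D $ Inl i $ Inr b = B $ i $ b"
  "block A B C D $ Inr a $ Inl j = C $ a $ j"
  "block A B C D $ Inr a $ Inr b = D $ a $ b"
  by (simp_all add: block_def)

lemma sum_UNIV_Plus:
  fixes g :: "'a::finite + 'b::finite \<Rightarrow> 'c::comm_monoid_add"
  shows "(\<Sum>s\<in>UNIV. g s) = (\<Sum>i\<in>UNIV. g (Inl i)) + (\<Sum>b\<in>UNIV. g (Inr b))"
  by (simp add: UNIV_Plus_UNIV[symmetric] sum.Plus del: UNIV_Plus_UNIV)

lemma block_eqI:
  assumes "\<And>i j. M $ Inl i $ Inl j = N $ Inl i $ Inl j" "\<And>i b. M $ Inl i $ Inr b = N $ Inl i $ Inr b"
    and "\<And>a j. M $ Inr a $ Inl j = N $ Inr a $ Inl j" "\<And>a b. M $ Inr a $ Inr b = N $ Inr a $ Inr b"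
  shows "M = N"
proof -
  have "M $ s $ t = N $ s $ t" for s t
    using assms by (cases s; cases t) auto
  then show ?thesis by (simp add: vec_eq_iff)
qed

lemma block_mult:
  fixes A :: "'r::comm_ring_1^'a^'a" and D :: "'r^'b^'b"
  shows "block A B C D ** block A' B' C' D'
    = block (A ** A' + B ** C') (A ** B' + B ** D') (C ** A' + D ** C') (C ** B' + D ** D')"
  by (rule block_eqI) (simp_all add: matrix_matrix_mult_def sum_UNIV_Plus)

lemma det_block_left:
  fixes A :: "'r::comm_ring_1^'a^'a" and C :: "'r^'a^'b"
  shows "det (block A 0 C (mat 1)) = det A"
proof -
  have "det (block A 0 C (mat 1)) = det (\<chi> i j. block A 0 C (mat 1) $ Inl i $ Inl j)"
  proof (rule det_extend)
    fix i :: 'a and t :: "'a + 'b" assume "t \<notin> range Inl"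
    then show "block A 0 C (mat 1) $ Inl i $ t = 0" by (cases t) auto
  next
    fix s t :: "'a + 'b" assume "s \<notin> range Inl" "t \<notin> range Inl"
    then show "block A 0 C (mat 1) $ s $ t = (if s = t then 1 else 0)"
      by (cases s; cases t) (auto simp: mat_def)
  qed simp
  then show ?thesis by simp
qed

lemma det_block_right:
  fixes D :: "'r::comm_ring_1^'b^'b"
  shows "det (block (mat 1 :: 'r^'a^'a) 0 0 D) = det D"
proof -
  have "det (block (mat 1 :: 'r^'a^'a) 0 0 D) = det (\<chi> i j. block (mat 1 :: 'r^'a^'a) 0 0 D $ Inr i $ Inr j)"
  proof (rule det_extend)
    fix i :: 'b and t :: "'a + 'b" assume "t \<notin> range Inr"
    then show "block (mat 1 :: 'r^'a^'a) 0 0 D $ Inr i $ t = 0" by (cases t) auto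
  next
    fix s t :: "'a + 'b" assume "s \<notin> range Inr" "t \<notin> range Inr"
    then show "block (mat 1 :: 'r^'a^'a) 0 0 D $ s $ t = (if s = t then 1 else 0)"
      by (cases s; cases t) (auto simp: mat_def)
  qed simp
  then show ?thesis by simp
qed

lemma det_block_lower:
  fixes A :: "'r::comm_ring_1^'a^'a" and D :: "'r^'b^'b"
  shows "det (block A 0 C D) = det A * det D"
proof -
  have "block A 0 C D = block A 0 C (mat 1) ** block (mat 1) 0 0 D"
    by (simp add: block_mult)
  then show ?thesis by (simp add: det_mul det_block_left det_block_right)
qed

lemma transpose_block:
  "Finite_Cartesian_Product.transpose (block A B C D)
     = block (Finite_Cartesian_Product.transpose A) (Finite_Cartesian_Product.transpose C)
         (Finite_Cartesian_Product.transpose B) (Finite_Cartesian_Product.transpose D)"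
  by (rule block_eqI) (simp_all add: Finite_Cartesian_Product.transpose_def)

lemma det_block_upper:
  fixes A :: "'r::comm_ring_1^'a^'a" and D :: "'r^'b^'b"
  shows "det (block A B 0 D) = det A * det D"
proof -
  have "Finite_Cartesian_Product.transpose (0 :: 'r^'a^'b) = 0"
    by (simp add: Finite_Cartesian_Product.transpose_def vec_eq_iff)
  then have "det (Finite_Cartesian_Product.transpose (block A B 0 D)) = det A * det D"
    by (simp add: transpose_block det_block_lower del: det_transpose) (simp add: det_transpose)
  then show ?thesis by (simp add: det_transpose)
qed

text \<open>The Schur complement in multiplicative form, with unipotent outer factors.\<close>

lemma block_schur:
  fixes S :: "'r::comm_ring_1^'a^'a" and V :: "'r^'b^'b"
  shows "block (S + P ** V ** Q) (P ** V) (V ** Q) V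
     = block (mat 1) P 0 (mat 1) ** block S 0 0 V ** block (mat 1) 0 Q (mat 1)"
  by (simp add: block_mult)

lemma det_block_schur:
  fixes S :: "'r::comm_ring_1^'a^'a" and V :: "'r^'b^'b"
  shows "det (block (S + P ** V ** Q) (P ** V) (V ** Q) V) = det S * det V"
  by (simp add: block_schur det_mul det_block_lower det_block_upper)

text \<open>The summand \<^typ>\<open>unit\<close> is the index of the border.\<close>

definition bordered :: "'r \<Rightarrow> 'r^'b \<Rightarrow> 'r^'b \<Rightarrow> 'r^'b^'b \<Rightarrow> 'r^(unit + 'b)^(unit + 'b)" where
  "bordered a R C H = block (\<chi> i j. a) (\<chi> i. R) (\<chi> j i. C $ j) H"

lemma bordered_nth [simp]:
  "bordered a R C H $ Inl i $ Inl j = a" "bordered a R C H $ Inl i $ Inr k = R $ k"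
  "bordered a R C H $ Inr l $ Inl j = C $ l" "bordered a R C H $ Inr l $ Inr k = H $ l $ k"
  by (simp_all add: bordered_def)

lemma det_unit: "det (A :: 'r::comm_ring_1^unit^unit) = A $ () $ ()"
proof -
  have "p = id" if "p permutes (UNIV :: unit set)" for p by auto
  then have "{p. p permutes (UNIV :: unit set)} = {id}" by auto
  then show ?thesis by (simp add: det_def UNIV_unit)
qed

text \<open>On a vector bundle the border is grouped with the fibre variables: after this reordering of
  the indices the horizontal directions split off as a Schur complement.\<close>

lemma det_fibred_schur:
  fixes M :: "'r::comm_ring_1^(unit + ('n::finite + 'k::finite))^(unit + ('n + 'k))"
    and S :: "'r^'n^'n" and P :: "'r^(unit + 'k)^'n" and V :: "'r^(unit + 'k)^(unit + 'k)" and Q :: "'r^'n^(unit + 'k)"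
  assumes M: "(\<chi> x y. M $ (case x of Inl i \<Rightarrow> Inr (Inl i) | Inr (Inl u) \<Rightarrow> Inl u | Inr (Inr a) \<Rightarrow> Inr (Inr a))
                       $ (case y of Inl i \<Rightarrow> Inr (Inl i) | Inr (Inl u) \<Rightarrow> Inl u | Inr (Inr a) \<Rightarrow> Inr (Inr a)))
         = block (S + P ** V ** Q) (P ** V) (V ** Q) V"
  shows "det M = det S * det V"
proof -
  let ?s = "\<lambda>x :: 'n + (unit + 'k). case x of Inl i \<Rightarrow> Inr (Inl i) | Inr (Inl u) \<Rightarrow> Inl u | Inr (Inr a) \<Rightarrow> Inr (Inr a)"
  have bij: "bij ?s"
  proof (rule bijI)
    show "inj ?s" by (rule injI) (auto split: sum.splits)
    show "surj ?s"
    proof (rule surjI[where f = "\<lambda>y. case y of Inl u \<Rightarrow> Inr (Inl u) | Inr (Inl i) \<Rightarrow> Inl i | Inr (Inr a) \<Rightarrow> Inr (Inr a)"])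
      show "?s (case y of Inl u \<Rightarrow> Inr (Inl u) | Inr (Inl i) \<Rightarrow> Inl i | Inr (Inr a) \<Rightarrow> Inr (Inr a)) = y" for y
        by (auto split: sum.splits)
    qed
  qed
  have "det M = det (\<chi> x y. M $ ?s x $ ?s y)" by (rule det_reindex[OF bij, symmetric])
  also have "\<dots> = det S * det V" unfolding M by (rule det_block_schur)
  finally show ?thesis .
qed

lemma det_scale:
  fixes A :: "'r::comm_ring_1^'n^'n"
  shows "det (\<chi> i j. c * A $ i $ j) = c ^ CARD('n) * det A"
  using det_rows_mul[of "\<lambda>i. c" "\<lambda>i. A $ i"] by (simp add: vector_scalar_mult_def)

text \<open>The vertical block for a function of \<open>r\<close>. Subtracting the border row,
  multiplied by \<open>b / a\<close> and the entries of \<open>c\<close>, from the other rows removes the term of rank one. Since \<open>c'\<close> is \<open>\<xi> h\<close>, the border row is then cleared by the Euler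
  combination of the other rows with coefficients \<open>\<xi>\<close>.\<close>

lemma det_bordered_radial:
  fixes h :: "complex^'k^'k" and \<xi> \<xi>' :: "complex^'k"
  assumes a: "a \<noteq> 0"
    and c: "\<And>\<alpha>. c $ \<alpha> = (\<Sum>\<beta>\<in>UNIV. h $ \<alpha> $ \<beta> * \<xi>' $ \<beta>)"
    and c': "\<And>\<beta>. c' $ \<beta> = (\<Sum>\<alpha>\<in>UNIV. \<xi> $ \<alpha> * h $ \<alpha> $ \<beta>)"
    and r: "r = (\<Sum>\<alpha>\<in>UNIV. \<xi> $ \<alpha> * c $ \<alpha>)"
  shows "det (bordered G (\<chi> \<beta>. a * c' $ \<beta>) (\<chi> \<alpha>. a * c $ \<alpha>) (\<chi> \<alpha> \<beta>. b * c $ \<alpha> * c' $ \<beta> + a * h $ \<alpha> $ \<beta>))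
       = (G - a * r + b / a * G * r) * a ^ CARD('k) * det h"
proof -
  let ?t = "b / a"
  let ?V = "(\<chi> \<alpha> \<beta>. a * h $ \<alpha> $ \<beta>) :: complex^'k^'k"
  let ?P = "(\<chi> u. \<xi>) :: complex^'k^unit"
  let ?Q = "(\<chi> \<beta> u. (a - ?t * G) / a * \<xi>' $ \<beta>) :: complex^unit^'k"
  let ?S = "(\<chi> u v. G - (a - ?t * G) * r) :: complex^unit^unit"
  let ?L = "block (mat 1) 0 (\<chi> \<alpha> u. ?t * c $ \<alpha>) (mat 1) :: complex^(unit + 'k)^(unit + 'k)"
  have PV: "?P ** ?V = (\<chi> u \<beta>. a * c' $ \<beta>)"
    by (simp add: vec_eq_iff matrix_matrix_mult_def c' sum_distrib_left algebra_simps)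
  have VQ: "?V ** ?Q = (\<chi> \<alpha> u. (a - ?t * G) * c $ \<alpha>)"
    using a by (simp add: vec_eq_iff matrix_matrix_mult_def c sum_distrib_left mult_ac)
  have PVQ: "?P ** ?V ** ?Q = (\<chi> u v. (a - ?t * G) * r)"
    unfolding matrix_mul_assoc[symmetric] VQ
    by (simp add: vec_eq_iff matrix_matrix_mult_def r sum_distrib_left mult_ac)
  have "det (block (?S + ?P ** ?V ** ?Q) (?P ** ?V) (?V ** ?Q) ?V) = det ?S * det ?V"
    by (rule det_block_schur)
  moreover have "block (?S + ?P ** ?V ** ?Q) (?P ** ?V) (?V ** ?Q) ?V
     = bordered G (\<chi> \<beta>. a * c' $ \<beta>) (\<chi> \<alpha>. (a - ?t * G) * c $ \<alpha>) ?V"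
    by (subst PVQ, subst PV, subst VQ, rule block_eqI) simp_all
  moreover have "bordered G (\<chi> \<beta>. a * c' $ \<beta>) (\<chi> \<alpha>. a * c $ \<alpha>) (\<chi> \<alpha> \<beta>. b * c $ \<alpha> * c' $ \<beta> + a * h $ \<alpha> $ \<beta>)
     = ?L ** bordered G (\<chi> \<beta>. a * c' $ \<beta>) (\<chi> \<alpha>. (a - ?t * G) * c $ \<alpha>) ?V"
    using a by (intro block_eqI) (simp_all add: matrix_matrix_mult_def sum_UNIV_Plus UNIV_unit mat_def
        if_distrib[where f = "\<lambda>x. x * _"] field_simps cong: if_cong)
  moreover have "det ?L = 1" by (simp add: det_block_lower)
  ultimately show ?thesis
    by (simp add: det_mul det_scale) (simp add: det_unit algebra_simps)
qed

section \<open>Smooth functions\<close>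

lemma higher_diff_subset: "higher_differentiable_on m f S \<Longrightarrow> T \<subseteq> S \<Longrightarrow> higher_differentiable_on m f T"
  by (induction m arbitrary: f) (auto intro: continuous_on_subset)

lemma higher_diff_cong:
  assumes "open S"
  shows "higher_differentiable_on m f S \<Longrightarrow> (\<And>x. x \<in> S \<Longrightarrow> f x = g x) \<Longrightarrow> higher_differentiable_on m g S"
proof (induction m arbitrary: f g)
  case 0
  then show ?case by (auto cong: continuous_on_cong)
next
  case (Suc m)
  have diff: "g differentiable (at x)" if "x \<in> S" for x
  proof -
    have "(f has_derivative frechet_derivative f (at x)) (at x)"
      using Suc.prems(1) that by (simp add: frechet_derivative_works)
    then have "(g has_derivative frechet_derivative f (at x)) (at x)"
      by (rule has_derivative_transform_within_open[OF _ assms that]) (use Suc.prems in auto)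
    then show ?thesis by (auto simp: differentiable_def)
  qed
  have eq: "frechet_derivative f (at x) v = frechet_derivative g (at x) v" if "x \<in> S" for x v
    using frechet_derivative_transform_within_open[OF _ assms that, of f g] Suc.prems that by auto
  show ?case
    using Suc.prems(1) diff Suc.IH[OF _ eq] by auto
qed

lemma higher_diff_SucD: "higher_differentiable_on (Suc m) f S \<Longrightarrow> higher_differentiable_on m f S"
proof (induction m arbitrary: f)
  case 0
  then show ?case
    by (auto intro!: differentiable_imp_continuous_on differentiable_at_imp_differentiable_on)
next
  case (Suc m)
  then show ?case by auto
qed

lemma higher_diff_SucI:
  assumes S: "open S"
    and f: "\<And>x. x \<in> S \<Longrightarrow> (f has_derivative D x) (at x)"
    and D: "\<And>v. higher_differentiable_on m (\<lambda>x. D x v) S"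
  shows "higher_differentiable_on (Suc m) f S"
proof -
  have "higher_differentiable_on m (\<lambda>x. frechet_derivative f (at x) v) S" for v
    by (rule higher_diff_cong[OF S D[of v]]) (metis f frechet_derivative_at)
  then show ?thesis using f by (auto simp: differentiable_def)
qed

lemma higher_diff_has_derivative:
  "higher_differentiable_on (Suc m) f S \<Longrightarrow> x \<in> S \<Longrightarrow> (f has_derivative frechet_derivative f (at x)) (at x)"
  by (simp add: frechet_derivative_works)

lemma higher_diff_const: "open S \<Longrightarrow> higher_differentiable_on m (\<lambda>x. c) S"
proof (induction m arbitrary: c)
  case (Suc m)
  show ?case
    by (rule higher_diff_SucI[OF Suc.prems, where D = "\<lambda>x v. 0"]) (use Suc in auto)
qed auto

lemma higher_diff_bounded_linear:
  assumes "bounded_linear L" and S: "open S"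
  shows "higher_differentiable_on m L S"
proof (cases m)
  case 0
  then show ?thesis using assms by (simp add: linear_continuous_on)
next
  case (Suc n)
  show ?thesis unfolding Suc
    by (rule higher_diff_SucI[OF S, where D = "\<lambda>x. L"])
       (use assms in \<open>auto intro: bounded_linear_imp_has_derivative higher_diff_const\<close>)
qed

lemma higher_diff_add:
  assumes S: "open S"
  shows "higher_differentiable_on m f S \<Longrightarrow> higher_differentiable_on m g S
    \<Longrightarrow> higher_differentiable_on m (\<lambda>x. f x + g x) S"
proof (induction m arbitrary: f g)
  case 0
  then show ?case by (auto intro: continuous_intros)
next
  case (Suc m)
  show ?case
    by (rule higher_diff_SucI[OF S, where D = "\<lambda>x v. frechet_derivative f (at x) v + frechet_derivative g (at x) v"])
       (use Suc in \<open>auto intro!: derivative_intros higher_diff_has_derivative\<close>)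
qed

lemma higher_diff_linear_comp:
  assumes L: "bounded_linear L" and S: "open S"
  shows "higher_differentiable_on m f S \<Longrightarrow> higher_differentiable_on m (\<lambda>x. L (f x)) S"
proof (induction m arbitrary: f)
  case 0
  then show ?case using L by (auto intro: bounded_linear.continuous_on)
next
  case (Suc m)
  show ?case
    by (rule higher_diff_SucI[OF S, where D = "\<lambda>x v. L (frechet_derivative f (at x) v)"])
       (use Suc in \<open>auto intro!: bounded_linear.has_derivative[OF L] higher_diff_has_derivative\<close>)
qed

lemma higher_diff_bilinear:
  assumes B: "bounded_bilinear B" and S: "open S"
  shows "higher_differentiable_on m f S \<Longrightarrow> higher_differentiable_on m g S
    \<Longrightarrow> higher_differentiable_on m (\<lambda>x. B (f x) (g x)) S"
proof (induction m arbitrary: f g)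
  case 0
  then show ?case using B by (auto intro: bounded_bilinear.continuous_on)
next
  case (Suc m)
  show ?case
  proof (rule higher_diff_SucI[OF S, where D = "\<lambda>x v. B (f x) (frechet_derivative g (at x) v)
            + B (frechet_derivative f (at x) v) (g x)"])
    show "((\<lambda>x. B (f x) (g x)) has_derivative (\<lambda>v. B (f x) (frechet_derivative g (at x) v)
            + B (frechet_derivative f (at x) v) (g x))) (at x)" if "x \<in> S" for x
      using that Suc.prems by (intro bounded_bilinear.FDERIV[OF B] higher_diff_has_derivative) auto
    show "higher_differentiable_on m (\<lambda>x. B (f x) (frechet_derivative g (at x) v)
            + B (frechet_derivative f (at x) v) (g x)) S" for v
      using Suc.prems by (intro higher_diff_add[OF S] Suc.IH higher_diff_SucD[of m f] higher_diff_SucD[of m g]) auto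
  qed
qed

lemma higher_diff_sum:
  assumes S: "open S"
  shows "(\<And>i. i \<in> I \<Longrightarrow> higher_differentiable_on m (f i) S)
    \<Longrightarrow> higher_differentiable_on m (\<lambda>x. \<Sum>i\<in>I. f i x) S"
  by (induction I rule: infinite_finite_induct) (auto intro: higher_diff_const[OF S] higher_diff_add[OF S])

text \<open>The differential of the composition is expanded in an orthonormal basis, so that the induction
  hypothesis applies to the directional derivatives of \<open>g\<close> along fixed vectors.\<close>

lemma higher_diff_compose:
  fixes f :: "'a::real_normed_vector \<Rightarrow> 'b::euclidean_space" and g :: "'b \<Rightarrow> 'c::real_normed_vector"
  assumes S: "open S" and T: "open T"
  shows "higher_differentiable_on m g T \<Longrightarrow> higher_differentiable_on m f S \<Longrightarrow> f ` S \<subseteq> T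
    \<Longrightarrow> higher_differentiable_on m (\<lambda>x. g (f x)) S"
proof (induction m arbitrary: g)
  case 0
  then show ?case by (auto intro: continuous_on_compose2)
next
  case (Suc m)
  let ?D = "\<lambda>x v. \<Sum>b\<in>Basis. (frechet_derivative f (at x) v \<bullet> b) *\<^sub>R frechet_derivative g (at (f x)) b"
  show ?case
  proof (rule higher_diff_SucI[OF S, where D = ?D])
    fix x assume x: "x \<in> S"
    have g': "(g has_derivative frechet_derivative g (at (f x))) (at (f x))"
      using Suc.prems x by (intro higher_diff_has_derivative) auto
    have f': "(f has_derivative frechet_derivative f (at x)) (at x)"
      using Suc.prems x by (intro higher_diff_has_derivative) auto
    have chain: "((\<lambda>x. g (f x)) has_derivative
        (\<lambda>v. frechet_derivative g (at (f x)) (frechet_derivative f (at x) v))) (at x)"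
      using has_derivative_compose[of f "frechet_derivative f (at x)" x UNIV g] f' g' by simp
    have lin: "frechet_derivative g (at (f x)) w = (\<Sum>b\<in>Basis. (w \<bullet> b) *\<^sub>R frechet_derivative g (at (f x)) b)" for w
    proof -
      interpret bounded_linear "frechet_derivative g (at (f x))"
        using g' by (rule has_derivative_bounded_linear)
      have "frechet_derivative g (at (f x)) (\<Sum>b\<in>Basis. (w \<bullet> b) *\<^sub>R b)
        = (\<Sum>b\<in>Basis. (w \<bullet> b) *\<^sub>R frechet_derivative g (at (f x)) b)"
        by (simp only: sum scaleR)
      then show ?thesis by (simp only: euclidean_representation)
    qed
    have "(\<lambda>v. frechet_derivative g (at (f x)) (frechet_derivative f (at x) v)) = ?D x"
      by (rule ext, rule lin)
    with chain show "((\<lambda>x. g (f x)) has_derivative ?D x) (at x)" by (simp only:)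
  next
    fix v
    show "higher_differentiable_on m (\<lambda>x. ?D x v) S"
    proof (intro higher_diff_sum[OF S] higher_diff_bilinear[OF bounded_bilinear_scaleR S])
      fix b :: 'b
      show "higher_differentiable_on m (\<lambda>x. frechet_derivative f (at x) v \<bullet> b) S"
        using Suc.prems by (intro higher_diff_linear_comp[OF bounded_linear_inner_left S]) auto
      show "higher_differentiable_on m (\<lambda>x. frechet_derivative g (at (f x)) b) S"
        using Suc.prems(1) higher_diff_SucD[OF Suc.prems(2)] Suc.prems(3) by (intro Suc.IH) auto
    qed
  qed
qed

lemma higher_diff_SucI_field:
  fixes f :: "'a::real_normed_field \<Rightarrow> 'a"
  assumes S: "open S"
    and f: "\<And>x. x \<in> S \<Longrightarrow> (f has_field_derivative D x) (at x)"
    and D: "higher_differentiable_on m D S"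
  shows "higher_differentiable_on (Suc m) f S"
  by (rule higher_diff_SucI[OF S, where D = "\<lambda>x v. D x * v"])
     (use assms in \<open>auto simp: has_field_derivative_def intro!: higher_diff_linear_comp[OF bounded_linear_mult_left]\<close>)

lemma higher_diff_inverse: "higher_differentiable_on m (inverse :: 'a::real_normed_field \<Rightarrow> 'a) (- {0})"
proof (induction m)
  case 0
  then show ?case by (auto intro!: continuous_intros)
next
  case (Suc m)
  have o: "open (- {0::'a})" by auto
  show ?case
  proof (rule higher_diff_SucI_field[OF o])
    show "(inverse has_field_derivative - (inverse x * inverse x)) (at x)" if "x \<in> - {0}" for x :: 'a
      using that DERIV_inverse[of x UNIV] by (simp add: numeral_2_eq_2)
    show "higher_differentiable_on m (\<lambda>x::'a. - (inverse x * inverse x)) (- {0})"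
      by (rule higher_diff_linear_comp[OF bounded_linear_minus[OF bounded_linear_ident] o
           higher_diff_bilinear[OF bounded_bilinear_mult o Suc.IH Suc.IH]])
  qed
qed

lemma higher_diff_ln: "higher_differentiable_on m (ln :: real \<Rightarrow> real) {0<..}"
proof (cases m)
  case 0
  then show ?thesis by (auto intro!: continuous_intros)
next
  case (Suc n)
  have "higher_differentiable_on n (inverse :: real \<Rightarrow> real) {0<..}"
    by (rule higher_diff_subset[OF higher_diff_inverse]) auto
  then show ?thesis
    unfolding Suc by (rule higher_diff_SucI_field[rotated 2]) (auto intro: DERIV_ln)
qed

lemma higher_diff_exp: "higher_differentiable_on m (exp :: real \<Rightarrow> real) UNIV"
proof (induction m)
  case 0
  show ?case unfolding higher_differentiable_on.simps(1) by (rule continuous_on_exp[OF continuous_on_id])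
next
  case (Suc m)
  show ?case by (rule higher_diff_SucI_field[OF open_UNIV DERIV_exp Suc.IH])
qed

lemma smooth_on_subset: "smooth_on S f \<Longrightarrow> T \<subseteq> S \<Longrightarrow> smooth_on T f"
  unfolding smooth_on_def by (meson higher_diff_subset)

lemma smooth_on_cong: "open S \<Longrightarrow> smooth_on S f \<Longrightarrow> (\<And>x. x \<in> S \<Longrightarrow> f x = g x) \<Longrightarrow> smooth_on S g"
  by (simp add: smooth_on_def higher_diff_cong[of S _ f g])

lemma smooth_on_const: "open S \<Longrightarrow> smooth_on S (\<lambda>x. c)"
  by (simp add: smooth_on_def higher_diff_const)

lemma smooth_on_add: "open S \<Longrightarrow> smooth_on S f \<Longrightarrow> smooth_on S g \<Longrightarrow> smooth_on S (\<lambda>x. f x + g x)"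
  by (simp add: smooth_on_def higher_diff_add)

lemma smooth_on_sum: "open S \<Longrightarrow> (\<And>i. i \<in> I \<Longrightarrow> smooth_on S (f i)) \<Longrightarrow> smooth_on S (\<lambda>x. \<Sum>i\<in>I. f i x)"
  by (simp add: smooth_on_def higher_diff_sum)

lemma smooth_on_linear:
  "bounded_linear L \<Longrightarrow> open S \<Longrightarrow> smooth_on S f \<Longrightarrow> smooth_on S (\<lambda>x. L (f x))"
  by (simp add: smooth_on_def higher_diff_linear_comp)

lemma smooth_on_bounded_linear: "bounded_linear L \<Longrightarrow> open S \<Longrightarrow> smooth_on S L"
  by (simp add: smooth_on_def higher_diff_bounded_linear)

lemma smooth_on_mult:
  fixes f g :: "'a::real_normed_vector \<Rightarrow> 'b::real_normed_algebra"
  shows "open S \<Longrightarrow> smooth_on S f \<Longrightarrow> smooth_on S g \<Longrightarrow> smooth_on S (\<lambda>x. f x * g x)"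
  by (simp add: smooth_on_def higher_diff_bilinear[OF bounded_bilinear_mult])

lemma smooth_on_compose:
  fixes f :: "'a::real_normed_vector \<Rightarrow> 'b::euclidean_space" and g :: "'b \<Rightarrow> 'c::real_normed_vector"
  shows "open S \<Longrightarrow> open T \<Longrightarrow> smooth_on T g \<Longrightarrow> smooth_on S f \<Longrightarrow> f ` S \<subseteq> T
    \<Longrightarrow> smooth_on S (\<lambda>x. g (f x))"
  by (simp add: smooth_on_def higher_diff_compose[of S T])

lemma smooth_on_minus: "open S \<Longrightarrow> smooth_on S f \<Longrightarrow> smooth_on S (\<lambda>x. - f x)"
  by (rule smooth_on_linear[OF bounded_linear_minus[OF bounded_linear_ident]])

lemma smooth_on_diff: "open S \<Longrightarrow> smooth_on S f \<Longrightarrow> smooth_on S g \<Longrightarrow> smooth_on S (\<lambda>x. f x - g x)"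
  using smooth_on_add[of S f "\<lambda>x. - g x"] smooth_on_minus[of S g] by simp

lemma smooth_on_prod:
  fixes f :: "'i \<Rightarrow> 'a::real_normed_vector \<Rightarrow> 'b::{real_normed_algebra,comm_ring_1}"
  assumes S: "open S"
  shows "(\<And>i. i \<in> I \<Longrightarrow> smooth_on S (f i)) \<Longrightarrow> smooth_on S (\<lambda>x. \<Prod>i\<in>I. f i x)"
  by (induction I rule: infinite_finite_induct) (auto intro: smooth_on_const[OF S] smooth_on_mult[OF S])

lemma smooth_on_inverse:
  fixes f :: "'a::real_normed_vector \<Rightarrow> 'b::{real_normed_field,euclidean_space}"
  assumes S: "open S" and "smooth_on S f" "\<And>x. x \<in> S \<Longrightarrow> f x \<noteq> 0"
  shows "smooth_on S (\<lambda>x. inverse (f x))"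
  by (rule smooth_on_compose[OF S, of "- {0}" inverse f]) (use assms in \<open>auto simp: smooth_on_def higher_diff_inverse\<close>)

lemma smooth_on_divide:
  fixes f :: "'a::real_normed_vector \<Rightarrow> 'b::{real_normed_field,euclidean_space}"
  assumes "open S" "smooth_on S f" "smooth_on S g" "\<And>x. x \<in> S \<Longrightarrow> g x \<noteq> 0"
  shows "smooth_on S (\<lambda>x. f x / g x)"
  using smooth_on_mult[OF assms(1,2) smooth_on_inverse[OF assms(1,3,4)]] by (simp add: divide_inverse)

lemma smooth_on_ln:
  fixes f :: "'a::real_normed_vector \<Rightarrow> real"
  assumes "open S" "smooth_on S f" "\<And>x. x \<in> S \<Longrightarrow> f x > 0"
  shows "smooth_on S (\<lambda>x. ln (f x))"
  by (rule smooth_on_compose[OF assms(1), of "{0<..}" ln f]) (use assms in \<open>auto simp: smooth_on_def higher_diff_ln\<close>)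

lemma smooth_on_exp:
  fixes f :: "'a::real_normed_vector \<Rightarrow> real"
  assumes "open S" "smooth_on S f"
  shows "smooth_on S (\<lambda>x. exp (f x))"
  by (rule smooth_on_compose[OF assms(1), of UNIV exp f]) (use assms in \<open>auto simp: smooth_on_def higher_diff_exp\<close>)

lemma smooth_on_det:
  fixes A :: "'a::real_normed_vector \<Rightarrow> complex^'k^'k"
  assumes S: "open S" and "\<And>\<alpha> \<beta>. smooth_on S (\<lambda>x. A x $ \<alpha> $ \<beta>)"
  shows "smooth_on S (\<lambda>x. det (A x))"
  unfolding det_def by (intro smooth_on_sum[OF S] smooth_on_mult[OF S] smooth_on_const[OF S] smooth_on_prod[OF S] assms)

lemma smooth_on_differentiable: "smooth_on S f \<Longrightarrow> x \<in> S \<Longrightarrow> f differentiable (at x)"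
  unfolding smooth_on_def by (metis higher_differentiable_on.simps(2))

lemma smooth_on_continuous: "smooth_on S f \<Longrightarrow> continuous_on S f"
  unfolding smooth_on_def by (metis higher_differentiable_on.simps(1))

lemma smooth_on_frechet: "smooth_on S f \<Longrightarrow> smooth_on S (\<lambda>x. frechet_derivative f (at x) v)"
  unfolding smooth_on_def by (metis higher_differentiable_on.simps(2))

lemma smooth_on_dz: "open S \<Longrightarrow> smooth_on S f \<Longrightarrow> smooth_on S (dz i f)"
  unfolding dz_def
  by (intro smooth_on_divide smooth_on_diff smooth_on_mult smooth_on_frechet smooth_on_const) auto

lemma smooth_on_dzbar: "open S \<Longrightarrow> smooth_on S f \<Longrightarrow> smooth_on S (dzbar i f)"
  unfolding dzbar_def
  by (intro smooth_on_divide smooth_on_add smooth_on_mult smooth_on_frechet smooth_on_const) auto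

section \<open>Wirtinger derivatives\<close>

lemma dz_eqI: "(f has_derivative D) (at z) \<Longrightarrow> dz i f z = (D (axis i 1) - \<i> * D (axis i \<i>)) / 2"
  unfolding dz_def using frechet_derivative_at by metis

lemma dzbar_eqI: "(f has_derivative D) (at z) \<Longrightarrow> dzbar i f z = (D (axis i 1) + \<i> * D (axis i \<i>)) / 2"
  unfolding dzbar_def using frechet_derivative_at by metis

lemma wirtinger_cong:
  assumes "open S" "z \<in> S" "\<And>x. x \<in> S \<Longrightarrow> f x = g x" "f differentiable (at z)"
  shows "dz i f z = dz i g z" "dzbar i f z = dzbar i g z"
  using frechet_derivative_transform_within_open[of f z S g] assms by (simp_all add: dz_def dzbar_def)

lemma wirtinger_const [simp]: "dz i (\<lambda>x. c) z = 0" "dzbar i (\<lambda>x. c) z = 0"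
  by (simp_all add: dz_def dzbar_def)

context
  fixes f g :: "complex^'a \<Rightarrow> complex" and z :: "complex^'a"
  assumes f: "f differentiable (at z)"
begin

lemma dz_cnj: "dz i (\<lambda>x. cnj (f x)) z = cnj (dzbar i f z)"
  and dzbar_cnj: "dzbar i (\<lambda>x. cnj (f x)) z = cnj (dz i f z)"
proof -
  have "(f has_derivative frechet_derivative f (at z)) (at z)" using f by (simp add: frechet_derivative_works)
  then have "((\<lambda>x. cnj (f x)) has_derivative (\<lambda>v. cnj (frechet_derivative f (at z) v))) (at z)"
    by (rule has_derivative_cnj)
  from dz_eqI[OF this] dzbar_eqI[OF this]
  show "dz i (\<lambda>x. cnj (f x)) z = cnj (dzbar i f z)" "dzbar i (\<lambda>x. cnj (f x)) z = cnj (dz i f z)"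
    by (simp_all add: dz_def dzbar_def)
qed

lemma dz_minus: "dz i (\<lambda>x. - f x) z = - dz i f z"
  and dzbar_minus: "dzbar i (\<lambda>x. - f x) z = - dzbar i f z"
proof -
  have "(f has_derivative frechet_derivative f (at z)) (at z)" using f by (simp add: frechet_derivative_works)
  then have "((\<lambda>x. - f x) has_derivative (\<lambda>v. - frechet_derivative f (at z) v)) (at z)"
    by (rule has_derivative_minus)
  note D = this
  show "dz i (\<lambda>x. - f x) z = - dz i f z" "dzbar i (\<lambda>x. - f x) z = - dzbar i f z"
    by (simp_all only: dz_eqI[OF D] dzbar_eqI[OF D]) (simp_all add: dz_def dzbar_def field_simps)
qed

context
  assumes g: "g differentiable (at z)"
begin

lemma dz_add: "dz i (\<lambda>x. f x + g x) z = dz i f z + dz i g z"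
  and dzbar_add: "dzbar i (\<lambda>x. f x + g x) z = dzbar i f z + dzbar i g z"
proof -
  have "(f has_derivative frechet_derivative f (at z)) (at z)" "(g has_derivative frechet_derivative g (at z)) (at z)"
    using f g by (simp_all add: frechet_derivative_works)
  note D = has_derivative_add[OF this]
  show "dz i (\<lambda>x. f x + g x) z = dz i f z + dz i g z" "dzbar i (\<lambda>x. f x + g x) z = dzbar i f z + dzbar i g z"
    by (simp_all only: dz_eqI[OF D] dzbar_eqI[OF D]) (simp_all add: dz_def dzbar_def field_simps)
qed

lemma dz_mult: "dz i (\<lambda>x. f x * g x) z = dz i f z * g z + f z * dz i g z"
  and dzbar_mult: "dzbar i (\<lambda>x. f x * g x) z = dzbar i f z * g z + f z * dzbar i g z"
proof -
  have "(f has_derivative frechet_derivative f (at z)) (at z)" "(g has_derivative frechet_derivative g (at z)) (at z)"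
    using f g by (simp_all add: frechet_derivative_works)
  note D = has_derivative_mult[OF this]
  show "dz i (\<lambda>x. f x * g x) z = dz i f z * g z + f z * dz i g z"
    "dzbar i (\<lambda>x. f x * g x) z = dzbar i f z * g z + f z * dzbar i g z"
    by (simp_all only: dz_eqI[OF D] dzbar_eqI[OF D]) (simp_all add: dz_def dzbar_def field_simps)
qed

end

end

lemma wirtinger_sum:
  fixes f :: "'i \<Rightarrow> complex^'a \<Rightarrow> complex"
  assumes "finite I" "\<And>s. s \<in> I \<Longrightarrow> f s differentiable (at z)"
  shows "dz i (\<lambda>x. \<Sum>s\<in>I. f s x) z = (\<Sum>s\<in>I. dz i (f s) z)"
    "dzbar i (\<lambda>x. \<Sum>s\<in>I. f s x) z = (\<Sum>s\<in>I. dzbar i (f s) z)"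
proof -
  have "((\<lambda>x. \<Sum>s\<in>I. f s x) has_derivative (\<lambda>v. \<Sum>s\<in>I. frechet_derivative (f s) (at z) v)) (at z)"
    by (rule has_derivative_sum) (use assms in \<open>simp add: frechet_derivative_works\<close>)
  note D = this
  show "dz i (\<lambda>x. \<Sum>s\<in>I. f s x) z = (\<Sum>s\<in>I. dz i (f s) z)"
    "dzbar i (\<lambda>x. \<Sum>s\<in>I. f s x) z = (\<Sum>s\<in>I. dzbar i (f s) z)"
    by (simp_all only: dz_eqI[OF D] dzbar_eqI[OF D]) (simp_all add: dz_def dzbar_def sum.distrib sum_subtractf sum_distrib_left flip: sum_divide_distrib)
qed

lemma wirtinger_real_chain:
  fixes u :: "complex^'a \<Rightarrow> real" and G :: "real \<Rightarrow> real"
  assumes u: "u differentiable (at z)" and G: "(G has_real_derivative G') (at (u z))"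
  shows "dz i (\<lambda>x. complex_of_real (G (u x))) z = of_real G' * dz i (\<lambda>x. of_real (u x)) z"
    "dzbar i (\<lambda>x. complex_of_real (G (u x))) z = of_real G' * dzbar i (\<lambda>x. of_real (u x)) z"
proof -
  have u': "(u has_derivative frechet_derivative u (at z)) (at z)"
    using u by (simp add: frechet_derivative_works)
  have "((\<lambda>x. G (u x)) has_derivative (\<lambda>v. frechet_derivative u (at z) v * G')) (at z)"
    using has_derivative_compose[of u "frechet_derivative u (at z)" z UNIV G "\<lambda>h. h * G'"] u' G
    by (simp add: has_field_derivative_def mult_commute_abs)
  note D = has_derivative_of_real[OF this, where ?'a = complex] and D0 = has_derivative_of_real[OF u', where ?'a = complex]
  show "dz i (\<lambda>x. complex_of_real (G (u x))) z = of_real G' * dz i (\<lambda>x. of_real (u x)) z"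
    by (simp only: dz_eqI[OF D] dz_eqI[OF D0]) (simp add: field_simps)
  show "dzbar i (\<lambda>x. complex_of_real (G (u x))) z = of_real G' * dzbar i (\<lambda>x. of_real (u x)) z"
    by (simp only: dzbar_eqI[OF D] dzbar_eqI[OF D0]) (simp add: field_simps)
qed

lemma cnj_dz_of_real:
  assumes "u differentiable (at z)"
  shows "cnj (dz i (\<lambda>x. complex_of_real (u x)) z) = dzbar i (\<lambda>x. of_real (u x)) z"
  using dzbar_cnj[of "\<lambda>x. of_real (u x)" z i] assms by (simp add: differentiable_def) (metis has_derivative_of_real)

lemma vec_complex_expansion:
  "v = (\<Sum>a\<in>UNIV. Re (v $ a) *\<^sub>R axis a 1 + Im (v $ a) *\<^sub>R axis a \<i>)"
  for v :: "complex^'a"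
proof -
  have "(\<Sum>a\<in>UNIV. Re (v $ a) *\<^sub>R axis a 1 + Im (v $ a) *\<^sub>R axis a \<i>) $ b = v $ b" for b
  proof -
    have "(\<Sum>a\<in>UNIV. Re (v $ a) *\<^sub>R axis a 1 + Im (v $ a) *\<^sub>R axis a \<i>) $ b
       = (\<Sum>a\<in>UNIV. if a = b then v $ b else 0)"
      by (simp only: sum_component) (rule sum.cong, auto simp: axis_def complex_eq_iff)
    then show ?thesis by simp
  qed
  then show ?thesis by (simp add: vec_eq_iff)
qed

text \<open>The decomposition of a real linear form into its complex linear and antilinear parts.\<close>

lemma linear_wirtinger:
  fixes D :: "complex^'a \<Rightarrow> complex"
  assumes "bounded_linear D"
  shows "D v = (\<Sum>a\<in>UNIV. (D (axis a 1) - \<i> * D (axis a \<i>)) / 2 * v $ a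
                    + (D (axis a 1) + \<i> * D (axis a \<i>)) / 2 * cnj (v $ a))"
proof -
  interpret bounded_linear D by fact
  have "D v = (\<Sum>a\<in>UNIV. Re (v $ a) *\<^sub>R D (axis a 1) + Im (v $ a) *\<^sub>R D (axis a \<i>))"
    by (subst vec_complex_expansion[of v]) (simp only: sum add scaleR)
  also have "\<dots> = (\<Sum>a\<in>UNIV. (D (axis a 1) - \<i> * D (axis a \<i>)) / 2 * v $ a
                    + (D (axis a 1) + \<i> * D (axis a \<i>)) / 2 * cnj (v $ a))"
    by (rule sum.cong) (auto simp: complex_eq_iff field_simps)
  finally show ?thesis .
qed

lemma frechet_wirtinger:
  fixes f :: "complex^'a \<Rightarrow> complex"
  assumes "f differentiable (at z)"
  shows "frechet_derivative f (at z) v = (\<Sum>a\<in>UNIV. dz a f z * v $ a + dzbar a f z * cnj (v $ a))"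
  unfolding dz_def dzbar_def
  by (rule linear_wirtinger) (meson assms frechet_derivative_works has_derivative_bounded_linear)

text \<open>There are no mixed terms because \<open>F'\<close> commutes with multiplication by \<open>\<i>\<close>.\<close>

lemma wirtinger_holomorphic_chain:
  fixes F :: "complex^'a \<Rightarrow> complex^'b" and f :: "complex^'b \<Rightarrow> complex"
  assumes F: "(F has_derivative F') (at x)" and lin: "\<And>c v. F' (c *s v) = c *s F' v"
    and f: "f differentiable (at (F x))"
  shows "dz j (\<lambda>x. f (F x)) x = (\<Sum>a\<in>UNIV. dz a f (F x) * F' (axis j 1) $ a)"
    "dzbar j (\<lambda>x. f (F x)) x = (\<Sum>a\<in>UNIV. dzbar a f (F x) * cnj (F' (axis j 1) $ a))"
proof -
  have ax: "axis j \<i> = \<i> *s (axis j 1 :: complex^'a)"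
    by (simp add: vec_eq_iff axis_def)
  have "(f has_derivative frechet_derivative f (at (F x))) (at (F x))"
    using f by (simp add: frechet_derivative_works)
  from has_derivative_compose[OF F this]
  have D: "((\<lambda>x. f (F x)) has_derivative (\<lambda>v. frechet_derivative f (at (F x)) (F' v))) (at x)" .
  let ?A = "\<Sum>a\<in>UNIV. dz a f (F x) * F' (axis j 1) $ a"
  let ?B = "\<Sum>a\<in>UNIV. dzbar a f (F x) * cnj (F' (axis j 1) $ a)"
  have 1: "frechet_derivative f (at (F x)) (F' (axis j 1)) = ?A + ?B"
    by (simp add: frechet_wirtinger[OF f] sum.distrib)
  have 2: "frechet_derivative f (at (F x)) (F' (axis j \<i>)) = \<i> * ?A - \<i> * ?B"
    by (simp add: frechet_wirtinger[OF f] ax lin sum_subtractf sum_distrib_left mult.left_commute)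
  show "dz j (\<lambda>x. f (F x)) x = ?A"
    by (simp only: dz_eqI[OF D] 1 2) (simp add: algebra_simps flip: mult.assoc)
  show "dzbar j (\<lambda>x. f (F x)) x = ?B"
    by (simp only: dzbar_eqI[OF D] 1 2) (simp add: algebra_simps flip: mult.assoc)
qed

lemma differentiable_nth: "(\<lambda>x. x $ j) differentiable (at z)"
  by (metis bounded_linear_imp_differentiable bounded_linear_vec_nth)

lemma wirtinger_coord:
  fixes z :: "complex^'a"
  shows "dz i (\<lambda>x. x $ j) z = (if i = j then 1 else 0)" "dzbar i (\<lambda>x. x $ j) z = 0"
proof -
  have D: "((\<lambda>x. x $ j) has_derivative (\<lambda>v. v $ j)) (at z)"
    by (rule bounded_linear_imp_has_derivative) (rule bounded_linear_vec_nth)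
  show "dz i (\<lambda>x. x $ j) z = (if i = j then 1 else 0)" "dzbar i (\<lambda>x. x $ j) z = 0"
    by (simp_all add: dz_eqI[OF D] dzbar_eqI[OF D] axis_def)
qed

text \<open>Clairaut's argument: the second difference over a parallelogram is symmetric in its two edges,
  and two applications of the mean value theorem express it by one of the mixed derivatives.\<close>

lemma second_difference_mvt:
  fixes f :: "'a::real_normed_vector \<Rightarrow> real"
  assumes h: "h > 0"
    and S: "\<And>s t. 0 \<le> s \<Longrightarrow> s \<le> h \<Longrightarrow> 0 \<le> t \<Longrightarrow> t \<le> h \<Longrightarrow> x + s *\<^sub>R u + t *\<^sub>R v \<in> S"
    and f: "\<And>y. y \<in> S \<Longrightarrow> f differentiable (at y)"
    and fu: "\<And>y. y \<in> S \<Longrightarrow> (\<lambda>w. frechet_derivative f (at w) u) differentiable (at y)"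
  shows "\<exists>s t. 0 \<le> s \<and> s \<le> h \<and> 0 \<le> t \<and> t \<le> h \<and>
     f (x + h *\<^sub>R u + h *\<^sub>R v) - f (x + h *\<^sub>R u) - f (x + h *\<^sub>R v) + f x
       = h * h * frechet_derivative (\<lambda>w. frechet_derivative f (at w) u) (at (x + s *\<^sub>R u + t *\<^sub>R v)) v"
proof -
  let ?a = "\<lambda>s. f (x + s *\<^sub>R u + h *\<^sub>R v) - f (x + s *\<^sub>R u)"
  let ?fu = "\<lambda>w. frechet_derivative f (at w) u"
  have d1: "((\<lambda>s. f (x + s *\<^sub>R u + t *\<^sub>R v)) has_real_derivative ?fu (x + s *\<^sub>R u + t *\<^sub>R v)) (at s)"
    if "0 \<le> s" "s \<le> h" "0 \<le> t" "t \<le> h" for s t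
  proof -
    have fd: "(f has_derivative frechet_derivative f (at (x + s *\<^sub>R u + t *\<^sub>R v))) (at (x + s *\<^sub>R u + t *\<^sub>R v))"
      using f S that by (simp add: frechet_derivative_works)
    have "((\<lambda>s. x + s *\<^sub>R u + t *\<^sub>R v) has_derivative (\<lambda>q. q *\<^sub>R u)) (at s)"
      by (auto intro!: derivative_eq_intros)
    from has_derivative_compose[OF this fd]
    have "((\<lambda>s. f (x + s *\<^sub>R u + t *\<^sub>R v)) has_derivative
        (\<lambda>q. frechet_derivative f (at (x + s *\<^sub>R u + t *\<^sub>R v)) (q *\<^sub>R u))) (at s)" .
    moreover have "frechet_derivative f (at (x + s *\<^sub>R u + t *\<^sub>R v)) (q *\<^sub>R u) = ?fu (x + s *\<^sub>R u + t *\<^sub>R v) * q" for q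
      using linear_scale[OF has_derivative_linear[OF fd]] by simp
    ultimately show ?thesis by (simp add: has_field_derivative_def)
  qed
  have "(?a has_real_derivative ?fu (x + s *\<^sub>R u + h *\<^sub>R v) - ?fu (x + s *\<^sub>R u)) (at s)" if "0 \<le> s" "s \<le> h" for s
    using DERIV_diff[OF d1[of s h] d1[of s 0]] that h by simp
  from MVT2[of 0 h ?a "\<lambda>s. ?fu (x + s *\<^sub>R u + h *\<^sub>R v) - ?fu (x + s *\<^sub>R u)"] this h
  obtain s where s: "0 < s" "s < h" "?a h - ?a 0 = (h - 0) * (?fu (x + s *\<^sub>R u + h *\<^sub>R v) - ?fu (x + s *\<^sub>R u))"
    by blast
  let ?b = "\<lambda>t. ?fu (x + s *\<^sub>R u + t *\<^sub>R v)"
  have d2: "(?b has_real_derivative frechet_derivative ?fu (at (x + s *\<^sub>R u + t *\<^sub>R v)) v) (at t)"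
    if "0 \<le> t" "t \<le> h" for t
  proof -
    have fd: "(?fu has_derivative frechet_derivative ?fu (at (x + s *\<^sub>R u + t *\<^sub>R v))) (at (x + s *\<^sub>R u + t *\<^sub>R v))"
      using fu S that s by (simp add: frechet_derivative_works[symmetric])
    have "((\<lambda>t. x + s *\<^sub>R u + t *\<^sub>R v) has_derivative (\<lambda>q. q *\<^sub>R v)) (at t)"
      by (auto intro!: derivative_eq_intros)
    from has_derivative_compose[OF this fd]
    have "(?b has_derivative
        (\<lambda>q. frechet_derivative ?fu (at (x + s *\<^sub>R u + t *\<^sub>R v)) (q *\<^sub>R v))) (at t)" .
    moreover have "frechet_derivative ?fu (at (x + s *\<^sub>R u + t *\<^sub>R v)) (q *\<^sub>R v)
       = frechet_derivative ?fu (at (x + s *\<^sub>R u + t *\<^sub>R v)) v * q" for q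
      using linear_scale[OF has_derivative_linear[OF fd]] by simp
    ultimately show ?thesis by (simp add: has_field_derivative_def)
  qed
  from MVT2[of 0 h ?b "\<lambda>t. frechet_derivative ?fu (at (x + s *\<^sub>R u + t *\<^sub>R v)) v"] d2 h
  obtain t where t: "0 < t" "t < h" "?b h - ?b 0 = (h - 0) * frechet_derivative ?fu (at (x + s *\<^sub>R u + t *\<^sub>R v)) v"
    by blast
  show ?thesis
    by (rule exI[of _ s], rule exI[of _ t]) (use s t in \<open>simp add: algebra_simps\<close>)
qed

lemma second_derivative_symmetric_real:
  fixes f :: "'a::real_normed_vector \<Rightarrow> real"
  assumes S: "open S" and f: "smooth_on S f" and x: "x \<in> S"
  shows "frechet_derivative (\<lambda>w. frechet_derivative f (at w) u) (at x) v
       = frechet_derivative (\<lambda>w. frechet_derivative f (at w) v) (at x) u"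
proof -
  define P where "P u v y = frechet_derivative (\<lambda>w. frechet_derivative f (at w) u) (at y) v" for u v y
  have cont: "continuous_on S (P u v)" for u v
    unfolding P_def by (intro smooth_on_continuous smooth_on_frechet f)
  have diff: "f differentiable (at y)" "(\<lambda>w. frechet_derivative f (at w) u) differentiable (at y)" if "y \<in> S" for y u
    using that f by (auto intro: smooth_on_differentiable smooth_on_frechet)
  have "dist (P u v x) (P v u x) < e" if e: "e > 0" for e
  proof -
    have "\<exists>d>0. \<forall>y\<in>S. dist y x < d \<longrightarrow> dist (P u v y) (P u v x) < e / 2" for u v
      using cont[of u v] x e unfolding continuous_on_iff by (meson half_gt_zero)
    then obtain d1 d2 where d: "d1 > 0" "d2 > 0"
      and d1: "\<And>y. y \<in> S \<Longrightarrow> dist y x < d1 \<Longrightarrow> dist (P u v y) (P u v x) < e / 2"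
      and d2: "\<And>y. y \<in> S \<Longrightarrow> dist y x < d2 \<Longrightarrow> dist (P v u y) (P v u x) < e / 2"
      by metis
    obtain d3 where d3: "d3 > 0" "ball x d3 \<subseteq> S" using S x open_contains_ball by blast
    \<comment> \<open>\<open>h\<close> is so small that the parallelogram with edges \<open>h u\<close> and \<open>h v\<close> lies in the ball of radius \<open>d\<close>\<close>
    define d where "d = min d1 (min d2 d3)"
    define h where "h = d / (2 * (norm u + norm v + 1))"
    have dpos: "d > 0" using d d3 by (simp add: d_def)
    have den: "norm u + norm v + 1 > 0" by (smt (verit) norm_ge_zero)
    have hpos: "h > 0" unfolding h_def using dpos den by simp
    have near: "dist (x + s *\<^sub>R u + t *\<^sub>R v) x < d" "dist (x + t *\<^sub>R v + s *\<^sub>R u) x < d"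
      if "0 \<le> s" "s \<le> h" "0 \<le> t" "t \<le> h" for s t
    proof -
      have "norm (s *\<^sub>R u + t *\<^sub>R v) \<le> h * norm u + h * norm v"
        using that by (intro norm_triangle_le add_mono) (auto intro: mult_right_mono)
      also have "\<dots> < 2 * (h * (norm u + norm v + 1))"
        using hpos by (simp add: algebra_simps) (smt (verit) hpos mult_nonneg_nonneg norm_ge_zero)
      also have "\<dots> = d" unfolding h_def using den by (simp add: divide_simps)
      finally show "dist (x + s *\<^sub>R u + t *\<^sub>R v) x < d" "dist (x + t *\<^sub>R v + s *\<^sub>R u) x < d"
        by (simp_all add: dist_norm algebra_simps)
    qed
    have inS: "y \<in> S" if "dist y x < d" for y
      using that d3 by (auto simp: d_def dist_commute mem_ball)
    obtain s t where st: "0 \<le> s" "s \<le> h" "0 \<le> t" "t \<le> h"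
      and e1: "f (x + h *\<^sub>R u + h *\<^sub>R v) - f (x + h *\<^sub>R u) - f (x + h *\<^sub>R v) + f x
       = h * h * P u v (x + s *\<^sub>R u + t *\<^sub>R v)"
      using second_difference_mvt[OF hpos, of x u v S f] near inS diff unfolding P_def by blast
    obtain s' t' where st': "0 \<le> s'" "s' \<le> h" "0 \<le> t'" "t' \<le> h"
      and e2: "f (x + h *\<^sub>R v + h *\<^sub>R u) - f (x + h *\<^sub>R v) - f (x + h *\<^sub>R u) + f x
       = h * h * P v u (x + s' *\<^sub>R v + t' *\<^sub>R u)"
      using second_difference_mvt[OF hpos, of x v u S f] near inS diff unfolding P_def by blast
    have "x + h *\<^sub>R u + h *\<^sub>R v = x + h *\<^sub>R v + h *\<^sub>R u" by simp
    with e1 e2 hpos have "P u v (x + s *\<^sub>R u + t *\<^sub>R v) = P v u (x + s' *\<^sub>R v + t' *\<^sub>R u)"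
      by (smt (verit) mult_cancel_left mult_pos_pos)
    moreover have "dist (P u v (x + s *\<^sub>R u + t *\<^sub>R v)) (P u v x) < e / 2"
      using near(1)[OF st] by (intro d1 inS) (auto simp: d_def)
    moreover have "dist (P v u (x + s' *\<^sub>R v + t' *\<^sub>R u)) (P v u x) < e / 2"
      using near(2)[OF st'(3,4,1,2)] by (intro d2 inS) (auto simp: d_def)
    ultimately show ?thesis unfolding dist_real_def by linarith
  qed
  then have "P u v x = P v u x" by (metis dist_pos_lt less_irrefl)
  then show ?thesis by (simp add: P_def)
qed

lemma frechet_linear_comp:
  assumes "bounded_linear L" "f differentiable (at x)"
  shows "frechet_derivative (\<lambda>w. L (f w)) (at x) v = L (frechet_derivative f (at x) v)"
  using bounded_linear.has_derivative[OF assms(1), of f "frechet_derivative f (at x)" "at x"] assms(2)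
    frechet_derivative_at frechet_derivative_works by metis

lemma second_derivative_symmetric:
  fixes f :: "'a::real_normed_vector \<Rightarrow> 'b::euclidean_space"
  assumes S: "open S" and f: "smooth_on S f" and x: "x \<in> S"
  shows "frechet_derivative (\<lambda>w. frechet_derivative f (at w) u) (at x) v
       = frechet_derivative (\<lambda>w. frechet_derivative f (at w) v) (at x) u"
proof (rule euclidean_eqI)
  fix b :: 'b
  have L: "bounded_linear (\<lambda>y::'b. y \<bullet> b)" by (rule bounded_linear_inner_left)
  have d: "g differentiable (at y)" if "smooth_on S g" "y \<in> S" for g :: "'a \<Rightarrow> 'b" and y
    using that by (rule smooth_on_differentiable)
  have eq: "frechet_derivative (\<lambda>w. frechet_derivative f (at w) u) (at x) v \<bullet> b
     = frechet_derivative (\<lambda>w. frechet_derivative (\<lambda>y. f y \<bullet> b) (at w) u) (at x) v" for u v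
  proof -
    have "frechet_derivative (\<lambda>w. frechet_derivative f (at w) u) (at x) v \<bullet> b
      = frechet_derivative (\<lambda>w. frechet_derivative f (at w) u \<bullet> b) (at x) v"
      by (rule frechet_linear_comp[OF L, symmetric]) (intro d smooth_on_frechet f x)
    also have "frechet_derivative (\<lambda>w. frechet_derivative f (at w) u \<bullet> b) (at x)
       = frechet_derivative (\<lambda>w. frechet_derivative (\<lambda>y. f y \<bullet> b) (at w) u) (at x)"
    proof (rule frechet_derivative_transform_within_open[OF _ S x])
      show "(\<lambda>w. frechet_derivative f (at w) u \<bullet> b) differentiable (at x)"
        by (intro smooth_on_differentiable[OF smooth_on_linear[OF L S]] smooth_on_frechet f x)
      show "frechet_derivative f (at w) u \<bullet> b = frechet_derivative (\<lambda>y. f y \<bullet> b) (at w) u" if "w \<in> S" for w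
        by (rule frechet_linear_comp[OF L, symmetric]) (intro d f that)
    qed
    finally show ?thesis .
  qed
  show "frechet_derivative (\<lambda>w. frechet_derivative f (at w) u) (at x) v \<bullet> b
      = frechet_derivative (\<lambda>w. frechet_derivative f (at w) v) (at x) u \<bullet> b"
    unfolding eq by (rule second_derivative_symmetric_real[OF S smooth_on_linear[OF L S f] x])
qed

section \<open>Hermitian forms and eigenvalues\<close>

lemma matrix_inv_works:
  fixes A :: "complex^'k^'k"
  assumes "det A \<noteq> 0"
  shows "A ** matrix_inv A = mat 1" "matrix_inv A ** A = mat 1"
  using assms invertible_det_nz[of A] someI_ex[of "\<lambda>A'. A ** A' = mat 1 \<and> A' ** A = mat 1"]
  by (auto simp: invertible_def matrix_inv_def)

text \<open>For \<open>q \<noteq> 0\<close> the matrix is \<open>- q (t - A g\<^sup>-\<^sup>1) g\<close> with \<open>t = - p / q\<close>, so its determinant is read off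
  from the characteristic polynomial.\<close>

lemma det_pencil_eigenvalues:
  fixes A g :: "complex^'n^'n"
  assumes ev: "ordered_eigenvalues (A ** matrix_inv g) ls" and g: "det g \<noteq> 0"
  shows "det (\<chi> i j. p * g $ i $ j + q * A $ i $ j) = det g * (\<Prod>l\<leftarrow>ls. p + q * complex_of_real l)"
proof (cases "q = 0")
  case True
  have "(\<Prod>l\<leftarrow>ls. p) = p ^ length ls" by (induction ls) auto
  with True ev show ?thesis by (simp add: det_scale ordered_eigenvalues_def)
next
  case False
  let ?t = "- p / q"
  let ?E = "A ** matrix_inv g"
  have Eg: "?E ** g = A" by (simp add: matrix_inv_works[OF g] flip: matrix_mul_assoc)
  have mt: "mat t ** g = (\<chi> i j. t * g $ i $ j)" for t
  proof -
    have "(\<Sum>k\<in>UNIV. mat t $ i $ k * g $ k $ j) = (\<Sum>k\<in>UNIV. if k = i then t * g $ i $ j else 0)" for i j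
      by (rule sum.cong) (auto simp: mat_def)
    then show ?thesis by (simp add: vec_eq_iff matrix_matrix_mult_def)
  qed
  have diff: "(mat ?t - ?E) ** g = mat ?t ** g - ?E ** g"
    by (simp add: matrix_matrix_mult_def vec_eq_iff algebra_simps sum_subtractf)
  have eq: "(\<chi> i j. - q * ((mat ?t - ?E) ** g) $ i $ j) = (\<chi> i j. p * g $ i $ j + q * A $ i $ j)"
    unfolding diff Eg mt using False by (simp add: vec_eq_iff field_simps)
  have "(- q) ^ length ls * (\<Prod>l\<leftarrow>ls. ?t - complex_of_real l) = (\<Prod>l\<leftarrow>ls. p + q * complex_of_real l)"
    by (induction ls) (use False in \<open>auto simp: field_simps\<close>)
  then show ?thesis
    using ev by (simp only: eq[symmetric] det_scale det_mul) (simp add: ordered_eigenvalues_def algebra_simps)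
qed

text \<open>The form polarizing \<open>sesq\<close>.\<close>

definition sesq2 :: "complex^'a^'a \<Rightarrow> complex^'a \<Rightarrow> complex^'a \<Rightarrow> complex" where
  "sesq2 A v w = (\<Sum>i\<in>UNIV. \<Sum>j\<in>UNIV. A $ i $ j * v $ i * cnj (w $ j))"

lemma sesq_conv_sesq2: "sesq A v = sesq2 A v v"
  by (simp add: sesq_def sesq2_def)

lemma sesq2_add_left: "sesq2 A (v + v') w = sesq2 A v w + sesq2 A v' w"
  and sesq2_add_right: "sesq2 A v (w + w') = sesq2 A v w + sesq2 A v w'"
  and sesq2_scale_left: "sesq2 A (c *s v) w = c * sesq2 A v w"
  and sesq2_scale_right: "sesq2 A v (c *s w) = cnj c * sesq2 A v w"
  by (simp_all add: sesq2_def algebra_simps sum.distrib sum_distrib_left)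

lemma sesq2_axis: "sesq2 A (axis i 1) (axis j 1) = A $ i $ j"
proof -
  have "sesq2 A (axis i 1) (axis j 1) = (\<Sum>p\<in>UNIV. \<Sum>q\<in>UNIV. if q = j then if p = i then A $ i $ j else 0 else 0)"
    unfolding sesq2_def by (intro sum.cong refl) (simp add: axis_def)
  then show ?thesis by simp
qed

text \<open>Polarization with \<open>v + w\<close> and \<open>v + \<i> w\<close>.\<close>

lemma sesq_determines:
  assumes "\<And>v. sesq A v = sesq B v"
  shows "A = B"
proof -
  have eq: "sesq2 A v v = sesq2 B v v" for v using assms by (simp add: sesq_conv_sesq2)
  have "sesq2 A v w = sesq2 B v w" for v w
  proof -
    have e1: "sesq2 M (v + w) (v + w) = sesq2 M v v + sesq2 M w w + (sesq2 M v w + sesq2 M w v)" for M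
      by (simp add: sesq2_add_left sesq2_add_right)
    have e2: "sesq2 M (v + \<i> *s w) (v + \<i> *s w) = sesq2 M v v + sesq2 M w w + \<i> * (sesq2 M w v - sesq2 M v w)" for M
      by (simp only: sesq2_add_left sesq2_add_right sesq2_scale_left sesq2_scale_right)
         (simp add: algebra_simps flip: mult.assoc)
    have 1: "sesq2 A v w + sesq2 A w v = sesq2 B v w + sesq2 B w v"
      using eq[of "v + w"] unfolding e1 eq by simp
    have 2: "sesq2 A w v - sesq2 A v w = sesq2 B w v - sesq2 B v w"
      using eq[of "v + \<i> *s w"] unfolding e2 eq by simp
    have "2 * sesq2 A v w = (sesq2 A v w + sesq2 A w v) - (sesq2 A w v - sesq2 A v w)" by simp
    also have "\<dots> = 2 * sesq2 B v w" unfolding 1 2 by simp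
    finally show ?thesis by simp
  qed
  then have "A $ i $ j = B $ i $ j" for i j by (metis sesq2_axis)
  then show ?thesis by (simp add: vec_eq_iff)
qed

lemma hermitian_cnj: "hermitian_matrix A \<Longrightarrow> cnj (A $ i $ j) = A $ j $ i"
  by (metis hermitian_matrix_def)

lemma sesq_hermitian_real:
  assumes "hermitian_matrix A"
  shows "Im (sesq A v) = 0"
proof -
  have "cnj (sesq A v) = (\<Sum>i\<in>UNIV. \<Sum>j\<in>UNIV. A $ j $ i * v $ j * cnj (v $ i))"
    unfolding sesq_def by (simp add: cnj_sum hermitian_cnj[OF assms] mult_ac)
  also have "\<dots> = sesq A v" unfolding sesq_def by (rule sum.swap)
  finally show ?thesis by (metis Reals_cnj_iff complex_is_Real_iff)
qed

definition pos_def :: "complex^'a^'a \<Rightarrow> bool" where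
  "pos_def A \<longleftrightarrow> hermitian_matrix A \<and> (\<forall>v. v \<noteq> 0 \<longrightarrow> Re (sesq A v) > 0)"

lemma pos_def_det_nonzero:
  assumes "pos_def A"
  shows "det A \<noteq> 0"
proof
  assume "det A = 0"
  then have "\<not> (\<exists>B. B ** A = mat 1)"
    using invertible_det_nz[of A] by (simp add: invertible_left_inverse)
  then obtain w where w: "A *v w = 0" "w \<noteq> 0" by (auto simp: matrix_left_invertible_ker)
  define v where "v = (\<chi> i. cnj (w $ i))"
  have "v \<noteq> 0" using w(2) by (auto simp: v_def vec_eq_iff)
  have "sesq A v = (\<Sum>i\<in>UNIV. v $ i * (A *v w) $ i)"
    by (simp add: sesq_def v_def matrix_vector_mult_def sum_distrib_left mult_ac)
  also have "\<dots> = 0" using w by simp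
  finally show False using assms \<open>v \<noteq> 0\<close> by (auto simp: pos_def_def)
qed

lemma hermitian_det_real:
  assumes "hermitian_matrix A"
  shows "Im (det A) = 0"
proof -
  have "cnj (det A) = det (\<chi> i j. cnj (A $ i $ j))"
    by (simp add: det_def cnj_sum cnj_prod)
  also have "(\<chi> i j. cnj (A $ i $ j)) = Finite_Cartesian_Product.transpose A"
    by (simp add: vec_eq_iff Finite_Cartesian_Product.transpose_def hermitian_cnj[OF assms])
  finally have "cnj (det A) = det A" by (simp add: det_transpose)
  then show ?thesis by (metis Reals_cnj_iff complex_is_Real_iff)
qed

text \<open>The segment from the identity to \<open>A\<close> consists of positive definite and hence invertible
  matrices, so the determinant, being real, keeps its sign along the segment.\<close>

lemma pos_def_det_pos:
  fixes A :: "complex^'a^'a"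
  assumes A: "pos_def A"
  shows "Re (det A) > 0" "det A = complex_of_real (Re (det A))"
proof -
  define B where "B t = (\<chi> i j. complex_of_real (1 - t) * mat 1 $ i $ j + complex_of_real t * A $ i $ j)" for t
  have sq: "sesq (B t) v = complex_of_real (1 - t) * sesq (mat 1) v + complex_of_real t * sesq A v" for t v
    by (simp add: sesq_def B_def algebra_simps sum.distrib sum_distrib_left sum_subtractf)
  have s1: "sesq (mat 1 :: complex^'a^'a) v = complex_of_real (\<Sum>i\<in>UNIV. (cmod (v $ i))\<^sup>2)" for v
  proof -
    have "sesq (mat 1 :: complex^'a^'a) v = (\<Sum>i\<in>UNIV. \<Sum>j\<in>UNIV. if j = i then v $ i * cnj (v $ i) else 0)"
      unfolding sesq_def by (intro sum.cong refl) (auto simp: mat_def)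
    then show ?thesis by (simp add: complex_norm_square del: of_real_power)
  qed
  have pd: "pos_def (B t)" if t: "0 \<le> t" "t \<le> 1" for t
    unfolding pos_def_def
  proof (intro conjI allI impI)
    show "hermitian_matrix (B t)"
      unfolding hermitian_matrix_def
    proof (intro allI)
      fix i j
      have "cnj (A $ j $ i) = A $ i $ j" using A by (simp add: pos_def_def hermitian_cnj)
      then show "B t $ i $ j = cnj (B t $ j $ i)" by (simp add: B_def mat_def)
    qed
    fix v :: "complex^'a" assume v: "v \<noteq> 0"
    then obtain i where "v $ i \<noteq> 0" by (auto simp: vec_eq_iff)
    then have p1: "0 < (\<Sum>i\<in>UNIV. (cmod (v $ i))\<^sup>2)" by (intro sum_pos2[of _ i]) auto
    have p2: "Re (sesq A v) > 0" using A v by (simp add: pos_def_def)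
    have "Re (sesq (B t) v) = (1 - t) * (\<Sum>i\<in>UNIV. (cmod (v $ i))\<^sup>2) + t * Re (sesq A v)"
      by (simp add: sq s1)
    also have "\<dots> > 0"
      using t p1 p2 by (cases "t = 0") (auto intro!: add_nonneg_pos mult_nonneg_nonneg)
    finally show "Re (sesq (B t) v) > 0" .
  qed
  have cont: "continuous_on {0..1} (\<lambda>t. Re (det (B t)))"
    unfolding det_def B_def by (auto intro!: continuous_intros)
  have B0: "B 0 = mat 1" and B1: "B 1 = A" by (simp_all add: B_def vec_eq_iff)
  have nz: "Re (det (B t)) \<noteq> 0" if "0 \<le> t" "t \<le> 1" for t
    using pos_def_det_nonzero[OF pd[OF that]] hermitian_det_real[of "B t"] pd[OF that]
    by (auto simp: pos_def_def complex_eq_iff)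
  show "Re (det A) > 0"
  proof (rule ccontr)
    assume "\<not> ?thesis"
    then have "\<exists>t\<ge>0. t \<le> 1 \<and> Re (det (B t)) = 0"
      by (intro IVT2') (use cont B0 B1 in auto)
    with nz show False by auto
  qed
  show "det A = complex_of_real (Re (det A))"
    using A hermitian_det_real[of A] by (simp add: pos_def_def complex_eq_iff)
qed

section \<open>The complex Hessian of the logarithm of a determinant\<close>

lemma det_replace_row:
  fixes A :: "complex^'k^'k"
  assumes "det A \<noteq> 0"
  shows "det (\<chi> s. if s = \<alpha> then q else A $ s) = det A * (\<Sum>\<beta>\<in>UNIV. q $ \<beta> * matrix_inv A $ \<beta> $ \<alpha>)"
proof -
  define x where "x = q v* matrix_inv A"
  have "q = x v* A"
    unfolding x_def by (simp add: vector_matrix_mul_assoc matrix_inv_works[OF assms])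
  then have q: "q = (\<Sum>i\<in>UNIV. x $ i *s row i A)"
    by (simp add: vec_eq_iff vector_matrix_mult_def row_def sum_component mult.commute)
  have "(\<chi> s. if s = \<alpha> then q else A $ s) = (\<chi> i. if i = \<alpha> then \<Sum>i\<in>UNIV. x $ i *s row i A else row i A)"
    by (simp add: vec_eq_iff q row_def)
  then have "det (\<chi> s. if s = \<alpha> then q else A $ s) = x $ \<alpha> * det A"
    using cramer_lemma_transpose[of \<alpha> x A] by simp
  then show ?thesis by (simp add: x_def vector_matrix_mult_def mult.commute)
qed

text \<open>Jacobi's formula. The product rule replaces one row of \<open>A\<close> at a time by its derivative; each of
  the resulting determinants is given by Cramer's rule.\<close>

lemma has_derivative_det:
  fixes A :: "'a::real_normed_vector \<Rightarrow> complex^'k^'k"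
  assumes A: "\<And>\<alpha> \<beta>. ((\<lambda>x. A x $ \<alpha> $ \<beta>) has_derivative (\<lambda>v. A' v $ \<alpha> $ \<beta>)) (at z)"
    and nz: "det (A z) \<noteq> 0"
  shows "((\<lambda>x. det (A x)) has_derivative
      (\<lambda>v. det (A z) * (\<Sum>\<alpha>\<in>UNIV. \<Sum>\<beta>\<in>UNIV. matrix_inv (A z) $ \<beta> $ \<alpha> * A' v $ \<alpha> $ \<beta>))) (at z)"
proof -
  have "((\<lambda>x. det (A x)) has_derivative (\<lambda>v. \<Sum>p\<in>{p. p permutes UNIV}.
      of_int (sign p) * (\<Sum>\<alpha>\<in>UNIV. A' v $ \<alpha> $ p \<alpha> * (\<Prod>s\<in>UNIV - {\<alpha>}. A z $ s $ p s)))) (at z)"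
    unfolding det_def
    by (intro has_derivative_sum has_derivative_mult_right has_derivative_prod A)
  moreover have "(\<Sum>p\<in>{p. p permutes (UNIV::'k set)}.
      of_int (sign p) * (\<Sum>\<alpha>\<in>UNIV. A' v $ \<alpha> $ p \<alpha> * (\<Prod>s\<in>UNIV - {\<alpha>}. A z $ s $ p s)))
     = det (A z) * (\<Sum>\<alpha>\<in>UNIV. \<Sum>\<beta>\<in>UNIV. matrix_inv (A z) $ \<beta> $ \<alpha> * A' v $ \<alpha> $ \<beta>)" (is "?l = ?r") for v
  proof -
    have pr: "(\<Prod>s\<in>UNIV. (if s = \<alpha> then A' v $ \<alpha> else A z $ s) $ p s)
        = A' v $ \<alpha> $ p \<alpha> * (\<Prod>s\<in>UNIV - {\<alpha>}. A z $ s $ p s)" for p :: "'k \<Rightarrow> 'k" and \<alpha>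
      by (subst prod.remove[of UNIV \<alpha>]) (auto intro!: prod.cong)
    have "?l = (\<Sum>\<alpha>\<in>UNIV. \<Sum>p\<in>{p. p permutes (UNIV::'k set)}.
      of_int (sign p) * (A' v $ \<alpha> $ p \<alpha> * (\<Prod>s\<in>UNIV - {\<alpha>}. A z $ s $ p s)))"
      by (simp only: sum_distrib_left) (rule sum.swap)
    also have "\<dots> = (\<Sum>\<alpha>\<in>UNIV. det (\<chi> s. if s = \<alpha> then A' v $ \<alpha> else A z $ s))"
      by (simp add: det_def pr)
    also have "\<dots> = ?r"
      by (simp add: det_replace_row[OF nz] sum_distrib_left mult.commute)
    finally show ?thesis .
  qed
  ultimately show ?thesis by simp
qed

lemma wirtinger_det:
  fixes A :: "complex^'a \<Rightarrow> complex^'k^'k"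
  assumes A: "\<And>\<alpha> \<beta>. (\<lambda>x. A x $ \<alpha> $ \<beta>) differentiable (at z)" and nz: "det (A z) \<noteq> 0"
  shows "dz i (\<lambda>x. det (A x)) z
      = det (A z) * (\<Sum>\<alpha>\<in>UNIV. \<Sum>\<beta>\<in>UNIV. matrix_inv (A z) $ \<beta> $ \<alpha> * dz i (\<lambda>x. A x $ \<alpha> $ \<beta>) z)"
    "dzbar i (\<lambda>x. det (A x)) z
      = det (A z) * (\<Sum>\<alpha>\<in>UNIV. \<Sum>\<beta>\<in>UNIV. matrix_inv (A z) $ \<beta> $ \<alpha> * dzbar i (\<lambda>x. A x $ \<alpha> $ \<beta>) z)"
proof -
  let ?A' = "\<lambda>v. \<chi> \<alpha> \<beta>. frechet_derivative (\<lambda>x. A x $ \<alpha> $ \<beta>) (at z) v"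
  have "((\<lambda>x. A x $ \<alpha> $ \<beta>) has_derivative (\<lambda>v. ?A' v $ \<alpha> $ \<beta>)) (at z)" for \<alpha> \<beta>
    using A by (simp add: frechet_derivative_works[symmetric])
  note D = has_derivative_det[of A ?A', OF this nz]
  show "dz i (\<lambda>x. det (A x)) z
      = det (A z) * (\<Sum>\<alpha>\<in>UNIV. \<Sum>\<beta>\<in>UNIV. matrix_inv (A z) $ \<beta> $ \<alpha> * dz i (\<lambda>x. A x $ \<alpha> $ \<beta>) z)"
    by (simp only: dz_eqI[OF D])
       (simp add: dz_def algebra_simps sum_subtractf sum_distrib_left diff_divide_distrib flip: sum_divide_distrib)
  show "dzbar i (\<lambda>x. det (A x)) z
      = det (A z) * (\<Sum>\<alpha>\<in>UNIV. \<Sum>\<beta>\<in>UNIV. matrix_inv (A z) $ \<beta> $ \<alpha> * dzbar i (\<lambda>x. A x $ \<alpha> $ \<beta>) z)"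
    by (simp only: dzbar_eqI[OF D])
       (simp add: dzbar_def algebra_simps sum.distrib sum_distrib_left add_divide_distrib flip: sum_divide_distrib)
qed

lemma matrix_inv_nth:
  fixes A :: "complex^'k^'k"
  assumes "det A \<noteq> 0"
  shows "matrix_inv A $ i $ j = det (\<chi> p q. if q = i then axis j 1 $ p else A $ p $ q) / det A"
proof -
  have "A *v (matrix_inv A *v axis j 1) = axis j 1"
    by (simp add: matrix_vector_mul_assoc matrix_inv_works[OF assms])
  then have "(matrix_inv A *v axis j 1) $ i = det (\<chi> p q. if q = i then axis j 1 $ p else A $ p $ q) / det A"
    by (simp add: cramer[OF assms])
  moreover have "(matrix_inv A *v axis j 1) $ i = matrix_inv A $ i $ j"
    by (simp add: matrix_vector_mult_def axis_def if_distrib cong: if_cong)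
  ultimately show ?thesis by (simp only:)
qed

lemma smooth_on_matrix_inv:
  fixes A :: "'a::real_normed_vector \<Rightarrow> complex^'k^'k"
  assumes S: "open S" and A: "\<And>\<alpha> \<beta>. smooth_on S (\<lambda>x. A x $ \<alpha> $ \<beta>)" and nz: "\<And>x. x \<in> S \<Longrightarrow> det (A x) \<noteq> 0"
  shows "smooth_on S (\<lambda>x. matrix_inv (A x) $ i $ j)"
proof (rule smooth_on_cong[OF S])
  show "det (\<chi> p q. if q = i then axis j 1 $ p else A x $ p $ q) / det (A x) = matrix_inv (A x) $ i $ j" if "x \<in> S" for x
    using matrix_inv_nth[OF nz[OF that]] by simp
  have "smooth_on S (\<lambda>x. (\<chi> p q. if q = i then axis j 1 $ p else A x $ p $ q) $ \<alpha> $ \<beta>)" for \<alpha> \<beta>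
    by (cases "\<beta> = i") (simp_all add: A smooth_on_const[OF S])
  then show "smooth_on S (\<lambda>x. det (\<chi> p q. if q = i then axis j 1 $ p else A x $ p $ q) / det (A x))"
    by (intro smooth_on_divide[OF S] smooth_on_det[OF S] A nz)
qed

definition dzm :: "'a \<Rightarrow> (complex^'a \<Rightarrow> complex^'k^'k) \<Rightarrow> complex^'a \<Rightarrow> complex^'k^'k" where
  "dzm i A z = (\<chi> \<alpha> \<beta>. dz i (\<lambda>x. A x $ \<alpha> $ \<beta>) z)"

lemma dzm_matrix_inv:
  fixes A :: "complex^'a \<Rightarrow> complex^'k^'k"
  assumes S: "open S" and A: "\<And>\<alpha> \<beta>. smooth_on S (\<lambda>x. A x $ \<alpha> $ \<beta>)" and nz: "\<And>x. x \<in> S \<Longrightarrow> det (A x) \<noteq> 0"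
    and z: "z \<in> S"
  shows "dzm i (\<lambda>x. matrix_inv (A x)) z = - (matrix_inv (A z) ** dzm i A z ** matrix_inv (A z))"
proof -
  let ?B = "\<lambda>x. matrix_inv (A x)"
  have dA: "(\<lambda>x. A x $ \<alpha> $ \<beta>) differentiable (at z)" for \<alpha> \<beta>
    using smooth_on_differentiable[OF A z] .
  have dB: "(\<lambda>x. ?B x $ \<alpha> $ \<beta>) differentiable (at z)" for \<alpha> \<beta>
    using smooth_on_differentiable[OF smooth_on_matrix_inv[OF S A nz] z] .
  have "(dzm i ?B z ** A z + ?B z ** dzm i A z) $ \<alpha> $ \<beta> = 0" for \<alpha> \<beta>
  proof -
    have "dz i (\<lambda>x. \<Sum>\<gamma>\<in>UNIV. ?B x $ \<alpha> $ \<gamma> * A x $ \<gamma> $ \<beta>) z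
        = (\<Sum>\<gamma>\<in>UNIV. dz i (\<lambda>x. ?B x $ \<alpha> $ \<gamma>) z * A z $ \<gamma> $ \<beta> + ?B z $ \<alpha> $ \<gamma> * dz i (\<lambda>x. A x $ \<gamma> $ \<beta>) z)"
      by (subst wirtinger_sum) (auto intro!: sum.cong dz_mult dA dB derivative_intros)
    moreover have "dz i (\<lambda>x. \<Sum>\<gamma>\<in>UNIV. ?B x $ \<alpha> $ \<gamma> * A x $ \<gamma> $ \<beta>) z = dz i (\<lambda>x. mat 1 $ \<alpha> $ \<beta>) z"
    proof (rule wirtinger_cong(1)[OF S z])
      show "(\<Sum>\<gamma>\<in>UNIV. ?B x $ \<alpha> $ \<gamma> * A x $ \<gamma> $ \<beta>) = mat 1 $ \<alpha> $ \<beta>" if "x \<in> S" for x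
        using matrix_inv_works(2)[OF nz[OF that]] by (simp add: matrix_matrix_mult_def vec_eq_iff)
      show "(\<lambda>x. \<Sum>\<gamma>\<in>UNIV. ?B x $ \<alpha> $ \<gamma> * A x $ \<gamma> $ \<beta>) differentiable (at z)"
        by (rule differentiable_sum) (auto intro: differentiable_mult dA dB)
    qed
    ultimately show ?thesis by (simp add: dzm_def matrix_matrix_mult_def sum.distrib)
  qed
  then have "dzm i ?B z ** A z + ?B z ** dzm i A z = 0" by (simp add: vec_eq_iff)
  then have "dzm i ?B z ** A z = - (?B z ** dzm i A z)" by (simp add: eq_neg_iff_add_eq_0)
  then have "dzm i ?B z ** A z ** ?B z = - (?B z ** dzm i A z) ** ?B z" by simp
  then have "dzm i ?B z = - (?B z ** dzm i A z) ** ?B z"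
    by (simp add: matrix_inv_works[OF nz[OF z]] flip: matrix_mul_assoc)
  then show ?thesis
    by (simp add: vec_eq_iff matrix_matrix_mult_def sum_negf)
qed

text \<open>By Jacobi's formula the antiholomorphic derivative of \<open>log det A\<close> is the trace of \<open>A\<^sup>-\<^sup>1\<close> times the
  derivative of \<open>A\<close>. Differentiating once more, the derivative of \<open>A\<^sup>-\<^sup>1\<close> produces the quadratic term of
  the Chern curvature.\<close>

lemma hessian_log_det:
  fixes A :: "complex^'a \<Rightarrow> complex^'k^'k"
  assumes S: "open S" and A: "\<And>\<alpha> \<beta>. smooth_on S (\<lambda>x. A x $ \<alpha> $ \<beta>)" and pd: "\<And>x. x \<in> S \<Longrightarrow> pos_def (A x)"
    and z: "z \<in> S"
  shows "dz i (dzbar j (\<lambda>x. complex_of_real (ln (Re (det (A x)))))) z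
       = - (\<Sum>\<alpha>\<in>UNIV. \<Sum>\<beta>\<in>UNIV. matrix_inv (A z) $ \<beta> $ \<alpha> * chern_curvature A z \<alpha> \<beta> i j)"
proof -
  let ?B = "\<lambda>x. matrix_inv (A x)"
  have nz: "det (A x) \<noteq> 0" if "x \<in> S" for x using pos_def_det_nonzero pd that by blast
  have dA: "(\<lambda>x. A x $ \<alpha> $ \<beta>) differentiable (at x)" if "x \<in> S" for \<alpha> \<beta> x
    using smooth_on_differentiable[OF A that] .
  have sB: "smooth_on S (\<lambda>x. ?B x $ \<alpha> $ \<beta>)" for \<alpha> \<beta> by (rule smooth_on_matrix_inv[OF S A nz])
  have sdA: "smooth_on S (dzbar j (\<lambda>x. A x $ \<alpha> $ \<beta>))" for \<alpha> \<beta> by (rule smooth_on_dzbar[OF S A])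
  have s_det: "smooth_on S (\<lambda>x. Re (det (A x)))"
    by (rule smooth_on_linear[OF bounded_linear_Re S smooth_on_det[OF S A]])
  have log: "dzbar j (\<lambda>x. complex_of_real (ln (Re (det (A x))))) x
     = (\<Sum>\<alpha>\<in>UNIV. \<Sum>\<beta>\<in>UNIV. ?B x $ \<beta> $ \<alpha> * dzbar j (\<lambda>x. A x $ \<alpha> $ \<beta>) x)" if x: "x \<in> S" for x
  proof -
    have "dzbar j (\<lambda>x. complex_of_real (ln (Re (det (A x))))) x
      = of_real (inverse (Re (det (A x)))) * dzbar j (\<lambda>x. of_real (Re (det (A x)))) x"
      using pos_def_det_pos(1)[OF pd[OF x]]
      by (intro wirtinger_real_chain smooth_on_differentiable[OF s_det x] DERIV_ln)
    also have "dzbar j (\<lambda>x. of_real (Re (det (A x)))) x = dzbar j (\<lambda>x. det (A x)) x"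
      using pos_def_det_pos(2)[OF pd]
      by (intro wirtinger_cong(2)[OF S x, symmetric]) (auto intro: smooth_on_differentiable[OF smooth_on_det[OF S A] x])
    also have "\<dots> = det (A x) * (\<Sum>\<alpha>\<in>UNIV. \<Sum>\<beta>\<in>UNIV. ?B x $ \<beta> $ \<alpha> * dzbar j (\<lambda>x. A x $ \<alpha> $ \<beta>) x)"
      by (rule wirtinger_det[OF dA[OF x] nz[OF x]])
    also have "of_real (inverse (Re (det (A x)))) = inverse (det (A x))"
      by (subst (2) pos_def_det_pos(2)[OF pd[OF x]]) simp
    finally show ?thesis using nz[OF x] by simp
  qed
  have "dz i (dzbar j (\<lambda>x. complex_of_real (ln (Re (det (A x)))))) z
     = dz i (\<lambda>x. \<Sum>\<alpha>\<in>UNIV. \<Sum>\<beta>\<in>UNIV. ?B x $ \<beta> $ \<alpha> * dzbar j (\<lambda>x. A x $ \<alpha> $ \<beta>) x) z"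
  proof (rule wirtinger_cong(1)[OF S z log])
    have "smooth_on S (\<lambda>x. complex_of_real (ln (Re (det (A x)))))"
      using pos_def_det_pos(1)[OF pd]
      by (intro smooth_on_linear[OF bounded_linear_of_real S] smooth_on_ln[OF S] s_det)
    then show "dzbar j (\<lambda>x. complex_of_real (ln (Re (det (A x))))) differentiable (at z)"
      by (intro smooth_on_differentiable[OF smooth_on_dzbar[OF S] z])
  qed
  also have "\<dots> = (\<Sum>\<alpha>\<in>UNIV. \<Sum>\<beta>\<in>UNIV. dz i (\<lambda>x. ?B x $ \<beta> $ \<alpha>) z * dzbar j (\<lambda>x. A x $ \<alpha> $ \<beta>) z
       + ?B z $ \<beta> $ \<alpha> * dz i (dzbar j (\<lambda>x. A x $ \<alpha> $ \<beta>)) z)"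
  proof -
    have d1: "(\<lambda>x. ?B x $ \<beta> $ \<alpha> * dzbar j (\<lambda>x. A x $ \<alpha> $ \<beta>) x) differentiable (at z)" for \<alpha> \<beta>
      by (rule differentiable_mult[OF smooth_on_differentiable[OF sB z] smooth_on_differentiable[OF sdA z]])
    have d2: "(\<lambda>x. \<Sum>\<beta>\<in>UNIV. ?B x $ \<beta> $ \<alpha> * dzbar j (\<lambda>x. A x $ \<alpha> $ \<beta>) x) differentiable (at z)" for \<alpha>
      by (rule differentiable_sum) (auto intro: d1)
    show ?thesis
      by (subst wirtinger_sum(1)[OF finite d2], rule sum.cong[OF refl], subst wirtinger_sum(1)[OF finite d1],
          rule sum.cong[OF refl], rule dz_mult[OF smooth_on_differentiable[OF sB z] smooth_on_differentiable[OF sdA z]])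
  qed
  also have "\<dots> = (\<Sum>\<alpha>\<in>UNIV. \<Sum>\<beta>\<in>UNIV. dz i (\<lambda>x. ?B x $ \<beta> $ \<alpha>) z * dzbar j (\<lambda>x. A x $ \<alpha> $ \<beta>) z)
       + (\<Sum>\<alpha>\<in>UNIV. \<Sum>\<beta>\<in>UNIV. ?B z $ \<beta> $ \<alpha> * dz i (dzbar j (\<lambda>x. A x $ \<alpha> $ \<beta>)) z)"
    by (simp add: sum.distrib)
  also have "(\<Sum>\<alpha>\<in>UNIV. \<Sum>\<beta>\<in>UNIV. dz i (\<lambda>x. ?B x $ \<beta> $ \<alpha>) z * dzbar j (\<lambda>x. A x $ \<alpha> $ \<beta>) z)
     = - (\<Sum>\<gamma>\<in>UNIV. \<Sum>\<beta>\<in>UNIV. \<Sum>\<alpha>\<in>UNIV. \<Sum>\<delta>\<in>UNIV. ?B z $ \<beta> $ \<alpha> * dz i (\<lambda>x. A x $ \<alpha> $ \<delta>) z * ?B z $ \<delta> $ \<gamma>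
            * dzbar j (\<lambda>x. A x $ \<gamma> $ \<beta>) z)"
  proof -
    have "dz i (\<lambda>x. ?B x $ \<beta> $ \<gamma>) z
        = - (\<Sum>\<alpha>\<in>UNIV. \<Sum>\<delta>\<in>UNIV. ?B z $ \<beta> $ \<alpha> * dz i (\<lambda>x. A x $ \<alpha> $ \<delta>) z * ?B z $ \<delta> $ \<gamma>)" for \<beta> \<gamma>
    proof -
      have "dz i (\<lambda>x. ?B x $ \<beta> $ \<gamma>) z = - (\<Sum>\<delta>\<in>UNIV. \<Sum>\<alpha>\<in>UNIV. ?B z $ \<beta> $ \<alpha> * dz i (\<lambda>x. A x $ \<alpha> $ \<delta>) z * ?B z $ \<delta> $ \<gamma>)"
        using arg_cong[OF dzm_matrix_inv[OF S A nz z, of i], of "\<lambda>M. M $ \<beta> $ \<gamma>"]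
        by (simp add: dzm_def matrix_matrix_mult_def sum_distrib_right)
      also have "(\<Sum>\<delta>\<in>UNIV. \<Sum>\<alpha>\<in>UNIV. ?B z $ \<beta> $ \<alpha> * dz i (\<lambda>x. A x $ \<alpha> $ \<delta>) z * ?B z $ \<delta> $ \<gamma>)
        = (\<Sum>\<alpha>\<in>UNIV. \<Sum>\<delta>\<in>UNIV. ?B z $ \<beta> $ \<alpha> * dz i (\<lambda>x. A x $ \<alpha> $ \<delta>) z * ?B z $ \<delta> $ \<gamma>)"
        by (rule sum.swap)
      finally show ?thesis .
    qed
    then show ?thesis by (simp add: sum_negf sum_distrib_right)
  qed
  also have "(\<Sum>\<gamma>\<in>UNIV. \<Sum>\<beta>\<in>UNIV. \<Sum>\<alpha>\<in>UNIV. \<Sum>\<delta>\<in>UNIV. ?B z $ \<beta> $ \<alpha> * dz i (\<lambda>x. A x $ \<alpha> $ \<delta>) z * ?B z $ \<delta> $ \<gamma>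
            * dzbar j (\<lambda>x. A x $ \<gamma> $ \<beta>) z)
      = (\<Sum>\<alpha>\<in>UNIV. \<Sum>\<beta>\<in>UNIV. ?B z $ \<beta> $ \<alpha> * (\<Sum>\<gamma>\<in>UNIV. \<Sum>\<delta>\<in>UNIV. ?B z $ \<delta> $ \<gamma> * dz i (\<lambda>x. A x $ \<alpha> $ \<delta>) z
            * dzbar j (\<lambda>x. A x $ \<gamma> $ \<beta>) z))" (is "?l = ?r")
  proof -
    let ?t = "\<lambda>\<alpha> \<beta> \<gamma> \<delta>. ?B z $ \<beta> $ \<alpha> * dz i (\<lambda>x. A x $ \<alpha> $ \<delta>) z * ?B z $ \<delta> $ \<gamma> * dzbar j (\<lambda>x. A x $ \<gamma> $ \<beta>) z"
    have "?l = (\<Sum>\<gamma>\<in>UNIV. \<Sum>\<alpha>\<in>UNIV. \<Sum>\<beta>\<in>UNIV. \<Sum>\<delta>\<in>UNIV. ?t \<alpha> \<beta> \<gamma> \<delta>)"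
      by (rule sum.cong[OF refl], rule sum.swap)
    also have "\<dots> = (\<Sum>\<alpha>\<in>UNIV. \<Sum>\<gamma>\<in>UNIV. \<Sum>\<beta>\<in>UNIV. \<Sum>\<delta>\<in>UNIV. ?t \<alpha> \<beta> \<gamma> \<delta>)"
      by (rule sum.swap)
    also have "\<dots> = (\<Sum>\<alpha>\<in>UNIV. \<Sum>\<beta>\<in>UNIV. \<Sum>\<gamma>\<in>UNIV. \<Sum>\<delta>\<in>UNIV. ?t \<alpha> \<beta> \<gamma> \<delta>)"
      by (rule sum.cong[OF refl], rule sum.swap)
    also have "\<dots> = ?r" by (simp add: sum_distrib_left mult_ac)
    finally show ?thesis .
  qed
  finally show ?thesis
    by (simp add: chern_curvature_def algebra_simps sum.distrib sum_subtractf)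
qed

section \<open>The radial profile\<close>

lemma smooth_on_poly: "open S \<Longrightarrow> smooth_on S (poly (p :: real poly))"
proof (induction p)
  case 0
  then show ?case by (simp add: smooth_on_const)
next
  case (pCons a p)
  have "smooth_on S (\<lambda>x. a + x * poly p x)"
    using pCons
    by (intro smooth_on_add smooth_on_mult smooth_on_const smooth_on_bounded_linear[OF bounded_linear_ident]) auto
  then show ?case by (simp add: poly_pCons[abs_def])
qed

lemma pderiv_sum_distrib: "pderiv (\<Sum>i\<in>I. f i) = (\<Sum>i\<in>I. pderiv (f i))"
  by (induction I rule: infinite_finite_induct) (auto simp: pderiv_add)

text \<open>The operator multiplies \<open>x\<^sup>j\<close> by \<open>d - j\<close>, so the only obstruction is the coefficient of \<open>x\<^sup>d\<close>. In
  the radial equation this obstruction is the coefficient of a logarithmic term.\<close>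

lemma euler_operator_surj:
  fixes T :: "real poly"
  assumes T: "degree T < d"
  shows "\<exists>P. \<forall>x. of_nat d * poly P x - x * poly (pderiv P) x = poly T x"
proof -
  define t where "t j = coeff T j / of_nat (d - j)" for j
  define P where "P = (\<Sum>j<d. monom (t j) j)"
  have t: "(of_nat d - of_nat j) * t j = coeff T j" if "j < d" for j
    using that by (simp add: t_def of_nat_diff)
  have "of_nat d * poly P x - x * poly (pderiv P) x = poly T x" for x
  proof -
    have "x * poly (pderiv (monom (t j) j)) x = of_nat j * (t j * x ^ j)" for j
      by (cases j) (simp_all add: pderiv_monom poly_monom)
    then have "x * poly (pderiv P) x = (\<Sum>j<d. of_nat j * (t j * x ^ j))"
      by (simp add: P_def pderiv_sum_distrib poly_sum sum_distrib_left)
    moreover have "poly P x = (\<Sum>j<d. t j * x ^ j)"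
      by (simp add: P_def poly_sum poly_monom)
    ultimately have "of_nat d * poly P x - x * poly (pderiv P) x
        = (\<Sum>j<d. (of_nat d - of_nat j) * t j * x ^ j)"
      by (simp add: sum_distrib_left left_diff_distrib sum_subtractf mult.assoc)
    also have "\<dots> = (\<Sum>j<d. coeff T j * x ^ j)"
      by (rule sum.cong) (simp_all add: t)
    also have "\<dots> = (\<Sum>j\<le>degree T. coeff T j * x ^ j)"
      by (rule sum.mono_neutral_right) (use T in \<open>auto simp: coeff_eq_0\<close>)
    also have "\<dots> = poly T x" by (rule poly_altdef[symmetric])
    finally show ?thesis .
  qed
  then show ?thesis by blast
qed

text \<open>The solution is the inverse function of a primitive of \<open>- 1 / R\<close>; its smoothness follows from
  the equation by induction on the order of differentiability.\<close>

lemma autonomous_ode_solution: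
  fixes R :: "real \<Rightarrow> real"
  assumes d: "d > 0" and R: "smooth_on {-d<..<d} R" and pos: "\<And>x. x \<in> {-d<..<d} \<Longrightarrow> R x > 0"
  shows "\<exists>a b w. a < 0 \<and> 0 < b \<and> w 0 = 0 \<and> smooth_on {a<..<b} w \<and>
    (\<forall>s\<in>{a<..<b}. w s \<in> {-d<..<d} \<and> (w has_real_derivative - R (w s)) (at s) \<and> (w s = 0 \<longleftrightarrow> s = 0))"
proof -
  \<comment> \<open>closed intervals inside the domain: \<open>R\<close> is continuous on \<open>[-e, e]\<close>, and the primitive \<open>S\<close> is differentiable on a neighbourhood of \<open>[-f, f]\<close>\<close>
  define e where "e = d / 2"
  have e: "0 < e" "e < d" using d by (auto simp: e_def)
  have sub: "{-e..e} \<subseteq> {-d<..<d}" using e by auto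
  have "continuous_on {-e..e} (\<lambda>x. - inverse (R x))"
    using pos sub by (intro continuous_intros continuous_on_subset[OF smooth_on_continuous[OF R] sub]) force
  then obtain S0 where S0: "\<And>x. x \<in> {-e..e} \<Longrightarrow> (S0 has_vector_derivative - inverse (R x)) (at x within {-e..e})"
    using antiderivative_continuous by metis
  define S where "S x = S0 x - S0 0" for x
  have S_der: "(S has_real_derivative - inverse (R x)) (at x)" if "x \<in> {-e<..<e}" for x
  proof -
    have "(S0 has_vector_derivative - inverse (R x)) (at x)"
      using S0[of x] that at_within_interior[of x "{-e..e}"] by (auto simp: interior_atLeastAtMost_real)
    then have "(S0 has_real_derivative - inverse (R x)) (at x)"
      by (simp add: has_real_derivative_iff_has_vector_derivative)
    then show ?thesis unfolding S_def by (auto intro!: derivative_eq_intros)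
  qed
  define f where "f = e / 2"
  have f: "0 < f" "f < e" using e by (auto simp: f_def)
  have S0': "S 0 = 0" by (simp add: S_def)
  have dec: "S y < S x" if "x < y" "x \<in> {-e<..<e}" "y \<in> {-e<..<e}" for x y
  proof (rule DERIV_neg_imp_decreasing[OF that(1)])
    fix z assume "x \<le> z" "z \<le> y"
    then have z: "z \<in> {-e<..<e}" using that by auto
    then have "R z > 0" using pos e by auto
    then show "\<exists>D. (S has_real_derivative D) (at z) \<and> D < 0"
      using S_der[OF z] by (intro exI[of _ "- inverse (R z)"]) auto
  qed
  have cont: "isCont S x" if "x \<in> {-e<..<e}" for x
    using DERIV_isCont[OF S_der[OF that]] .
  define a where "a = S f"
  define b where "b = S (- f)"
  have ab: "a < 0" "0 < b" using dec[of 0 f] dec[of "-f" 0] f S0' by (auto simp: a_def b_def)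
  have ex: "\<exists>x. x \<in> {-f<..<f} \<and> S x = s" if s: "s \<in> {a<..<b}" for s
  proof -
    have "\<exists>x\<ge>-f. x \<le> f \<and> S x = s"
      by (rule IVT2) (use s f cont in \<open>auto simp: a_def b_def\<close>)
    then obtain x where x: "-f \<le> x" "x \<le> f" "S x = s" by blast
    then have "x \<noteq> f" "x \<noteq> - f" using s by (auto simp: a_def b_def)
    with x show ?thesis by (intro exI[of _ x]) auto
  qed
  define w where "w s = (SOME x. x \<in> {-f<..<f} \<and> S x = s)" for s
  have w: "w s \<in> {-f<..<f}" "S (w s) = s" if "s \<in> {a<..<b}" for s
    using someI_ex[OF ex[OF that]] by (auto simp: w_def)
  have inj: "x = y" if "S x = S y" "x \<in> {-e<..<e}" "y \<in> {-e<..<e}" for x y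
    using dec[OF _ that(2,3)] dec[OF _ that(3,2)] that(1) by (metis linorder_less_linear order_less_irrefl)
  have w0: "w 0 = 0"
    by (rule inj) (use w[of 0] ab f S0' in auto)
  have wS: "w (S x) = x" if "x \<in> {-f<..<f}" for x
  proof -
    have "S x \<in> {a<..<b}" using dec[of x f] dec[of "-f" x] that f by (auto simp: a_def b_def)
    note q = w[OF this]
    show ?thesis by (rule inj) (use q that f in auto)
  qed
  have w_cont: "isCont w s" if s: "s \<in> {a<..<b}" for s
  proof -
    have ws: "w s \<in> {-f<..<f}" using w(1)[OF s] .
    define q where "q = min (f - w s) (f + w s) / 2"
    have q: "q > 0" "w s - q > - f" "w s + q < f" using ws by (auto simp: q_def min_def field_simps)
    have "isCont w (S (w s))"
      by (rule isCont_inverse_function[where d = q]) (use q f in \<open>auto intro!: wS cont simp: abs_le_iff\<close>)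
    then show ?thesis using w(2)[OF s] by simp
  qed
  have w_der: "(w has_real_derivative - R (w s)) (at s)" if s: "s \<in> {a<..<b}" for s
  proof -
    have ws: "w s \<in> {-e<..<e}" using w(1)[OF s] f by auto
    have Rp: "R (w s) > 0" using pos ws e by auto
    have "(w has_real_derivative inverse (- inverse (R (w s)))) (at s)"
      by (rule DERIV_inverse_function[where f = S and a = a and b = b])
         (use S_der[OF ws] Rp s w w_cont in auto)
    then show ?thesis using Rp by simp
  qed
  have "higher_differentiable_on m w {a<..<b}" for m
  proof (induction m)
    case 0
    then show ?case using w_cont by (auto intro: continuous_at_imp_continuous_on)
  next
    case (Suc m)
    have Rm: "higher_differentiable_on m R {-d<..<d}" using R by (simp add: smooth_on_def)
    have img: "w ` {a<..<b} \<subseteq> {-d<..<d}"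
    proof clarify
      fix s assume "s \<in> {a<..<b}"
      from w(1)[OF this] show "w s \<in> {-d<..<d}" using f e by simp
    qed
    have "higher_differentiable_on m (\<lambda>s. R (w s)) {a<..<b}"
      by (rule higher_diff_compose[OF _ _ Rm Suc img]) auto
    then have "higher_differentiable_on m (\<lambda>s. - R (w s)) {a<..<b}"
      by (intro higher_diff_linear_comp[OF bounded_linear_minus[OF bounded_linear_ident]]) auto
    from higher_diff_SucI_field[OF open_greaterThanLessThan w_der this] show ?case .
  qed
  then have "smooth_on {a<..<b} w" by (simp add: smooth_on_def)
  moreover have "w s \<in> {-d<..<d} \<and> (w has_real_derivative - R (w s)) (at s) \<and> (w s = 0 \<longleftrightarrow> s = 0)"
    if s: "s \<in> {a<..<b}" for s
    using w[OF s] w_der[OF s] f e w0 S0' by auto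
  ultimately show ?thesis using ab w0 by blast
qed

text \<open>The ordinary differential equation to which \<open>J = 1\<close> reduces. Let \<open>s = ln r\<close> and write \<open>G = w \<phi>\<close> with
  \<open>dG/ds = - \<phi>\<close>. With \<open>Q(w) = \<Prod> (1/k + c w)\<close> the equation reads \<open>- \<phi>\<^sup>N\<^sup>+\<^sup>1 Q(w) dw/ds = e\<^sup>k\<^sup>s\<close>, where
  \<open>N = n + k\<close> and \<open>n\<close> is the number of the \<open>c\<close>. Putting \<open>dw/ds = - P(w) / Q(w)\<close> it becomes
  \<open>\<phi>\<^sup>N\<^sup>+\<^sup>1 P(w) = e\<^sup>k\<^sup>s\<close>, which determines \<open>\<phi>\<close>. The remaining condition \<open>dG/ds = - \<phi>\<close> amounts to
  \<open>(N + 1) P - w P' = (N + 1) Q + k w Q\<close>, an Euler equation for the polynomial \<open>P\<close>. It is solvable because its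
  right-hand side has degree at most \<open>n + 1 \<le> N\<close>.\<close>

lemma radial_profile:
  fixes cs :: "real list" and k :: nat
  assumes k: "k \<ge> 1"
  shows "\<exists>a b G G' G''. 0 < a \<and> a < 1 \<and> 1 < b \<and> smooth_on {a<..<b} G \<and>
    (\<forall>r\<in>{a<..<b}. (G has_real_derivative G' r) (at r) \<and> (G' has_real_derivative G'' r) (at r) \<and>
       (G r = 0 \<longleftrightarrow> r = 1) \<and> G' r < 0 \<and>
       (- 1) ^ (length cs + k) * (\<Prod>c\<leftarrow>cs. G' r * r / k - G r * c)
         * ((G r - G' r * r + G'' r / G' r * G r * r) * G' r ^ k) = 1)"
proof -
  define n where "n = length cs"
  define N1 where "N1 = real (n + k + 1)"
  define Q where "Q = (\<Prod>c\<leftarrow>cs. [:1 / real k, c:])"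
  have N1: "N1 > 0" by (simp add: N1_def)
  have degQ: "degree Q \<le> n"
    unfolding Q_def n_def
  proof (induction cs)
    case (Cons c cs)
    have "degree ([:1 / real k, c:] * (\<Prod>c\<leftarrow>cs. [:1 / real k, c:]))
        \<le> degree [:1 / real k, c:] + degree (\<Prod>c\<leftarrow>cs. [:1 / real k, c:])"
      by (rule degree_mult_le)
    also have "\<dots> \<le> 1 + length cs" using Cons by (intro add_mono) auto
    finally show ?case by simp
  qed simp
  have Qw: "poly Q x = (\<Prod>c\<leftarrow>cs. 1 / real k + x * c)" for x
    unfolding Q_def by (induction cs) (auto simp: algebra_simps)
  have "degree (smult N1 Q + smult (real k) (pCons 0 Q)) < n + k + 1"
  proof -
    have "degree (smult N1 Q + smult (real k) (pCons 0 Q)) \<le> n + 1"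
      using degQ k by (intro degree_add_le order_trans[OF degree_smult_le] order_trans[OF degree_pCons_le]) auto
    then show ?thesis using k by simp
  qed
  from euler_operator_surj[OF this] obtain P where
    P': "\<And>x. of_nat (n + k + 1) * poly P x - x * poly (pderiv P) x
       = poly (smult N1 Q + smult (real k) (pCons 0 Q)) x" by blast
  have P: "N1 * poly P x - x * poly (pderiv P) x = N1 * poly Q x + real k * (x * poly Q x)" for x
    using P'[of x] by (simp add: N1_def)
  have Q0: "poly Q 0 > 0"
  proof -
    have "(\<Prod>c\<leftarrow>cs. 1 / real k + 0 * c) > 0" using k by (induction cs) auto
    then show ?thesis by (simp only: Qw)
  qed
  have P0: "poly P 0 > 0" using P[of 0] Q0 N1 by simp
  have "\<exists>d>0. \<forall>x. dist x 0 < d \<longrightarrow> poly T x > 0" if "poly T 0 > 0" for T :: "real poly"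
  proof -
    have "isCont (poly T) 0" by simp
    then have "(poly T \<longlongrightarrow> poly T 0) (nhds 0)"
      unfolding isCont_def tendsto_at_iff_tendsto_nhds .
    then have "eventually (\<lambda>x. poly T x > 0) (nhds 0)"
      using that by (rule order_tendstoD(1))
    then show ?thesis by (simp add: eventually_nhds_metric)
  qed
  from this[OF P0] this[OF Q0] obtain d1 d2 where d12: "d1 > 0" "d2 > 0"
    "\<And>x. dist x 0 < d1 \<Longrightarrow> poly P x > 0" "\<And>x. dist x 0 < d2 \<Longrightarrow> poly Q x > 0" by blast
  define d where "d = min d1 d2"
  have d: "d > 0" using d12 by (simp add: d_def)
  have Pp: "poly P x > 0" and Qp: "poly Q x > 0" if "x \<in> {-d<..<d}" for x
    using that d12 by (auto simp: d_def dist_real_def)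
  define R where "R x = poly P x / poly Q x" for x
  have Rs: "smooth_on {-d<..<d} R"
    unfolding R_def using Qp by (intro smooth_on_divide smooth_on_poly) force+
  have Rp: "R x > 0" if "x \<in> {-d<..<d}" for x using Pp[OF that] Qp[OF that] by (simp add: R_def)
  obtain \<alpha> \<beta> w where ab: "\<alpha> < 0" "0 < \<beta>" and w0: "w 0 = 0" and ws: "smooth_on {\<alpha><..<\<beta>} w"
    and w: "\<And>s. s \<in> {\<alpha><..<\<beta>} \<Longrightarrow> w s \<in> {-d<..<d}"
    and w': "\<And>s. s \<in> {\<alpha><..<\<beta>} \<Longrightarrow> (w has_real_derivative - R (w s)) (at s)"
    and wz: "\<And>s. s \<in> {\<alpha><..<\<beta>} \<Longrightarrow> w s = 0 \<longleftrightarrow> s = 0"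
    using autonomous_ode_solution[OF d Rs Rp] by blast
  define \<phi> where "\<phi> s = exp ((real k * s - ln (poly P (w s))) / N1)" for s
  \<comment> \<open>\<open>q\<close> is the logarithmic derivative of \<open>\<phi>\<close>\<close>
  define q where "q s = (real k + poly (pderiv P) (w s) / poly Q (w s)) / N1" for s
  have \<phi>p: "\<phi> s > 0" for s by (simp add: \<phi>_def)
  have \<phi>s: "smooth_on {\<alpha><..<\<beta>} \<phi>"
    unfolding \<phi>_def using Pp w N1
    by (intro smooth_on_exp smooth_on_divide smooth_on_diff smooth_on_mult smooth_on_const smooth_on_ln
        smooth_on_bounded_linear[OF bounded_linear_ident] smooth_on_compose[of _ UNIV "poly P" w] smooth_on_poly ws) auto
  have \<phi>': "(\<phi> has_real_derivative \<phi> s * q s) (at s)" if s: "s \<in> {\<alpha><..<\<beta>}" for s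
  proof -
    have p: "poly P (w s) > 0" "poly Q (w s) > 0" using Pp Qp w[OF s] by auto
    have "((\<lambda>s. poly P (w s)) has_real_derivative poly (pderiv P) (w s) * - R (w s)) (at s)"
      by (rule DERIV_chain2[OF poly_DERIV w'[OF s]])
    from DERIV_chain2[OF DERIV_ln[OF p(1)] this]
    have "((\<lambda>s. ln (poly P (w s))) has_real_derivative
        inverse (poly P (w s)) * (poly (pderiv P) (w s) * - R (w s))) (at s)" .
    from DERIV_chain2[OF DERIV_exp DERIV_cdivide[OF DERIV_diff[OF DERIV_cmult_Id this], of "real k" N1]]
    have "(\<phi> has_real_derivative exp ((real k * s - ln (poly P (w s))) / N1)
        * ((real k - inverse (poly P (w s)) * (poly (pderiv P) (w s) * - R (w s))) / N1)) (at s)"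
      unfolding \<phi>_def .
    moreover have "inverse (poly P (w s)) * (poly (pderiv P) (w s) * - R (w s)) = - (poly (pderiv P) (w s) / poly Q (w s))"
      using p by (simp add: R_def field_simps)
    ultimately show ?thesis by (simp add: \<phi>_def q_def)
  qed
  \<comment> \<open>the Euler equation for \<open>P\<close>, rewritten\<close>
  have wq: "w s * q s = R (w s) - 1" if s: "s \<in> {\<alpha><..<\<beta>}" for s
  proof -
    have p: "poly Q (w s) > 0" using Qp w[OF s] by auto
    have "w s * q s * N1 * poly Q (w s) = real k * (w s * poly Q (w s)) + w s * poly (pderiv P) (w s)"
      using p N1 by (simp add: q_def field_simps)
    also have "\<dots> = N1 * (poly P (w s) - poly Q (w s))" using P[of "w s"] by (simp add: algebra_simps)
    also have "\<dots> = (R (w s) - 1) * N1 * poly Q (w s)" using p by (simp add: R_def field_simps)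
    finally show ?thesis using p N1 by simp
  qed
  define G where "G r = w (ln r) * \<phi> (ln r)" for r
  define G' where "G' r = - \<phi> (ln r) / r" for r
  define G'' where "G'' r = \<phi> (ln r) * (1 - q (ln r)) / r\<^sup>2" for r
  let ?I = "{exp \<alpha><..<exp \<beta>}"
  have I: "r > 0" "ln r \<in> {\<alpha><..<\<beta>}" if "r \<in> ?I" for r
  proof -
    show r: "r > 0" using that exp_gt_zero[of \<alpha>] by (auto simp del: exp_gt_zero)
    show "ln r \<in> {\<alpha><..<\<beta>}" using that r ln_less_cancel_iff[of "exp \<alpha>" r] ln_less_cancel_iff[of r "exp \<beta>"] by auto
  qed
  have lnd: "(ln has_real_derivative 1 / r) (at r)" if "r \<in> ?I" for r
    using DERIV_ln_divide I(1)[OF that] by blast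
  have f': "((\<lambda>s. w s * \<phi> s) has_real_derivative - \<phi> s) (at s)" if s: "s \<in> {\<alpha><..<\<beta>}" for s
  proof -
    have "((\<lambda>s. w s * \<phi> s) has_real_derivative - R (w s) * \<phi> s + \<phi> s * q s * w s) (at s)"
      by (rule DERIV_mult[OF w'[OF s] \<phi>'[OF s]])
    moreover have "- R (w s) * \<phi> s + \<phi> s * q s * w s = - \<phi> s"
      using wq[OF s] by (simp add: algebra_simps) (metis (no_types, opaque_lifting) diff_add_cancel distrib_left mult.commute mult.left_commute mult.right_neutral)
    ultimately show ?thesis by simp
  qed
  show ?thesis
  proof (rule exI[of _ "exp \<alpha>"], rule exI[of _ "exp \<beta>"], rule exI[of _ G], rule exI[of _ G'], rule exI[of _ G''],
      intro conjI ballI)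
    show "0 < exp \<alpha>" "exp \<alpha> < 1" "1 < exp \<beta>" using ab by auto
    show "smooth_on ?I G"
      unfolding G_def
      using I ws \<phi>s
      by (intro smooth_on_mult smooth_on_compose[of ?I "{\<alpha><..<\<beta>}" w ln] smooth_on_compose[of ?I "{\<alpha><..<\<beta>}" \<phi> ln]
          smooth_on_ln smooth_on_bounded_linear[OF bounded_linear_ident]) auto
    fix r assume r: "r \<in> ?I"
    note r0 = I(1)[OF r] and s = I(2)[OF r]
    show "(G has_real_derivative G' r) (at r)"
      using DERIV_chain2[OF f'[OF s] lnd[OF r]] by (simp add: G_def[abs_def] G'_def)
    have "((\<lambda>r. \<phi> (ln r)) has_real_derivative \<phi> (ln r) * q (ln r) * (1 / r)) (at r)"
      by (rule DERIV_chain2[OF \<phi>'[OF s] lnd[OF r]])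
    then show "(G' has_real_derivative G'' r) (at r)"
      unfolding G'_def G''_def using r0
      by (auto intro!: derivative_eq_intros simp: field_simps power2_eq_square)
    show "G r = 0 \<longleftrightarrow> r = 1" using wz[OF s] \<phi>p[of "ln r"] r0 by (simp add: G_def)
    show "G' r < 0" using \<phi>p r0 by (simp add: G'_def)
    let ?s = "ln r"
    have p: "poly P (w ?s) > 0" "poly Q (w ?s) > 0" using Pp Qp w[OF s] by auto
    have 1: "G r - G' r * r + G'' r / G' r * G r * r = \<phi> ?s * R (w ?s)"
    proof -
      have e: "G'' r / G' r * r = - (1 - q ?s)"
        using r0 \<phi>p[of ?s] by (simp add: G'_def G''_def field_simps power2_eq_square)
      have "G r - G' r * r + G'' r / G' r * G r * r = G r - G' r * r + (G'' r / G' r * r) * G r"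
        by (simp add: mult_ac)
      also have "\<dots> = G r - G' r * r - (1 - q ?s) * G r" by (simp only: e)
      also have "\<dots> = \<phi> ?s * (1 + w ?s * q ?s)"
        using r0 by (simp add: G_def G'_def algebra_simps)
      also have "\<dots> = \<phi> ?s * R (w ?s)" by (simp add: wq[OF s])
      finally show ?thesis .
    qed
    have 2: "(\<Prod>c\<leftarrow>cs. G' r * r / k - G r * c) = (- \<phi> ?s) ^ n * poly Q (w ?s)"
    proof -
      have "(\<Prod>c\<leftarrow>cs. G' r * r / k - G r * c) = (\<Prod>c\<leftarrow>cs. - \<phi> ?s * (1 / real k + w ?s * c))"
        using r0 by (intro arg_cong[where f = prod_list] map_cong) (simp_all add: G_def G'_def algebra_simps)
      also have "\<dots> = (- \<phi> ?s) ^ n * poly Q (w ?s)"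
        unfolding Qw n_def by (induction cs) auto
      finally show ?thesis .
    qed
    have 3: "\<phi> ?s ^ (n + k + 1) * poly P (w ?s) = r ^ k"
    proof -
      have "\<phi> ?s ^ (n + k + 1) = exp (N1 * ((real k * ?s - ln (poly P (w ?s))) / N1))"
        unfolding \<phi>_def N1_def exp_of_nat_mult by simp
      also have "\<dots> = exp (real k * ?s) / poly P (w ?s)"
        using N1 p by (simp add: exp_diff)
      also have "exp (real k * ?s) = r ^ k" using r0 by (simp add: exp_of_nat_mult)
      finally show ?thesis using p by simp
    qed
    have G'k: "G' r ^ k = (- \<phi> ?s) ^ k / r ^ k" by (simp only: G'_def power_divide)
    have "(- 1) ^ (length cs + k) * (\<Prod>c\<leftarrow>cs. G' r * r / k - G r * c)
         * ((G r - G' r * r + G'' r / G' r * G r * r) * G' r ^ k)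
       = ((- 1) ^ (n + k) * (- \<phi> ?s) ^ n * (- \<phi> ?s) ^ k) * \<phi> ?s * (R (w ?s) * poly Q (w ?s)) / r ^ k"
      unfolding 1 2 G'k by (simp add: n_def)
    also have "(- 1) ^ (n + k) * (- \<phi> ?s) ^ n * (- \<phi> ?s) ^ k = \<phi> ?s ^ (n + k)"
      by (simp add: power_add[symmetric] mult.assoc flip: power_mult_distrib)
    also have "R (w ?s) * poly Q (w ?s) = poly P (w ?s)" using p by (simp add: R_def)
    also have "\<phi> ?s ^ (n + k) * \<phi> ?s * poly P (w ?s) / r ^ k = 1"
      using 3 r0 by (simp add: mult_ac)
    finally show "(- 1) ^ (length cs + k) * (\<Prod>c\<leftarrow>cs. G' r * r / k - G r * c)
         * ((G r - G' r * r + G'' r / G' r * G r * r) * G' r ^ k) = 1" .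
  qed
qed

section \<open>The Monge-Ampere operator on weighted radial functions\<close>

lemma sesq_conv_mult: "sesq A v = (\<Sum>i\<in>UNIV. v $ i * (A *v (\<chi> j. cnj (v $ j))) $ i)"
  by (simp add: sesq_def matrix_vector_mult_def sum_distrib_left mult_ac)

text \<open>The substitution rule for a Hermitian form under a linear change of variables.\<close>

lemma sesq_congruence:
  fixes L :: "complex^'b^'a" and M :: "complex^'b^'b"
  assumes R: "\<And>p j. R $ p $ j = cnj (L $ j $ p)"
  shows "sesq (L ** M ** R) w = sesq M (w v* L)"
proof -
  have 1: "R *v (\<chi> j. cnj (w $ j)) = (\<chi> p. cnj ((w v* L) $ p))"
    by (simp add: vec_eq_iff matrix_vector_mult_def vector_matrix_mult_def R mult.commute)
  have 2: "(\<Sum>i\<in>UNIV. w $ i * (L *v x) $ i) = (\<Sum>p\<in>UNIV. (w v* L) $ p * x $ p)" for x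
    unfolding matrix_vector_mult_def vector_matrix_mult_def
    by (simp add: sum_distrib_left sum_distrib_right mult_ac, rule sum.swap)
  show ?thesis
    unfolding sesq_conv_mult
    by (simp add: 2 1 flip: matrix_vector_mul_assoc)
qed

lemma sesq_block_schur:
  fixes S :: "complex^'a^'a" and V :: "complex^'b^'b"
  assumes Q: "\<And>p j. Q $ p $ j = cnj (P $ j $ p)"
  shows "sesq (block (S + P ** V ** Q) (P ** V) (V ** Q) V) w
       = sesq S (\<chi> i. w $ Inl i) + sesq V (\<chi> b. w $ Inr b + (\<Sum>i\<in>UNIV. w $ Inl i * P $ i $ b))"
proof -
  let ?L = "block (mat 1) P 0 (mat 1) :: complex^('a + 'b)^('a + 'b)"
  let ?R = "block (mat 1) 0 Q (mat 1) :: complex^('a + 'b)^('a + 'b)"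
  have R: "?R $ p $ j = cnj (?L $ j $ p)" for p j
    by (cases p; cases j) (auto simp: Q mat_def)
  have sp: "sesq (block S 0 0 V) u = sesq S (\<chi> i. u $ Inl i) + sesq V (\<chi> b. u $ Inr b)" for u
    by (simp add: sesq_def sum_UNIV_Plus)
  have "(w v* ?L) $ Inl i = w $ Inl i" for i
    by (simp add: vector_matrix_mult_def sum_UNIV_Plus mat_def if_distrib[where f = "\<lambda>x. _ * x"] cong: if_cong)
  moreover have "(w v* ?L) $ Inr b = w $ Inr b + (\<Sum>i\<in>UNIV. w $ Inl i * P $ i $ b)" for b
    by (simp add: vector_matrix_mult_def sum_UNIV_Plus mat_def if_distrib[where f = "\<lambda>x. _ * x"] cong: if_cong)
  ultimately show ?thesis
    unfolding block_schur sesq_congruence[OF R] sp by simp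
qed

text \<open>The unipotent factors have the entries \<open>- p\<close> and \<open>- q\<close> of a logarithmic differential: this
  undoes the product rule for a function multiplied by an exponential.\<close>

lemma block_conjugate_bordered:
  fixes g :: "'r::comm_ring_1"
  shows "block (mat 1) 0 (\<chi> j u. - p j) (mat 1) ** bordered g R C H ** block (mat 1) (\<chi> u k. - q k) 0 (mat 1)
    = bordered g (\<chi> k. R $ k - g * q k) (\<chi> j. C $ j - p j * g)
        (\<chi> j k. H $ j $ k - C $ j * q k - p j * R $ k + p j * g * q k)"
proof -
  have 1: "block (mat 1) 0 (\<chi> j u. - p j) (mat 1) ** bordered g R C H
      = bordered g R (\<chi> j. C $ j - p j * g) (\<chi> j k. H $ j $ k - p j * R $ k)"
    by (simp add: bordered_def block_mult, rule block_eqI) (simp_all add: matrix_matrix_mult_def UNIV_unit)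
  have 2: "bordered g R C' H' ** block (mat 1) (\<chi> u k. - q k) 0 (mat 1)
      = bordered g (\<chi> k. R $ k - g * q k) C' (\<chi> j k. H' $ j $ k - C' $ j * q k)" for C' H'
    by (simp add: bordered_def block_mult, rule block_eqI) (simp_all add: matrix_matrix_mult_def UNIV_unit)
  show ?thesis
    unfolding 1 2 by (rule block_eqI) (simp_all add: algebra_simps)
qed

lemma smooth_on_of_real: "open S \<Longrightarrow> smooth_on S r \<Longrightarrow> smooth_on S (\<lambda>x. complex_of_real (r x))"
  by (rule smooth_on_linear[OF bounded_linear_of_real])

definition bordered_hessian :: "(complex^'N \<Rightarrow> complex) \<Rightarrow> complex^'N \<Rightarrow> complex^(unit + 'N)^(unit + 'N)" where
  "bordered_hessian f z = bordered (f z) (\<chi> k. dzbar k f z) (\<chi> j. dz j f z) (\<chi> j k. dz j (dzbar k f) z)"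

lemma fefferman_J_bordered:
  fixes u :: "complex^'N \<Rightarrow> real"
  shows "fefferman_J u z = (- 1) ^ CARD('N) * det (bordered_hessian (\<lambda>w. complex_of_real (u w)) z)"
proof -
  let ?s = "\<lambda>x :: unit + 'N. case x of Inl _ \<Rightarrow> None | Inr j \<Rightarrow> Some j"
  have bij: "bij ?s"
  proof (rule bijI)
    show "inj ?s" by (rule injI) (auto split: sum.splits)
    show "surj ?s"
    proof (rule surjI[where f = "\<lambda>y. case y of None \<Rightarrow> Inl () | Some j \<Rightarrow> Inr j"])
      show "?s (case y of None \<Rightarrow> Inl () | Some j \<Rightarrow> Inr j) = y" for y by (cases y) auto
    qed
  qed
  define f where "f = (\<lambda>w. complex_of_real (u w))"
  let ?M = "(\<chi> a b. case a of
               None \<Rightarrow> (case b of None \<Rightarrow> f z | Some k \<Rightarrow> dzbar k f z)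
             | Some j \<Rightarrow> (case b of None \<Rightarrow> dz j f z | Some k \<Rightarrow> dz j (dzbar k f) z))
           :: complex^('N option)^('N option)"
  have "det ?M = det (\<chi> x y. ?M $ ?s x $ ?s y)" by (rule det_reindex[OF bij, symmetric])
  also have "(\<chi> x y. ?M $ ?s x $ ?s y) = bordered_hessian f z"
    by (rule block_eqI) (simp_all add: bordered_hessian_def)
  finally show ?thesis unfolding f_def fefferman_J_def Let_def by simp
qed

context
  fixes V :: "(complex^'N) set" and r \<psi> :: "complex^'N \<Rightarrow> real" and G G1 G2 :: "real \<Rightarrow> real"
  assumes V: "open V" and r: "smooth_on V r" and \<psi>: "smooth_on V \<psi>"
    and G: "\<And>x. x \<in> V \<Longrightarrow> (G has_real_derivative G1 (r x)) (at (r x))"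
    and G1: "\<And>x. x \<in> V \<Longrightarrow> (G1 has_real_derivative G2 (r x)) (at (r x))"
begin

private abbreviation "R \<equiv> \<lambda>x. complex_of_real (r x)"
private abbreviation "X \<equiv> \<lambda>x. complex_of_real (\<psi> x)"
private abbreviation "u \<equiv> \<lambda>x. complex_of_real (G (r x) * exp (- \<psi> x))"
private abbreviation "m \<equiv> \<lambda>x. complex_of_real (exp (- \<psi> x))"

private lemma warped_diff:
  assumes x: "x \<in> V"
  shows "r differentiable (at x)" "\<psi> differentiable (at x)"
    "(\<lambda>x. complex_of_real (G (r x))) differentiable (at x)" "(\<lambda>x. complex_of_real (G1 (r x))) differentiable (at x)"
    "m differentiable (at x)" "dzbar k R differentiable (at x)" "dzbar k X differentiable (at x)"
proof -
  show r': "r differentiable (at x)" and "\<psi> differentiable (at x)"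
    using smooth_on_differentiable r \<psi> x by blast+
  have gen: "(\<lambda>x. complex_of_real (g (r x))) differentiable (at x)" if "(g has_real_derivative d) (at (r x))" for g d
  proof -
    have "g differentiable (at (r x))" using that by (auto simp: real_differentiable_def)
    then have "(g \<circ> r) differentiable (at x)" by (rule differentiable_chain_at[OF r'])
    then obtain D where "((g \<circ> r) has_derivative D) (at x)" by (auto simp: differentiable_def)
    from has_derivative_of_real[OF this, where ?'a = complex] show ?thesis
      by (auto simp: differentiable_def o_def)
  qed
  show "(\<lambda>x. complex_of_real (G (r x))) differentiable (at x)" "(\<lambda>x. complex_of_real (G1 (r x))) differentiable (at x)"
    using gen G[OF x] G1[OF x] by blast+
  show "m differentiable (at x)"
    by (rule smooth_on_differentiable[OF smooth_on_of_real[OF V smooth_on_exp[OF V smooth_on_minus[OF V \<psi>]]] x])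
  show "dzbar k R differentiable (at x)" "dzbar k X differentiable (at x)"
    by (rule smooth_on_differentiable[OF smooth_on_dzbar[OF V smooth_on_of_real[OF V]] x], fact)+
qed

private lemma dexp: "((\<lambda>t. exp (- t)) has_real_derivative - exp (- t)) (at t)" for t :: real
  by (auto intro!: derivative_eq_intros)

lemma warped_first_derivatives:
  assumes x: "x \<in> V"
  shows "dz k u x = m x * (G1 (r x) * dz k R x - G (r x) * dz k X x)"
    "dzbar k u x = m x * (G1 (r x) * dzbar k R x - G (r x) * dzbar k X x)"
  using wirtinger_real_chain[OF warped_diff(1)[OF x] G[OF x], of k]
    wirtinger_real_chain[OF warped_diff(2)[OF x] dexp, of k]
  by (simp_all add: dz_mult[OF warped_diff(3)[OF x] warped_diff(5)[OF x]]
        dzbar_mult[OF warped_diff(3)[OF x] warped_diff(5)[OF x]] algebra_simps)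

lemma warped_second_derivatives:
  assumes x: "x \<in> V"
  shows "dz j (dzbar k u) x = m x * (G2 (r x) * dz j R x * dzbar k R x + G1 (r x) * dz j (dzbar k R) x
      - G (r x) * dz j (dzbar k X) x - G1 (r x) * (dz j R x * dzbar k X x + dz j X x * dzbar k R x)
      + G (r x) * dz j X x * dzbar k X x)"
proof -
  let ?g = "\<lambda>x. complex_of_real (G (r x))" and ?g1 = "\<lambda>x. complex_of_real (G1 (r x))"
  let ?f = "\<lambda>x. m x * (?g1 x * dzbar k R x + - (?g x * dzbar k X x))"
  note d = warped_diff[OF x]
  have p1: "(\<lambda>x. ?g1 x * dzbar k R x) differentiable (at x)" "(\<lambda>x. ?g x * dzbar k X x) differentiable (at x)"
    by (intro differentiable_mult d)+
  have p2: "(\<lambda>x. - (?g x * dzbar k X x)) differentiable (at x)"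
    by (rule differentiable_minus[OF p1(2)])
  have p3: "(\<lambda>x. ?g1 x * dzbar k R x + - (?g x * dzbar k X x)) differentiable (at x)"
    by (rule differentiable_add[OF p1(1) p2])
  have "dz j (dzbar k u) x = dz j ?f x"
  proof (rule wirtinger_cong(1)[OF V x, symmetric])
    show "?f y = dzbar k u y" if "y \<in> V" for y
      using warped_first_derivatives(2)[OF that, of k] by simp
    show "?f differentiable (at x)" by (rule differentiable_mult[OF d(5) p3])
  qed
  also have "dz j ?f x = dz j m x * (?g1 x * dzbar k R x + - (?g x * dzbar k X x))
     + m x * (dz j ?g1 x * dzbar k R x + ?g1 x * dz j (dzbar k R) x
        - (dz j ?g x * dzbar k X x + ?g x * dz j (dzbar k X) x))"
    unfolding dz_mult[OF d(5) p3] dz_add[OF p1(1) p2] dz_minus[OF p1(2)] dz_mult[OF d(4) d(6)] dz_mult[OF d(3) d(7)]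
    by simp
  also have "dz j m x = - m x * dz j X x"
    using wirtinger_real_chain(1)[OF d(2) dexp, of j] by simp
  also have "dz j ?g1 x = G2 (r x) * dz j R x" by (rule wirtinger_real_chain(1)[OF d(1) G1[OF x]])
  also have "dz j ?g x = G1 (r x) * dz j R x" by (rule wirtinger_real_chain(1)[OF d(1) G[OF x]])
  finally show ?thesis by (simp add: algebra_simps)
qed

text \<open>The matrix for \<open>G(r) exp(- \<psi>)\<close> is \<open>exp(- \<psi>)\<close> times a unipotent conjugate of a matrix to which \<open>\<psi>\<close>
  contributes only its complex Hessian.\<close>

lemma fefferman_J_warped:
  assumes x: "x \<in> V"
  shows "fefferman_J (\<lambda>x. G (r x) * exp (- \<psi> x)) x = (- 1) ^ CARD('N) * m x ^ Suc CARD('N)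
     * det (bordered (complex_of_real (G (r x))) (\<chi> k. G1 (r x) * dzbar k R x) (\<chi> j. G1 (r x) * dz j R x)
        (\<chi> j k. G2 (r x) * dz j R x * dzbar k R x + G1 (r x) * dz j (dzbar k R) x - G (r x) * dz j (dzbar k X) x))"
proof -
  let ?B = "bordered (complex_of_real (G (r x))) (\<chi> k. G1 (r x) * dzbar k R x) (\<chi> j. G1 (r x) * dz j R x)
        (\<chi> j k. G2 (r x) * dz j R x * dzbar k R x + G1 (r x) * dz j (dzbar k R) x - G (r x) * dz j (dzbar k X) x)"
  let ?L = "block (mat 1) 0 (\<chi> j u. - dz j X x) (mat 1) :: complex^(unit + 'N)^(unit + 'N)"
  let ?L' = "block (mat 1) (\<chi> u k. - dzbar k X x) 0 (mat 1) :: complex^(unit + 'N)^(unit + 'N)"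
  note W = bordered_hessian_def bordered_nth vec_lambda_beta warped_first_derivatives[OF x] warped_second_derivatives[OF x]
  have "bordered_hessian u x = (\<chi> s t. m x * (?L ** ?B ** ?L') $ s $ t)"
    unfolding block_conjugate_bordered
  proof (rule block_eqI, goal_cases)
    case (1 i j)
    show ?case by (simp only: W) (simp add: algebra_simps)
  next
    case (2 i b)
    show ?case unfolding W by (simp add: algebra_simps)
  next
    case (3 a j)
    show ?case unfolding W by (simp add: algebra_simps)
  next
    case (4 a b)
    show ?case by (simp only: W) (simp add: algebra_simps)
  qed
  then have "det (bordered_hessian u x) = m x ^ CARD(unit + 'N) * det (?L ** ?B ** ?L')"
    by (simp only: det_scale)
  moreover have "det ?L = 1" "det ?L' = 1" by (simp_all add: det_block_lower det_block_upper)
  ultimately show ?thesis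
    unfolding fefferman_J_bordered by (simp add: det_mul)
qed

text \<open>At zeros of \<open>G(r)\<close> the terms of the complex Hessian other than that of \<open>r\<close> contain the differential
  of \<open>r\<close> or its conjugate as a factor, and therefore vanish on the complex tangent space.\<close>

lemma levi_form_warped:
  assumes x: "x \<in> V" and zero: "G (r x) = 0" and nz: "G1 (r x) \<noteq> 0"
    and w: "(\<Sum>i\<in>UNIV. dz i u x * w $ i) = 0"
  shows "(\<Sum>i\<in>UNIV. dz i R x * w $ i) = 0"
    "sesq (\<chi> i j. dz i (dzbar j (\<lambda>x. complex_of_real (- (G (r x) * exp (- \<psi> x))))) x) w
       = - (m x * G1 (r x)) * sesq (\<chi> i j. dz i (dzbar j R) x) w"
proof -
  have "m x * G1 (r x) * (\<Sum>i\<in>UNIV. dz i R x * w $ i) = (\<Sum>i\<in>UNIV. dz i u x * w $ i)"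
    unfolding warped_first_derivatives[OF x] zero by (simp add: sum_distrib_left mult_ac)
  with w nz show R0: "(\<Sum>i\<in>UNIV. dz i R x * w $ i) = 0" by simp
  have R0': "(\<Sum>j\<in>UNIV. dzbar j R x * cnj (w $ j)) = 0"
    using arg_cong[OF R0, of cnj] by (simp add: cnj_sum cnj_dz_of_real[OF warped_diff(1)[OF x]])
  have du: "u differentiable (at y)" if "y \<in> V" for y
    using differentiable_mult[OF warped_diff(3,5)[OF that]] by simp
  have neg: "dz i (dzbar j (\<lambda>x. complex_of_real (- (G (r x) * exp (- \<psi> x))))) x = - dz i (dzbar j u) x" for i j
  proof -
    have "dzbar j (\<lambda>x. complex_of_real (- (G (r x) * exp (- \<psi> x)))) y = - dzbar j u y" if "y \<in> V" for y
      using dzbar_minus[OF du[OF that], of j] by simp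
    moreover have du2: "dzbar j u differentiable (at x)"
    proof -
      have "(\<lambda>y. m y * (G1 (r y) * dzbar j R y - G (r y) * dzbar j X y)) differentiable (at x)"
        by (intro differentiable_mult differentiable_diff warped_diff[OF x])
      then have "((\<lambda>y. m y * (G1 (r y) * dzbar j R y - G (r y) * dzbar j X y)) has_derivative
          frechet_derivative (\<lambda>y. m y * (G1 (r y) * dzbar j R y - G (r y) * dzbar j X y)) (at x)) (at x)"
        by (simp add: frechet_derivative_works)
      then have "(dzbar j u has_derivative
          frechet_derivative (\<lambda>y. m y * (G1 (r y) * dzbar j R y - G (r y) * dzbar j X y)) (at x)) (at x)"
        by (rule has_derivative_transform_within_open[OF _ V x]) (rule warped_first_derivatives(2)[symmetric])
      then show ?thesis by (auto simp: differentiable_def)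
    qed
    ultimately have "dz i (\<lambda>y. - dzbar j u y) x = dz i (dzbar j (\<lambda>x. complex_of_real (- (G (r x) * exp (- \<psi> x))))) x"
      by (intro wirtinger_cong(1)[OF V x]) (auto intro: differentiable_minus)
    with dz_minus[OF du2, of i] show ?thesis by simp
  qed
  let ?c = "\<lambda>i j. m x * G1 (r x)"
  have "sesq (\<chi> i j. dz i (dzbar j (\<lambda>x. complex_of_real (- (G (r x) * exp (- \<psi> x))))) x) w
    = (\<Sum>i\<in>UNIV. \<Sum>j\<in>UNIV. - (m x * G1 (r x)) * (dz i (dzbar j R) x * w $ i * cnj (w $ j))
        - m x * G2 (r x) * ((dz i R x * w $ i) * (dzbar j R x * cnj (w $ j)))
        + m x * G1 (r x) * ((dz i R x * w $ i) * (dzbar j X x * cnj (w $ j)))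
        + m x * G1 (r x) * ((dz i X x * w $ i) * (dzbar j R x * cnj (w $ j))))"
    unfolding sesq_def
    by (intro sum.cong refl, simp only: vec_lambda_beta neg warped_second_derivatives[OF x] zero)
       (simp add: algebra_simps)
  also have "\<dots> = - (m x * G1 (r x)) * (\<Sum>i\<in>UNIV. \<Sum>j\<in>UNIV. dz i (dzbar j R) x * w $ i * cnj (w $ j))
        - m x * G2 (r x) * ((\<Sum>i\<in>UNIV. dz i R x * w $ i) * (\<Sum>j\<in>UNIV. dzbar j R x * cnj (w $ j)))
        + m x * G1 (r x) * ((\<Sum>i\<in>UNIV. dz i R x * w $ i) * (\<Sum>j\<in>UNIV. dzbar j X x * cnj (w $ j)))
        + m x * G1 (r x) * ((\<Sum>i\<in>UNIV. dz i X x * w $ i) * (\<Sum>j\<in>UNIV. dzbar j R x * cnj (w $ j)))"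
    unfolding sum_product by (simp only: sum.distrib sum_subtractf sum_distrib_left)
  also have "\<dots> = - (m x * G1 (r x)) * sesq (\<chi> i j. dz i (dzbar j R) x) w"
    unfolding R0 R0' by (simp add: sesq_def)
  finally show "sesq (\<chi> i j. dz i (dzbar j (\<lambda>x. complex_of_real (- (G (r x) * exp (- \<psi> x))))) x) w
       = - (m x * G1 (r x)) * sesq (\<chi> i j. dz i (dzbar j R) x) w" .
qed

end

section \<open>The squared norm on a Hermitian vector bundle\<close>

definition base :: "complex^('n::finite + 'k::finite) \<Rightarrow> complex^'n" where "base y = (\<chi> i. y $ Inl i)"
definition fib :: "complex^('n::finite + 'k::finite) \<Rightarrow> complex^'k" where "fib y = (\<chi> \<alpha>. y $ Inr \<alpha>)"

lemma base_vjoin [simp]: "base (vjoin z \<xi>) = z" and fib_vjoin [simp]: "fib (vjoin z \<xi>) = \<xi>"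
  by (simp_all add: base_def fib_def vjoin_def vec_eq_iff)

lemma vjoin_base_fib [simp]: "vjoin (base y) (fib y) = y"
proof -
  have "vjoin (base y) (fib y) $ s = y $ s" for s
    by (cases s) (simp_all add: base_def fib_def vjoin_def)
  then show ?thesis by (simp add: vec_eq_iff)
qed

lemma base_nth [simp]: "base y $ i = y $ Inl i" and fib_nth [simp]: "fib y $ a = y $ Inr a"
  by (simp_all add: base_def fib_def)

lemma bounded_linear_base: "bounded_linear (base :: complex^('n::finite + 'k::finite) \<Rightarrow> complex^'n)"
proof (rule bounded_linear_intro[where K = 1])
  fix y :: "complex^('n + 'k)"
  have "(\<Sum>i\<in>UNIV. (cmod (y $ Inl i))\<^sup>2) \<le> (\<Sum>s\<in>UNIV. (cmod (y $ s))\<^sup>2)"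
    by (simp add: sum_UNIV_Plus sum_nonneg)
  then show "norm (base y) \<le> norm y * 1"
    by (simp add: norm_vec_def L2_set_def)
qed (simp_all add: base_def vec_eq_iff)

lemma base_has_derivative: "(base has_derivative base) (at y)"
  by (rule bounded_linear_imp_has_derivative[OF bounded_linear_base])

lemma wirtinger_base:
  fixes f :: "complex^'n \<Rightarrow> complex" and y :: "complex^('n::finite + 'k::finite)"
  assumes f: "f differentiable (at (base y))"
  shows "dz (Inl i) (\<lambda>y. f (base y)) y = dz i f (base y)" "dzbar (Inl i) (\<lambda>y. f (base y)) y = dzbar i f (base y)"
    "dz (Inr a) (\<lambda>y. f (base y)) y = 0" "dzbar (Inr a) (\<lambda>y. f (base y)) y = 0"
proof -
  have lin: "base (c *s v) = c *s base v" for c and v :: "complex^('n + 'k)" by (simp add: vec_eq_iff)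
  note W = wirtinger_holomorphic_chain[OF base_has_derivative lin f]
  have l: "base (axis (Inl i) 1 :: complex^('n + 'k)) $ j = (if j = i then 1 else 0)" for i j by (simp add: axis_def)
  have r: "base (axis (Inr a) 1 :: complex^('n + 'k)) $ j = 0" for a j by (simp add: axis_def)
  show "dz (Inl i) (\<lambda>y. f (base y)) y = dz i f (base y)" "dzbar (Inl i) (\<lambda>y. f (base y)) y = dzbar i f (base y)"
    "dz (Inr a) (\<lambda>y. f (base y)) y = 0" "dzbar (Inr a) (\<lambda>y. f (base y)) y = 0"
    by (simp_all add: W l r if_distrib[of cnj] if_distrib[where f = "\<lambda>x. _ * x"] cong: if_cong del: base_nth)
qed

lemma differentiable_base:
  fixes f :: "complex^'n \<Rightarrow> complex" and y :: "complex^('n::finite + 'k::finite)"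
  assumes "f differentiable (at (base y))"
  shows "(\<lambda>y. f (base y)) differentiable (at y)"
  using differentiable_chain_at[of base y f] assms base_has_derivative by (auto simp: o_def differentiable_def)

lemma differentiable_cnj: "f differentiable (at z) \<Longrightarrow> (\<lambda>x. cnj (f x)) differentiable (at z)"
  unfolding differentiable_def using has_derivative_cnj by blast

definition dzbm :: "'a \<Rightarrow> (complex^'a \<Rightarrow> complex^'k^'k) \<Rightarrow> complex^'a \<Rightarrow> complex^'k^'k" where
  "dzbm i A z = (\<chi> \<alpha> \<beta>. dzbar i (\<lambda>x. A x $ \<alpha> $ \<beta>) z)"

text \<open>The value of the form \<open>A\<close> on the tautological section; for \<open>A = h\<close> this is the squared norm.\<close>

definition quad :: "(complex^('n::finite) \<Rightarrow> complex^('k::finite)^'k) \<Rightarrow> complex^('n + 'k) \<Rightarrow> complex" where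
  "quad A y = (\<Sum>\<alpha>\<in>UNIV. \<Sum>\<beta>\<in>UNIV. A (base y) $ \<alpha> $ \<beta> * (y $ Inr \<alpha> * cnj (y $ Inr \<beta>)))"

lemma quad_conv_sesq: "quad A y = sesq (A (base y)) (fib y)"
  by (simp add: quad_def sesq_def mult_ac)

lemma wirtinger_quad:
  fixes A :: "complex^('n::finite) \<Rightarrow> complex^('k::finite)^'k" and y :: "complex^('n + 'k)"
  assumes A: "\<And>\<alpha> \<beta>. (\<lambda>z. A z $ \<alpha> $ \<beta>) differentiable (at (base y))"
  shows "dz (Inl i) (quad A) y = quad (dzm i A) y" "dzbar (Inl i) (quad A) y = quad (dzbm i A) y"
    "dz (Inr \<gamma>) (quad A) y = (\<Sum>\<beta>\<in>UNIV. A (base y) $ \<gamma> $ \<beta> * cnj (y $ Inr \<beta>))"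
    "dzbar (Inr \<gamma>) (quad A) y = (\<Sum>\<alpha>\<in>UNIV. A (base y) $ \<alpha> $ \<gamma> * y $ Inr \<alpha>)"
proof -
  let ?t = "\<lambda>\<alpha> \<beta> y. A (base y) $ \<alpha> $ \<beta> * (y $ Inr \<alpha> * cnj (y $ Inr \<beta>))"
  have a: "(\<lambda>y. A (base y) $ \<alpha> $ \<beta>) differentiable (at y)" for \<alpha> \<beta>
    by (rule differentiable_base[OF A])
  have n: "(\<lambda>y. y $ s) differentiable (at y)" for s :: "'n + 'k" by (rule differentiable_nth)
  have c: "(\<lambda>y. cnj (y $ s)) differentiable (at y)" for s :: "'n + 'k" by (rule differentiable_cnj[OF n])
  have nc: "(\<lambda>y. y $ s * cnj (y $ s')) differentiable (at y)" for s s' :: "'n + 'k"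
    by (rule differentiable_mult[OF n c])
  have t: "?t \<alpha> \<beta> differentiable (at y)" for \<alpha> \<beta> by (rule differentiable_mult[OF a nc])
  have t': "(\<lambda>y. \<Sum>\<beta>\<in>UNIV. ?t \<alpha> \<beta> y) differentiable (at y)" for \<alpha>
    by (rule differentiable_sum) (auto intro: t)
  have q: "dz s (quad A) y = (\<Sum>\<alpha>\<in>UNIV. \<Sum>\<beta>\<in>UNIV. dz s (?t \<alpha> \<beta>) y)"
    "dzbar s (quad A) y = (\<Sum>\<alpha>\<in>UNIV. \<Sum>\<beta>\<in>UNIV. dzbar s (?t \<alpha> \<beta>) y)" for s
    unfolding quad_def[abs_def] wirtinger_sum[OF finite t'] wirtinger_sum[OF finite t] by simp_all
  note P = dz_mult[OF a nc] dzbar_mult[OF a nc] dz_mult[OF n c] dzbar_mult[OF n c] dz_cnj[OF n] dzbar_cnj[OF n]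
    wirtinger_coord wirtinger_base[OF A]
  show "dz (Inl i) (quad A) y = quad (dzm i A) y" "dzbar (Inl i) (quad A) y = quad (dzbm i A) y"
    unfolding q quad_def dzm_def dzbm_def by (simp_all add: P)
  have "dz (Inr \<gamma>) (quad A) y = (\<Sum>\<alpha>\<in>UNIV. if \<gamma> = \<alpha> then \<Sum>\<beta>\<in>UNIV. A (base y) $ \<alpha> $ \<beta> * cnj (y $ Inr \<beta>) else 0)"
    unfolding q by (rule sum.cong[OF refl]) (simp add: P)
  then show "dz (Inr \<gamma>) (quad A) y = (\<Sum>\<beta>\<in>UNIV. A (base y) $ \<gamma> $ \<beta> * cnj (y $ Inr \<beta>))" by simp
  have "dzbar (Inr \<gamma>) (quad A) y = (\<Sum>\<alpha>\<in>UNIV. \<Sum>\<beta>\<in>UNIV. if \<gamma> = \<beta> then A (base y) $ \<alpha> $ \<beta> * y $ Inr \<alpha> else 0)"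
    unfolding q by (intro sum.cong refl) (simp add: P)
  then show "dzbar (Inr \<gamma>) (quad A) y = (\<Sum>\<alpha>\<in>UNIV. A (base y) $ \<alpha> $ \<gamma> * y $ Inr \<alpha>)" by simp
qed

lemma dz_linear_in_fibre:
  fixes A :: "complex^('n::finite) \<Rightarrow> complex^('k::finite)^'k" and y :: "complex^('n + 'k)"
  assumes A: "\<And>\<alpha> \<beta>. (\<lambda>z. A z $ \<alpha> $ \<beta>) differentiable (at (base y))"
  shows "dz (Inl i) (\<lambda>y. \<Sum>\<alpha>\<in>UNIV. A (base y) $ \<alpha> $ \<gamma> * y $ Inr \<alpha>) y
      = (\<Sum>\<alpha>\<in>UNIV. dzm i A (base y) $ \<alpha> $ \<gamma> * y $ Inr \<alpha>)"
    "dz (Inr \<delta>) (\<lambda>y. \<Sum>\<alpha>\<in>UNIV. A (base y) $ \<alpha> $ \<gamma> * y $ Inr \<alpha>) y = A (base y) $ \<delta> $ \<gamma>"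
proof -
  let ?t = "\<lambda>\<alpha> y. A (base y) $ \<alpha> $ \<gamma> * y $ Inr \<alpha>"
  have a: "(\<lambda>y. A (base y) $ \<alpha> $ \<beta>) differentiable (at y)" for \<alpha> \<beta>
    by (rule differentiable_base[OF A])
  have n: "(\<lambda>y. y $ s) differentiable (at y)" for s :: "'n + 'k" by (rule differentiable_nth)
  have t: "?t \<alpha> differentiable (at y)" for \<alpha> by (rule differentiable_mult[OF a n])
  show "dz (Inl i) (\<lambda>y. \<Sum>\<alpha>\<in>UNIV. ?t \<alpha> y) y = (\<Sum>\<alpha>\<in>UNIV. dzm i A (base y) $ \<alpha> $ \<gamma> * y $ Inr \<alpha>)"
    unfolding wirtinger_sum(1)[OF finite t]
    by (simp add: dz_mult[OF a n] wirtinger_coord wirtinger_base[OF A] dzm_def)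
  have "dz (Inr \<delta>) (\<lambda>y. \<Sum>\<alpha>\<in>UNIV. ?t \<alpha> y) y = (\<Sum>\<alpha>\<in>UNIV. if \<delta> = \<alpha> then A (base y) $ \<alpha> $ \<gamma> else 0)"
    unfolding wirtinger_sum(1)[OF finite t]
    by (rule sum.cong[OF refl]) (simp add: dz_mult[OF a n] wirtinger_coord wirtinger_base[OF A])
  then show "dz (Inr \<delta>) (\<lambda>y. \<Sum>\<alpha>\<in>UNIV. ?t \<alpha> y) y = A (base y) $ \<delta> $ \<gamma>" by simp
qed

text \<open>For the squared norm \<open>r\<close>, \<open>\<Gamma>\<close> and \<open>\<Gamma>'\<close> are the coefficients of the Chern connection and its conjugate, contracted with
  the fibre coordinate. The horizontal lifts \<open>\<partial>\<^sub>i - \<Gamma>\<^sub>i\<close> annihilate \<open>r\<close> and are orthogonal to the fibres for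
  the complex Hessian of \<open>r\<close>, which on them equals \<open>S\<close>.\<close>

lemma det_bordered_fibred:
  fixes G a b r :: complex and c c' \<xi> \<xi>' :: "complex^'k" and h :: "complex^'k^'k"
    and \<Gamma> D1 :: "complex^'k^'n" and \<Gamma>' D2 :: "complex^'n^'k" and E S X :: "complex^'n^'n" and ri rj :: "complex^'n"
  assumes a: "a \<noteq> 0"
    and c: "\<And>\<alpha>. c $ \<alpha> = (\<Sum>\<beta>\<in>UNIV. h $ \<alpha> $ \<beta> * \<xi>' $ \<beta>)"
    and c': "\<And>\<beta>. c' $ \<beta> = (\<Sum>\<alpha>\<in>UNIV. \<xi> $ \<alpha> * h $ \<alpha> $ \<beta>)"
    and r: "r = (\<Sum>\<alpha>\<in>UNIV. \<xi> $ \<alpha> * c $ \<alpha>)"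
    and D1: "\<Gamma> ** h = D1" and D2: "h ** \<Gamma>' = D2"
    and ri: "\<And>i. ri $ i = (\<Sum>\<beta>\<in>UNIV. D1 $ i $ \<beta> * \<xi>' $ \<beta>)" and rj: "\<And>j. rj $ j = (\<Sum>\<alpha>\<in>UNIV. \<xi> $ \<alpha> * D2 $ \<alpha> $ j)"
    and E: "E = S + \<Gamma> ** h ** \<Gamma>'"
    and T: "\<And>i j. T (Inl i) (Inl j) = b * ri $ i * rj $ j + a * E $ i $ j - G * X $ i $ j"
      "\<And>i \<beta>. T (Inl i) (Inr \<beta>) = b * ri $ i * c' $ \<beta> + a * D1 $ i $ \<beta>"
      "\<And>\<alpha> j. T (Inr \<alpha>) (Inl j) = b * c $ \<alpha> * rj $ j + a * D2 $ \<alpha> $ j"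
      "\<And>\<alpha> \<beta>. T (Inr \<alpha>) (Inr \<beta>) = b * c $ \<alpha> * c' $ \<beta> + a * h $ \<alpha> $ \<beta>"
    and p: "\<And>j. p (Inl j) = rj $ j" "\<And>\<beta>. p (Inr \<beta>) = c' $ \<beta>"
    and q: "\<And>i. q (Inl i) = ri $ i" "\<And>\<alpha>. q (Inr \<alpha>) = c $ \<alpha>"
  shows "det (bordered G (\<chi> t. a * p t) (\<chi> s. a * q s) (\<chi> s t. T s t))
      = det (\<chi> i j. a * S $ i $ j - G * X $ i $ j) * ((G - a * r + b / a * G * r) * a ^ CARD('k) * det h)"
proof -
  let ?V = "bordered G (\<chi> \<beta>. a * c' $ \<beta>) (\<chi> \<alpha>. a * c $ \<alpha>) (\<chi> \<alpha> \<beta>. b * c $ \<alpha> * c' $ \<beta> + a * h $ \<alpha> $ \<beta>)"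
  let ?P = "(\<chi> i u. case u of Inl _ \<Rightarrow> 0 | Inr \<gamma> \<Rightarrow> \<Gamma> $ i $ \<gamma>) :: complex^(unit + 'k)^'n"
  let ?Q = "(\<chi> u j. case u of Inl _ \<Rightarrow> 0 | Inr \<gamma> \<Rightarrow> \<Gamma>' $ \<gamma> $ j) :: complex^'n^(unit + 'k)"
  let ?S = "(\<chi> i j. a * S $ i $ j - G * X $ i $ j) :: complex^'n^'n"
  have D1': "(\<Sum>\<gamma>\<in>UNIV. \<Gamma> $ i $ \<gamma> * h $ \<gamma> $ \<beta>) = D1 $ i $ \<beta>" for i \<beta>
    using D1 by (auto simp: matrix_matrix_mult_def vec_eq_iff)
  have D2': "(\<Sum>\<gamma>\<in>UNIV. h $ \<alpha> $ \<gamma> * \<Gamma>' $ \<gamma> $ j) = D2 $ \<alpha> $ j" for \<alpha> j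
    using D2 by (auto simp: matrix_matrix_mult_def vec_eq_iff)
  have \<Gamma>c: "(\<Sum>\<gamma>\<in>UNIV. \<Gamma> $ i $ \<gamma> * c $ \<gamma>) = ri $ i" for i
  proof -
    have "(\<Sum>\<gamma>\<in>UNIV. \<Gamma> $ i $ \<gamma> * c $ \<gamma>) = (\<Sum>\<gamma>\<in>UNIV. \<Sum>\<beta>\<in>UNIV. \<Gamma> $ i $ \<gamma> * h $ \<gamma> $ \<beta> * \<xi>' $ \<beta>)"
      by (simp add: c sum_distrib_left mult.assoc)
    also have "\<dots> = (\<Sum>\<beta>\<in>UNIV. \<Sum>\<gamma>\<in>UNIV. \<Gamma> $ i $ \<gamma> * h $ \<gamma> $ \<beta> * \<xi>' $ \<beta>)" by (rule sum.swap)
    also have "\<dots> = ri $ i" by (simp add: ri D1' flip: sum_distrib_right)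
    finally show ?thesis .
  qed
  have c\<Gamma>: "(\<Sum>\<gamma>\<in>UNIV. c' $ \<gamma> * \<Gamma>' $ \<gamma> $ j) = rj $ j" for j
  proof -
    have "(\<Sum>\<gamma>\<in>UNIV. c' $ \<gamma> * \<Gamma>' $ \<gamma> $ j) = (\<Sum>\<gamma>\<in>UNIV. \<Sum>\<alpha>\<in>UNIV. \<xi> $ \<alpha> * (h $ \<alpha> $ \<gamma> * \<Gamma>' $ \<gamma> $ j))"
      by (simp add: c' sum_distrib_right mult.assoc)
    also have "\<dots> = (\<Sum>\<alpha>\<in>UNIV. \<Sum>\<gamma>\<in>UNIV. \<xi> $ \<alpha> * (h $ \<alpha> $ \<gamma> * \<Gamma>' $ \<gamma> $ j))" by (rule sum.swap)
    also have "\<dots> = rj $ j" by (simp add: rj D2' flip: sum_distrib_left)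
    finally show ?thesis .
  qed
  have PV: "(?P ** ?V) $ i $ Inl u = a * ri $ i" "(?P ** ?V) $ i $ Inr \<beta> = b * ri $ i * c' $ \<beta> + a * D1 $ i $ \<beta>" for i u \<beta>
  proof -
    have "(?P ** ?V) $ i $ Inl u = a * (\<Sum>\<gamma>\<in>UNIV. \<Gamma> $ i $ \<gamma> * c $ \<gamma>)"
      by (simp add: matrix_matrix_mult_def sum_UNIV_Plus sum_distrib_left mult_ac)
    then show "(?P ** ?V) $ i $ Inl u = a * ri $ i" by (simp only: \<Gamma>c)
    have "(?P ** ?V) $ i $ Inr \<beta> = b * (\<Sum>\<gamma>\<in>UNIV. \<Gamma> $ i $ \<gamma> * c $ \<gamma>) * c' $ \<beta> + a * (\<Sum>\<gamma>\<in>UNIV. \<Gamma> $ i $ \<gamma> * h $ \<gamma> $ \<beta>)"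
      by (simp add: matrix_matrix_mult_def sum_UNIV_Plus sum_distrib_left sum_distrib_right sum.distrib algebra_simps)
    then show "(?P ** ?V) $ i $ Inr \<beta> = b * ri $ i * c' $ \<beta> + a * D1 $ i $ \<beta>" by (simp only: \<Gamma>c D1')
  qed
  have VQ: "(?V ** ?Q) $ Inl u $ j = a * rj $ j" "(?V ** ?Q) $ Inr \<alpha> $ j = b * c $ \<alpha> * rj $ j + a * D2 $ \<alpha> $ j" for j u \<alpha>
  proof -
    have "(?V ** ?Q) $ Inl u $ j = a * (\<Sum>\<gamma>\<in>UNIV. c' $ \<gamma> * \<Gamma>' $ \<gamma> $ j)"
      by (simp add: matrix_matrix_mult_def sum_UNIV_Plus sum_distrib_left mult_ac)
    then show "(?V ** ?Q) $ Inl u $ j = a * rj $ j" by (simp only: c\<Gamma>)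
    have "(?V ** ?Q) $ Inr \<alpha> $ j = b * c $ \<alpha> * (\<Sum>\<gamma>\<in>UNIV. c' $ \<gamma> * \<Gamma>' $ \<gamma> $ j) + a * (\<Sum>\<gamma>\<in>UNIV. h $ \<alpha> $ \<gamma> * \<Gamma>' $ \<gamma> $ j)"
      by (simp add: matrix_matrix_mult_def sum_UNIV_Plus sum_distrib_left sum_distrib_right sum.distrib algebra_simps)
    then show "(?V ** ?Q) $ Inr \<alpha> $ j = b * c $ \<alpha> * rj $ j + a * D2 $ \<alpha> $ j" by (simp only: c\<Gamma> D2')
  qed
  have PVQ: "(?P ** ?V ** ?Q) $ i $ j = b * ri $ i * rj $ j + a * (\<Gamma> ** h ** \<Gamma>') $ i $ j" for i j
  proof -
    have "(?P ** ?V ** ?Q) $ i $ j = (\<Sum>u\<in>UNIV. (?P ** ?V) $ i $ u * ?Q $ u $ j)"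
      by (simp add: matrix_matrix_mult_def)
    also have "\<dots> = (\<Sum>\<beta>\<in>UNIV. (b * ri $ i * c' $ \<beta> + a * D1 $ i $ \<beta>) * \<Gamma>' $ \<beta> $ j)"
      by (simp only: sum_UNIV_Plus PV) simp
    also have "\<dots> = b * ri $ i * (\<Sum>\<beta>\<in>UNIV. c' $ \<beta> * \<Gamma>' $ \<beta> $ j) + a * (\<Sum>\<beta>\<in>UNIV. D1 $ i $ \<beta> * \<Gamma>' $ \<beta> $ j)"
      by (simp add: sum_distrib_left sum.distrib algebra_simps)
    also have "(\<Sum>\<beta>\<in>UNIV. D1 $ i $ \<beta> * \<Gamma>' $ \<beta> $ j) = (\<Gamma> ** h ** \<Gamma>') $ i $ j"
      unfolding D1 by (simp add: matrix_matrix_mult_def)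
    finally show ?thesis by (simp only: c\<Gamma>)
  qed
  have "det (bordered G (\<chi> t. a * p t) (\<chi> s. a * q s) (\<chi> s t. T s t)) = det ?S * det ?V"
  proof (rule det_fibred_schur[of _ ?S ?P ?V ?Q], rule block_eqI)
    show "(\<chi> x y. bordered G (\<chi> t. a * p t) (\<chi> s. a * q s) (\<chi> s t. T s t)
         $ (case x of Inl i \<Rightarrow> Inr (Inl i) | Inr (Inl u) \<Rightarrow> Inl u | Inr (Inr a) \<Rightarrow> Inr (Inr a))
         $ (case y of Inl i \<Rightarrow> Inr (Inl i) | Inr (Inl u) \<Rightarrow> Inl u | Inr (Inr a) \<Rightarrow> Inr (Inr a))) $ Inl i $ Inl j
      = block (?S + ?P ** ?V ** ?Q) (?P ** ?V) (?V ** ?Q) ?V $ Inl i $ Inl j" for i j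
      by (simp only: block_nth vector_add_component PVQ) (simp add: T E algebra_simps)
    show "(\<chi> x y. bordered G (\<chi> t. a * p t) (\<chi> s. a * q s) (\<chi> s t. T s t)
         $ (case x of Inl i \<Rightarrow> Inr (Inl i) | Inr (Inl u) \<Rightarrow> Inl u | Inr (Inr a) \<Rightarrow> Inr (Inr a))
         $ (case y of Inl i \<Rightarrow> Inr (Inl i) | Inr (Inl u) \<Rightarrow> Inl u | Inr (Inr a) \<Rightarrow> Inr (Inr a))) $ Inl i $ Inr v
      = block (?S + ?P ** ?V ** ?Q) (?P ** ?V) (?V ** ?Q) ?V $ Inl i $ Inr v" for i v
      by (cases v; simp only: block_nth PV) (simp_all add: T q)
    show "(\<chi> x y. bordered G (\<chi> t. a * p t) (\<chi> s. a * q s) (\<chi> s t. T s t)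
         $ (case x of Inl i \<Rightarrow> Inr (Inl i) | Inr (Inl u) \<Rightarrow> Inl u | Inr (Inr a) \<Rightarrow> Inr (Inr a))
         $ (case y of Inl i \<Rightarrow> Inr (Inl i) | Inr (Inl u) \<Rightarrow> Inl u | Inr (Inr a) \<Rightarrow> Inr (Inr a))) $ Inr v $ Inl j
      = block (?S + ?P ** ?V ** ?Q) (?P ** ?V) (?V ** ?Q) ?V $ Inr v $ Inl j" for v j
      by (cases v; simp only: block_nth VQ) (simp_all add: T p)
    show "(\<chi> x y. bordered G (\<chi> t. a * p t) (\<chi> s. a * q s) (\<chi> s t. T s t)
         $ (case x of Inl i \<Rightarrow> Inr (Inl i) | Inr (Inl u) \<Rightarrow> Inl u | Inr (Inr a) \<Rightarrow> Inr (Inr a))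
         $ (case y of Inl i \<Rightarrow> Inr (Inl i) | Inr (Inl u) \<Rightarrow> Inl u | Inr (Inr a) \<Rightarrow> Inr (Inr a))) $ Inr v $ Inr v'
      = block (?S + ?P ** ?V ** ?Q) (?P ** ?V) (?V ** ?Q) ?V $ Inr v $ Inr v'" for v v'
      by (cases v; cases v') (simp_all add: T p q)
  qed
  also have "det ?V = (G - a * r + b / a * G * r) * a ^ CARD('k) * det h"
    by (rule det_bordered_radial[OF a c c' r])
  finally show ?thesis .
qed

text \<open>For a real function the antiholomorphic derivatives are the conjugates of the holomorphic ones,
  so that the latter determine the differential.\<close>

lemma dz_of_real_frechet:
  fixes u :: "complex^'a \<Rightarrow> real"
  assumes u: "u differentiable (at z)"
  shows "frechet_derivative u (at z) = (\<lambda>v. 0) \<longleftrightarrow> (\<forall>i. dz i (\<lambda>x. complex_of_real (u x)) z = 0)"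
proof -
  have D: "((\<lambda>x. complex_of_real (u x)) has_derivative (\<lambda>v. of_real (frechet_derivative u (at z) v))) (at z)"
    using u by (intro has_derivative_of_real) (simp add: frechet_derivative_works[symmetric])
  then have d: "(\<lambda>x. complex_of_real (u x)) differentiable (at z)" by (auto simp: differentiable_def)
  show ?thesis
  proof
    assume "frechet_derivative u (at z) = (\<lambda>v. 0)"
    then show "\<forall>i. dz i (\<lambda>x. complex_of_real (u x)) z = 0" by (simp add: dz_eqI[OF D])
  next
    assume 0: "\<forall>i. dz i (\<lambda>x. complex_of_real (u x)) z = 0"
    then have "dzbar i (\<lambda>x. complex_of_real (u x)) z = 0" for i
      using cnj_dz_of_real[OF u, of i] by (metis complex_cnj_zero)
    with 0 have "frechet_derivative (\<lambda>x. complex_of_real (u x)) (at z) v = 0" for v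
      by (simp add: frechet_wirtinger[OF d])
    then show "frechet_derivative u (at z) = (\<lambda>v. 0)"
      using frechet_derivative_at[OF D] by (auto simp: fun_eq_iff)
  qed
qed

text \<open>The local form of the theorem. The splitting of the curvature enters through the hypothesis
  \<open>\<Theta> = - (1/k) h \<otimes> g\<close>. It makes the horizontal part of the complex Hessian of \<open>r\<close> equal to \<open>(r/k) g\<close>, which gives
  both the value of \<open>J\<close> and the sign of the Levi form.\<close>

lemma sphere_bundle_local_defining_function:
  fixes Z :: "(complex^'n::finite) set" and H :: "complex^'n \<Rightarrow> complex^('k::finite)^'k"
    and g :: "complex^'n \<Rightarrow> complex^'n^'n"
  assumes Z: "open Z" and H: "\<And>\<alpha> \<beta>. smooth_on Z (\<lambda>z. H z $ \<alpha> $ \<beta>)"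
    and pdH: "\<And>z. z \<in> Z \<Longrightarrow> pos_def (H z)" and pdg: "\<And>z. z \<in> Z \<Longrightarrow> pos_def (g z)"
    and curv: "\<And>z \<alpha> \<beta> i j. z \<in> Z \<Longrightarrow>
        chern_curvature H z \<alpha> \<beta> i j = - (H z $ \<alpha> $ \<beta> * g z $ i $ j / of_nat CARD('k))"
    and ev: "\<And>z. z \<in> Z \<Longrightarrow> ordered_eigenvalues
        ((\<chi> i j. - dz i (dzbar j (\<lambda>x. complex_of_real (ln (Re (det (g x)))))) z) ** matrix_inv (g z)) ls"
    and z0: "z0 \<in> Z" and \<xi>0: "Re (sesq (H z0) \<xi>0) = 1"
  shows "\<exists>V \<rho>. open V \<and> vjoin z0 \<xi>0 \<in> V \<and> V \<subseteq> {y. base y \<in> Z} \<and>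
    pseudoconvex_defining_function V {y. Re (sesq (H (base y)) (fib y)) = 1} \<rho> \<and> (\<forall>y\<in>V. fefferman_J \<rho> y = 1)"
proof -
  define kk where "kk = real CARD('k)"
  define N1 where "N1 = real (CARD('n) + CARD('k) + 1)"
  have kk: "kk > 0" "complex_of_real kk = of_nat CARD('k)" by (simp_all add: kk_def)
  have N1: "N1 > 0" by (simp add: N1_def)
  define L1 where "L1 z = ln (Re (det (H z)))" for z
  define L2 where "L2 z = ln (Re (det (g z)))" for z
  have nzH: "det (H z) \<noteq> 0" if "z \<in> Z" for z using pos_def_det_nonzero[OF pdH[OF that]] .
  have nzg: "det (g z) \<noteq> 0" if "z \<in> Z" for z using pos_def_det_nonzero[OF pdg[OF that]] .
  have s_re_det: "smooth_on Z (\<lambda>z. Re (det (A z)))" if "\<And>\<alpha> \<beta>. smooth_on Z (\<lambda>z. A z $ \<alpha> $ \<beta>)" for A :: "complex^'n \<Rightarrow> complex^('q::finite)^'q"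
    by (rule smooth_on_linear[OF bounded_linear_Re Z smooth_on_det[OF Z that]])
  have sL1: "smooth_on Z L1"
    unfolding L1_def using pos_def_det_pos(1)[OF pdH] by (intro smooth_on_ln[OF Z] s_re_det H)
  have g_hess: "dz i (dzbar j (\<lambda>z. complex_of_real (L1 z))) z = g z $ i $ j" if z: "z \<in> Z" for i j z
  proof -
    \<comment> \<open>the trace of the identity of the fibre cancels the factor \<open>1/k\<close> in the curvature\<close>
    have tr: "(\<Sum>\<alpha>\<in>UNIV. \<Sum>\<beta>\<in>UNIV. matrix_inv (H z) $ \<beta> $ \<alpha> * H z $ \<alpha> $ \<beta>) = of_nat CARD('k)"
    proof -
      have "(\<Sum>\<alpha>\<in>UNIV. \<Sum>\<beta>\<in>UNIV. matrix_inv (H z) $ \<beta> $ \<alpha> * H z $ \<alpha> $ \<beta>)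
          = (\<Sum>\<beta>\<in>UNIV. (matrix_inv (H z) ** H z) $ \<beta> $ \<beta>)"
        unfolding matrix_matrix_mult_def by (simp, rule sum.swap)
      then show ?thesis by (simp add: matrix_inv_works[OF nzH[OF z]] mat_def)
    qed
    have "dz i (dzbar j (\<lambda>z. complex_of_real (L1 z))) z
       = - (\<Sum>\<alpha>\<in>UNIV. \<Sum>\<beta>\<in>UNIV. matrix_inv (H z) $ \<beta> $ \<alpha> * chern_curvature H z \<alpha> \<beta> i j)"
      unfolding L1_def by (rule hessian_log_det[OF Z H pdH z])
    also have "\<dots> = (\<Sum>\<alpha>\<in>UNIV. \<Sum>\<beta>\<in>UNIV. matrix_inv (H z) $ \<beta> $ \<alpha> * H z $ \<alpha> $ \<beta>) * (g z $ i $ j / of_nat CARD('k))"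
      by (simp add: curv[OF z] sum_negf sum_distrib_right sum_divide_distrib mult.assoc)
    also have "\<dots> = g z $ i $ j" by (simp add: tr)
    finally show ?thesis .
  qed
  have sg: "smooth_on Z (\<lambda>z. g z $ i $ j)" for i j
    by (rule smooth_on_cong[OF Z _ g_hess]) (intro smooth_on_dz smooth_on_dzbar Z smooth_on_of_real sL1)
  have sL2: "smooth_on Z L2"
    unfolding L2_def using pos_def_det_pos(1)[OF pdg] by (intro smooth_on_ln[OF Z] s_re_det sg)
  define Ric where "Ric z = (\<chi> i j. - dz i (dzbar j (\<lambda>x. complex_of_real (L2 x))) z)" for z
  have ev': "ordered_eigenvalues (Ric z ** matrix_inv (g z)) ls" if "z \<in> Z" for z
    using ev[OF that] by (simp add: Ric_def L2_def)

  define \<psi>0 where "\<psi>0 z = (L1 z + L2 z) * (1 / N1)" for z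
  have s\<psi>0: "smooth_on Z \<psi>0"
    unfolding \<psi>0_def by (intro smooth_on_mult smooth_on_add smooth_on_const sL1 sL2 Z)
  have hess\<psi>0: "dz i (dzbar j (\<lambda>z. complex_of_real (\<psi>0 z))) z = (g z $ i $ j - Ric z $ i $ j) / N1" if z: "z \<in> Z" for i j z
  proof -
    let ?l1 = "\<lambda>z. complex_of_real (L1 z)" and ?l2 = "\<lambda>z. complex_of_real (L2 z)" and ?c = "complex_of_real (1 / N1)"
    have s: "smooth_on Z ?l1" "smooth_on Z ?l2" by (intro smooth_on_of_real Z sL1 sL2)+
    have d: "?l1 differentiable (at x)" "?l2 differentiable (at x)"
      "dzbar j ?l1 differentiable (at x)" "dzbar j ?l2 differentiable (at x)" if "x \<in> Z" for x
      using that s smooth_on_dzbar[OF Z s(1)] smooth_on_dzbar[OF Z s(2)] by (auto intro: smooth_on_differentiable)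
    have c: "(\<lambda>x. ?c) differentiable (at x)" for x :: "complex^'n" by simp
    have e: "(\<lambda>z. complex_of_real (\<psi>0 z)) = (\<lambda>z. (?l1 z + ?l2 z) * ?c)" by (simp add: \<psi>0_def fun_eq_iff)
    have f: "dzbar j (\<lambda>z. complex_of_real (\<psi>0 z)) x = (dzbar j ?l1 x + dzbar j ?l2 x) * ?c" if "x \<in> Z" for x
      unfolding e dzbar_mult[OF differentiable_add[OF d(1,2)[OF that]] c] dzbar_add[OF d(1,2)[OF that]] by simp
    have "dz i (dzbar j (\<lambda>z. complex_of_real (\<psi>0 z))) z = dz i (\<lambda>x. (dzbar j ?l1 x + dzbar j ?l2 x) * ?c) z"
      by (rule wirtinger_cong(1)[OF Z z f])
         (use smooth_on_differentiable[OF smooth_on_dzbar[OF Z smooth_on_of_real[OF Z s\<psi>0]] z] in auto)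
    also have "\<dots> = (dz i (dzbar j ?l1) z + dz i (dzbar j ?l2) z) * ?c"
      unfolding dz_mult[OF differentiable_add[OF d(3,4)[OF z]] c] dz_add[OF d(3,4)[OF z]] by simp
    finally show ?thesis by (simp add: g_hess[OF z] Ric_def)
  qed

  define r where "r y = Re (quad H y)" for y :: "complex^('n + 'k)"
  let ?R = "\<lambda>y. complex_of_real (r y)"
  define \<psi> where "\<psi> y = \<psi>0 (base y)" for y :: "complex^('n + 'k)"
  let ?X = "\<lambda>y. complex_of_real (\<psi> y)"
  define W where "W = {y :: complex^('n + 'k). base y \<in> Z}"
  have W: "open W"
  proof -
    have "continuous_on UNIV (base :: complex^('n + 'k) \<Rightarrow> complex^'n)"
      by (rule linear_continuous_on[OF bounded_linear_base])
    then have "open (base -` Z :: (complex^('n + 'k)) set)" by (rule open_vimage[OF Z])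
    then show ?thesis by (simp add: W_def vimage_def)
  qed
  have s_base: "smooth_on W (\<lambda>y. f (base y))" if "smooth_on Z f" for f :: "complex^'n \<Rightarrow> 'q::real_normed_vector"
    by (rule smooth_on_compose[OF W Z that smooth_on_bounded_linear[OF bounded_linear_base W]]) (auto simp: W_def)
  have s_nth: "smooth_on W (\<lambda>y. y $ s)" for s by (rule smooth_on_bounded_linear[OF bounded_linear_vec_nth W])
  have s_quad: "smooth_on W (quad A)" if "\<And>\<alpha> \<beta>. smooth_on Z (\<lambda>z. A z $ \<alpha> $ \<beta>)" for A :: "complex^'n \<Rightarrow> complex^'k^'k"
    unfolding quad_def
    by (intro smooth_on_sum[OF W] smooth_on_mult[OF W] s_base that s_nth smooth_on_linear[OF bounded_linear_cnj W])
  have sr: "smooth_on W r"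
    unfolding r_def by (rule smooth_on_linear[OF bounded_linear_Re W s_quad[OF H]])
  have s\<psi>: "smooth_on W \<psi>" unfolding \<psi>_def by (rule s_base[OF s\<psi>0])
  have Rq: "?R y = quad H y" if "y \<in> W" for y
    using sesq_hermitian_real[of "H (base y)" "fib y"] pdH[of "base y"] that
    by (simp add: r_def quad_conv_sesq W_def pos_def_def complex_eq_iff)

  have dH: "(\<lambda>z. H z $ \<alpha> $ \<beta>) differentiable (at z)" if "z \<in> Z" for \<alpha> \<beta> z
    by (rule smooth_on_differentiable[OF H that])
  have dH': "(\<lambda>z. dzbm j H z $ \<alpha> $ \<beta>) differentiable (at z)" if "z \<in> Z" for \<alpha> \<beta> z j
    using smooth_on_differentiable[OF smooth_on_dzbar[OF Z H] that] by (simp add: dzbm_def)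
  have dR: "dz s ?R y = dz s (quad H) y" "dzbar s ?R y = dzbar s (quad H) y" if "y \<in> W" for s y
    using smooth_on_differentiable[OF s_quad[OF H] that]
    by (intro wirtinger_cong[OF W that, symmetric]; simp add: Rq)+
  have d2R: "dz s (dzbar t ?R) y = dz s f y" if "y \<in> W" "\<And>x. x \<in> W \<Longrightarrow> dzbar t ?R x = f x" for s t y f
    using smooth_on_differentiable[OF smooth_on_dzbar[OF W smooth_on_of_real[OF W sr]] that(1)]
    by (intro wirtinger_cong(1)[OF W that])
  have d2X: "dz s (dzbar t ?X) y = dz s f y" if "y \<in> W" "\<And>x. x \<in> W \<Longrightarrow> dzbar t ?X x = f x" for s t y f
    using smooth_on_differentiable[OF smooth_on_dzbar[OF W smooth_on_of_real[OF W s\<psi>]] that(1)]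
    by (intro wirtinger_cong(1)[OF W that])
  have d\<psi>0: "(\<lambda>z. complex_of_real (\<psi>0 z)) differentiable (at z)"
    "dzbar j (\<lambda>z. complex_of_real (\<psi>0 z)) differentiable (at z)" if "z \<in> Z" for z j
    using smooth_on_of_real[OF Z s\<psi>0] smooth_on_dzbar[OF Z smooth_on_of_real[OF Z s\<psi>0]] that
    by (auto intro: smooth_on_differentiable)

  define \<xi>' where "\<xi>' y = (\<chi> \<beta>. cnj (y $ Inr \<beta>))" for y :: "complex^('n + 'k)"
  \<comment> \<open>\<open>c\<close> and \<open>c'\<close> are the fibre derivatives of \<open>r\<close>, \<open>E\<close> and \<open>D1\<close>, \<open>D2\<close> the base and mixed blocks of its complex Hessian, and \<open>\<Gamma>\<close> contains the coefficients of the Chern connection\<close>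
  define c where "c y = (\<chi> \<alpha>. \<Sum>\<beta>\<in>UNIV. H (base y) $ \<alpha> $ \<beta> * \<xi>' y $ \<beta>)" for y :: "complex^('n + 'k)"
  define c' where "c' y = (\<chi> \<beta>. \<Sum>\<alpha>\<in>UNIV. fib y $ \<alpha> * H (base y) $ \<alpha> $ \<beta>)" for y :: "complex^('n + 'k)"
  define D1 where "D1 y = (\<chi> i \<beta>. \<Sum>\<alpha>\<in>UNIV. fib y $ \<alpha> * dzm i H (base y) $ \<alpha> $ \<beta>)" for y :: "complex^('n + 'k)"
  define D2 where "D2 y = (\<chi> \<alpha> j. \<Sum>\<beta>\<in>UNIV. dzbm j H (base y) $ \<alpha> $ \<beta> * \<xi>' y $ \<beta>)" for y :: "complex^('n + 'k)"
  define E where "E y = (\<chi> i j. quad (dzm i (dzbm j H)) y)" for y :: "complex^('n + 'k)"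
  define \<Gamma> where "\<Gamma> y = D1 y ** matrix_inv (H (base y))" for y
  define \<Gamma>' where "\<Gamma>' y = matrix_inv (H (base y)) ** D2 y" for y
  define S where "S y = (\<chi> i j. complex_of_real (r y / kk) * g (base y) $ i $ j)" for y

  have first: "dz (Inl i) ?R y = quad (dzm i H) y" "dzbar (Inl i) ?R y = quad (dzbm i H) y"
    "dz (Inr \<alpha>) ?R y = c y $ \<alpha>" "dzbar (Inr \<alpha>) ?R y = c' y $ \<alpha>" if y: "y \<in> W" for y i \<alpha>
    using y by (simp_all add: dR[OF y] wirtinger_quad[OF dH] W_def c_def c'_def \<xi>'_def mult.commute)
  have second: "dz (Inl i) (dzbar (Inl j) ?R) y = E y $ i $ j" "dz (Inr \<alpha>) (dzbar (Inl j) ?R) y = D2 y $ \<alpha> $ j"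
    "dz (Inl i) (dzbar (Inr \<beta>) ?R) y = D1 y $ i $ \<beta>" "dz (Inr \<alpha>) (dzbar (Inr \<beta>) ?R) y = H (base y) $ \<alpha> $ \<beta>"
    if y: "y \<in> W" for y i j \<alpha> \<beta>
  proof -
    have b: "base y \<in> Z" using y by (simp add: W_def)
    show "dz (Inl i) (dzbar (Inl j) ?R) y = E y $ i $ j"
      by (subst d2R[OF y first(2)]) (simp_all add: wirtinger_quad[OF dH'[OF b]] E_def)
    show "dz (Inr \<alpha>) (dzbar (Inl j) ?R) y = D2 y $ \<alpha> $ j"
      by (subst d2R[OF y first(2)]) (simp_all add: wirtinger_quad[OF dH'[OF b]] D2_def \<xi>'_def)
    have e: "dzbar (Inr \<beta>) ?R x = (\<Sum>\<alpha>\<in>UNIV. H (base x) $ \<alpha> $ \<beta> * x $ Inr \<alpha>)" if "x \<in> W" for x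
      by (simp add: first[OF that] c'_def mult.commute)
    have "dz (Inl i) (dzbar (Inr \<beta>) ?R) y = dz (Inl i) (\<lambda>x. \<Sum>\<alpha>\<in>UNIV. H (base x) $ \<alpha> $ \<beta> * x $ Inr \<alpha>) y"
      by (rule d2R[OF y e])
    also have "\<dots> = (\<Sum>\<alpha>\<in>UNIV. dzm i H (base y) $ \<alpha> $ \<beta> * y $ Inr \<alpha>)"
      by (rule dz_linear_in_fibre(1)[OF dH[OF b]])
    finally show "dz (Inl i) (dzbar (Inr \<beta>) ?R) y = D1 y $ i $ \<beta>" by (simp add: D1_def mult.commute)
    show "dz (Inr \<alpha>) (dzbar (Inr \<beta>) ?R) y = H (base y) $ \<alpha> $ \<beta>"
      by (subst d2R[OF y e]) (simp_all add: dz_linear_in_fibre[OF dH[OF b]])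
  qed
  have secondX: "dz (Inl i) (dzbar (Inl j) ?X) y = (g (base y) $ i $ j - Ric (base y) $ i $ j) / N1"
    "dz (Inr \<alpha>) (dzbar (Inl j) ?X) y = 0" "dz s (dzbar (Inr \<beta>) ?X) y = 0" if y: "y \<in> W" for y i j \<alpha> \<beta> s
  proof -
    have b: "base y \<in> Z" using y by (simp add: W_def)
    have e: "dzbar (Inl j) ?X x = dzbar j (\<lambda>z. complex_of_real (\<psi>0 z)) (base x)" "dzbar (Inr \<beta>) ?X x = 0" if "x \<in> W" for x
    proof -
      have "base x \<in> Z" using that by (simp add: W_def)
      from wirtinger_base[OF d\<psi>0(1)[OF this]]
      show "dzbar (Inl j) ?X x = dzbar j (\<lambda>z. complex_of_real (\<psi>0 z)) (base x)" "dzbar (Inr \<beta>) ?X x = 0"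
        by (simp_all add: \<psi>_def)
    qed
    show "dz (Inl i) (dzbar (Inl j) ?X) y = (g (base y) $ i $ j - Ric (base y) $ i $ j) / N1"
      by (subst d2X[OF y e(1)]) (simp_all add: wirtinger_base[OF d\<psi>0(2)[OF b]] hess\<psi>0[OF b])
    show "dz (Inr \<alpha>) (dzbar (Inl j) ?X) y = 0"
      by (subst d2X[OF y e(1)]) (simp_all add: wirtinger_base[OF d\<psi>0(2)[OF b]])
    show "dz s (dzbar (Inr \<beta>) ?X) y = 0"
      by (subst d2X[OF y e(2)]) simp_all
  qed

  have \<Gamma>H: "\<Gamma> y ** H (base y) = D1 y" and H\<Gamma>: "H (base y) ** \<Gamma>' y = D2 y" if "y \<in> W" for y
  proof -
    have b: "base y \<in> Z" using that by (simp add: W_def)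
    show "\<Gamma> y ** H (base y) = D1 y"
      by (simp add: \<Gamma>_def matrix_inv_works[OF nzH[OF b]] flip: matrix_mul_assoc)
    show "H (base y) ** \<Gamma>' y = D2 y"
      by (simp add: \<Gamma>'_def matrix_inv_works[OF nzH[OF b]] matrix_mul_assoc)
  qed
  have ES: "E y = S y + \<Gamma> y ** H (base y) ** \<Gamma>' y" if y: "y \<in> W" for y
  proof -
    have b: "base y \<in> Z" using y by (simp add: W_def)
    let ?B = "matrix_inv (H (base y))" and ?z = "base y" and ?\<xi> = "fib y"
    have "E y $ i $ j = S y $ i $ j + (D1 y ** ?B ** D2 y) $ i $ j" for i j
    proof -
      let ?K = "\<lambda>\<alpha> \<beta>. \<Sum>\<gamma>\<in>UNIV. \<Sum>\<delta>\<in>UNIV. ?B $ \<delta> $ \<gamma> * dz i (\<lambda>w. H w $ \<alpha> $ \<delta>) ?z * dzbar j (\<lambda>w. H w $ \<gamma> $ \<beta>) ?z"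
      have 1: "(\<Sum>\<alpha>\<in>UNIV. \<Sum>\<beta>\<in>UNIV. chern_curvature H ?z \<alpha> \<beta> i j * (?\<xi> $ \<alpha> * \<xi>' y $ \<beta>))
          = - E y $ i $ j + (\<Sum>\<alpha>\<in>UNIV. \<Sum>\<beta>\<in>UNIV. ?K \<alpha> \<beta> * (?\<xi> $ \<alpha> * \<xi>' y $ \<beta>))"
        by (simp add: chern_curvature_def E_def quad_def dzm_def dzbm_def \<xi>'_def left_diff_distrib sum_subtractf)
      have 2: "(\<Sum>\<alpha>\<in>UNIV. \<Sum>\<beta>\<in>UNIV. chern_curvature H ?z \<alpha> \<beta> i j * (?\<xi> $ \<alpha> * \<xi>' y $ \<beta>)) = - S y $ i $ j"
      proof -
        have "(\<Sum>\<alpha>\<in>UNIV. \<Sum>\<beta>\<in>UNIV. chern_curvature H ?z \<alpha> \<beta> i j * (?\<xi> $ \<alpha> * \<xi>' y $ \<beta>))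
          = - (quad H y * (g ?z $ i $ j / of_nat CARD('k)))"
          by (simp add: curv[OF b] quad_def \<xi>'_def sum_negf sum_distrib_left sum_divide_distrib mult_ac)
        then show ?thesis by (simp add: S_def kk Rq[OF y, symmetric])
      qed
      have 3: "(\<Sum>\<alpha>\<in>UNIV. \<Sum>\<beta>\<in>UNIV. ?K \<alpha> \<beta> * (?\<xi> $ \<alpha> * \<xi>' y $ \<beta>)) = (D1 y ** ?B ** D2 y) $ i $ j"
      proof -
        let ?t = "\<lambda>\<alpha> \<beta> \<gamma> \<delta>. ?\<xi> $ \<alpha> * dz i (\<lambda>w. H w $ \<alpha> $ \<delta>) ?z * ?B $ \<delta> $ \<gamma> * (dzbar j (\<lambda>w. H w $ \<gamma> $ \<beta>) ?z * \<xi>' y $ \<beta>)"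
        have "(\<Sum>\<alpha>\<in>UNIV. \<Sum>\<beta>\<in>UNIV. ?K \<alpha> \<beta> * (?\<xi> $ \<alpha> * \<xi>' y $ \<beta>)) = (\<Sum>\<alpha>\<in>UNIV. \<Sum>\<beta>\<in>UNIV. \<Sum>\<gamma>\<in>UNIV. \<Sum>\<delta>\<in>UNIV. ?t \<alpha> \<beta> \<gamma> \<delta>)"
          by (simp add: sum_distrib_left sum_distrib_right mult_ac)
        also have "\<dots> = (\<Sum>\<alpha>\<in>UNIV. \<Sum>\<gamma>\<in>UNIV. \<Sum>\<beta>\<in>UNIV. \<Sum>\<delta>\<in>UNIV. ?t \<alpha> \<beta> \<gamma> \<delta>)"
          by (rule sum.cong[OF refl], rule sum.swap)
        also have "\<dots> = (\<Sum>\<gamma>\<in>UNIV. \<Sum>\<alpha>\<in>UNIV. \<Sum>\<beta>\<in>UNIV. \<Sum>\<delta>\<in>UNIV. ?t \<alpha> \<beta> \<gamma> \<delta>)"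
          by (rule sum.swap)
        also have "\<dots> = (\<Sum>\<gamma>\<in>UNIV. \<Sum>\<alpha>\<in>UNIV. \<Sum>\<delta>\<in>UNIV. \<Sum>\<beta>\<in>UNIV. ?t \<alpha> \<beta> \<gamma> \<delta>)"
          by (rule sum.cong[OF refl], rule sum.cong[OF refl], rule sum.swap)
        also have "\<dots> = (\<Sum>\<gamma>\<in>UNIV. \<Sum>\<delta>\<in>UNIV. \<Sum>\<alpha>\<in>UNIV. \<Sum>\<beta>\<in>UNIV. ?t \<alpha> \<beta> \<gamma> \<delta>)"
          by (rule sum.cong[OF refl], rule sum.swap)
        also have "\<dots> = (D1 y ** ?B ** D2 y) $ i $ j"
          by (simp add: matrix_matrix_mult_def D1_def D2_def dzm_def dzbm_def sum_distrib_left sum_distrib_right mult_ac)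
        finally show ?thesis .
      qed
      have "E y $ i $ j = (D1 y ** ?B ** D2 y) $ i $ j - (- E y $ i $ j + (D1 y ** ?B ** D2 y) $ i $ j)" by simp
      also have "- E y $ i $ j + (D1 y ** ?B ** D2 y) $ i $ j = - S y $ i $ j"
        using 1 unfolding 2 3 by (rule sym)
      finally show ?thesis by simp
    qed
    then have "E y = S y + D1 y ** ?B ** D2 y" by (simp add: vec_eq_iff)
    also have "D1 y ** ?B ** D2 y = \<Gamma> y ** H (base y) ** \<Gamma>' y"
      unfolding \<Gamma>H[OF y] by (simp add: \<Gamma>'_def matrix_mul_assoc)
    finally show ?thesis .
  qed
  have ri: "quad (dzm i H) y = (\<Sum>\<beta>\<in>UNIV. D1 y $ i $ \<beta> * \<xi>' y $ \<beta>)" for i y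
    unfolding quad_def D1_def \<xi>'_def by (subst sum.swap) (simp add: sum_distrib_left sum_distrib_right mult_ac)
  have rj: "quad (dzbm j H) y = (\<Sum>\<alpha>\<in>UNIV. fib y $ \<alpha> * D2 y $ \<alpha> $ j)" for j y
    unfolding quad_def D2_def \<xi>'_def by (simp add: sum_distrib_left mult_ac)
  have rc: "?R y = (\<Sum>\<alpha>\<in>UNIV. fib y $ \<alpha> * c y $ \<alpha>)" if "y \<in> W" for y
    unfolding Rq[OF that] quad_def c_def \<xi>'_def by (simp add: sum_distrib_left mult_ac)

  define cs where "cs = map (\<lambda>l. (1 - l) / N1) ls"
  have lens: "length ls = CARD('n)" using ev[OF z0] by (simp add: ordered_eigenvalues_def)
  have k1: "CARD('k) \<ge> 1" by (simp add: Suc_leI)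
  obtain a b G G1 G2 where ab: "0 < a" "a < 1" "1 < b" and sG: "smooth_on {a<..<b} G"
    and Gd: "\<And>t. t \<in> {a<..<b} \<Longrightarrow> (G has_real_derivative G1 t) (at t)"
    and G1d: "\<And>t. t \<in> {a<..<b} \<Longrightarrow> (G1 has_real_derivative G2 t) (at t)"
    and G0: "\<And>t. t \<in> {a<..<b} \<Longrightarrow> G t = 0 \<longleftrightarrow> t = 1"
    and G1neg: "\<And>t. t \<in> {a<..<b} \<Longrightarrow> G1 t < 0"
    and Gode: "\<And>t. t \<in> {a<..<b} \<Longrightarrow> (- 1) ^ (length cs + CARD('k)) * (\<Prod>c\<leftarrow>cs. G1 t * t / CARD('k) - G t * c)
         * ((G t - G1 t * t + G2 t / G1 t * G t * t) * G1 t ^ CARD('k)) = 1"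
    using radial_profile[OF k1, of cs] by blast
  define V where "V = W \<inter> r -` {a<..<b}"
  have V: "open V"
    unfolding V_def by (rule continuous_open_preimage[OF smooth_on_continuous[OF sr] W]) auto
  have VW: "y \<in> W" "r y \<in> {a<..<b}" "base y \<in> Z" "r y > 0" if "y \<in> V" for y
    using that ab by (auto simp: V_def W_def)
  have VW': "V \<subseteq> W" by (auto simp: V_def)
  define \<rho> where "\<rho> y = G (r y) * exp (- \<psi> y)" for y
  note warp = V smooth_on_subset[OF sr VW'] smooth_on_subset[OF s\<psi> VW'] Gd[OF VW(2)] G1d[OF VW(2)]
  let ?m = "\<lambda>y. complex_of_real (exp (- \<psi> y))"

  have J: "fefferman_J \<rho> y = 1" if y: "y \<in> V" for y
  proof -
    note yW = VW(1)[OF y] and yr = VW(2)[OF y] and yZ = VW(3)[OF y]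
    let ?a = "complex_of_real (G1 (r y))" and ?b = "complex_of_real (G2 (r y))" and ?G = "complex_of_real (G (r y))"
    let ?z = "base y"
    let ?XX = "(\<chi> i j. (g ?z $ i $ j - Ric ?z $ i $ j) / N1) :: complex^'n^'n"
    let ?T = "\<lambda>s t. ?b * dz s ?R y * dzbar t ?R y + ?a * dz s (dzbar t ?R) y - ?G * dz s (dzbar t ?X) y"
    have "det (bordered ?G (\<chi> t. ?a * dzbar t ?R y) (\<chi> s. ?a * dz s ?R y) (\<chi> s t. ?T s t))
      = det (\<chi> i j. ?a * S y $ i $ j - ?G * ?XX $ i $ j) * ((?G - ?a * ?R y + ?b / ?a * ?G * ?R y) * ?a ^ CARD('k) * det (H ?z))"
    proof (rule det_bordered_fibred[where c = "c y" and c' = "c' y" and \<xi> = "fib y" and \<xi>' = "\<xi>' y" and \<Gamma> = "\<Gamma> y" and \<Gamma>' = "\<Gamma>' y"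
          and ri = "\<chi> i. quad (dzm i H) y" and rj = "\<chi> j. quad (dzbm j H) y"])
      show "?a \<noteq> 0" using G1neg[OF yr] by simp
      show "c y $ \<alpha> = (\<Sum>\<beta>\<in>UNIV. H ?z $ \<alpha> $ \<beta> * \<xi>' y $ \<beta>)" for \<alpha> by (simp add: c_def)
      show "c' y $ \<beta> = (\<Sum>\<alpha>\<in>UNIV. fib y $ \<alpha> * H ?z $ \<alpha> $ \<beta>)" for \<beta> by (simp add: c'_def)
      show "?R y = (\<Sum>\<alpha>\<in>UNIV. fib y $ \<alpha> * c y $ \<alpha>)" by (rule rc[OF yW])
      show "\<Gamma> y ** H ?z = D1 y" "H ?z ** \<Gamma>' y = D2 y" using \<Gamma>H[OF yW] H\<Gamma>[OF yW] by simp_all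
      show "E y = S y + \<Gamma> y ** H ?z ** \<Gamma>' y" by (rule ES[OF yW])
    qed (simp_all add: first[OF yW] second[OF yW] secondX[OF yW] ri rj)
    moreover have "det (\<chi> i j. ?a * S y $ i $ j - ?G * ?XX $ i $ j)
        = det (g ?z) * (\<Prod>l\<leftarrow>ls. complex_of_real (G1 (r y) * r y / kk - G (r y) * ((1 - l) / N1)))"
    proof -
      let ?p = "complex_of_real (G1 (r y) * r y / kk - G (r y) / N1)" and ?q = "complex_of_real (G (r y) / N1)"
      have "(\<chi> i j. ?a * S y $ i $ j - ?G * ?XX $ i $ j) = (\<chi> i j. ?p * g ?z $ i $ j + ?q * Ric ?z $ i $ j)"
        using N1 kk by (simp add: vec_eq_iff S_def field_simps)
      then have "det (\<chi> i j. ?a * S y $ i $ j - ?G * ?XX $ i $ j) = det (g ?z) * (\<Prod>l\<leftarrow>ls. ?p + ?q * complex_of_real l)"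
        by (simp only: det_pencil_eigenvalues[OF ev'[OF yZ] nzg[OF yZ]])
      also have "(\<lambda>l. ?p + ?q * complex_of_real l) = (\<lambda>l. complex_of_real (G1 (r y) * r y / kk - G (r y) * ((1 - l) / N1)))"
        using N1 by (simp add: fun_eq_iff field_simps)
      finally show ?thesis .
    qed
    moreover have "fefferman_J \<rho> y = (- 1) ^ CARD('n + 'k) * ?m y ^ Suc CARD('n + 'k)
       * det (bordered ?G (\<chi> t. ?a * dzbar t ?R y) (\<chi> s. ?a * dz s ?R y) (\<chi> s t. ?T s t))"
      unfolding \<rho>_def by (rule fefferman_J_warped[OF warp y])
    ultimately have "fefferman_J \<rho> y = (?m y ^ Suc CARD('n + 'k) * det (g ?z) * det (H ?z)) * ((- 1) ^ CARD('n + 'k)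
       * (\<Prod>l\<leftarrow>ls. complex_of_real (G1 (r y) * r y / kk - G (r y) * ((1 - l) / N1)))
       * ((?G - ?a * ?R y + ?b / ?a * ?G * ?R y) * ?a ^ CARD('k)))"
      by (simp add: mult_ac)
    also have "(- 1) ^ CARD('n + 'k)
       * (\<Prod>l\<leftarrow>ls. complex_of_real (G1 (r y) * r y / kk - G (r y) * ((1 - l) / N1)))
       * ((?G - ?a * ?R y + ?b / ?a * ?G * ?R y) * ?a ^ CARD('k))
      = complex_of_real ((- 1) ^ (length cs + CARD('k)) * (\<Prod>c\<leftarrow>cs. G1 (r y) * r y / CARD('k) - G (r y) * c)
         * ((G (r y) - G1 (r y) * r y + G2 (r y) / G1 (r y) * G (r y) * r y) * G1 (r y) ^ CARD('k)))"
    proof -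
      have "(\<Prod>l\<leftarrow>ls. complex_of_real (G1 (r y) * r y / kk - G (r y) * ((1 - l) / N1)))
        = complex_of_real (\<Prod>c\<leftarrow>map (\<lambda>l. (1 - l) / N1) ls. G1 (r y) * r y / CARD('k) - G (r y) * c)" for ls
        unfolding kk_def by (induction ls) simp_all
      then show ?thesis by (simp add: cs_def lens)
    qed
    also have "\<dots> = 1" by (simp only: Gode[OF yr] of_real_1)
    also have "?m y ^ Suc CARD('n + 'k) * det (g ?z) * det (H ?z) = 1"
    proof -
      have "?m y ^ Suc CARD('n + 'k) = complex_of_real (exp (N1 * (- \<psi> y)))"
        unfolding N1_def exp_of_nat_mult by simp
      also have "N1 * (- \<psi> y) = - (L1 ?z + L2 ?z)" using N1 by (simp add: \<psi>_def \<psi>0_def)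
      also have "exp (- (L1 ?z + L2 ?z)) = 1 / (Re (det (H ?z)) * Re (det (g ?z)))"
        using pos_def_det_pos(1)[OF pdH[OF yZ]] pos_def_det_pos(1)[OF pdg[OF yZ]]
        by (simp only: exp_minus exp_add L1_def L2_def exp_ln inverse_eq_divide)
      finally have m: "?m y ^ Suc CARD('n + 'k) = 1 / (complex_of_real (Re (det (H ?z))) * complex_of_real (Re (det (g ?z))))"
        by simp
      then show ?thesis
        unfolding m pos_def_det_pos(2)[OF pdH[OF yZ], symmetric] pos_def_det_pos(2)[OF pdg[OF yZ], symmetric]
        using nzH[OF yZ] nzg[OF yZ] by simp
    qed
    finally show ?thesis by simp
  qed

  have s\<rho>: "smooth_on V \<rho>"
    unfolding \<rho>_def
    using VW(2) by (intro smooth_on_mult[OF V] smooth_on_exp[OF V] smooth_on_minus[OF V] warp(3)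
      smooth_on_compose[OF V _ sG warp(2)]) auto
  have pc: "pseudoconvex_defining_function V {y. Re (sesq (H (base y)) (fib y)) = 1} \<rho>"
    unfolding pseudoconvex_defining_function_def
  proof (intro conjI ballI allI impI)
    show "smooth_on V \<rho>" by (rule s\<rho>)
    have r1: "Re (sesq (H (base y)) (fib y)) = r y" for y by (simp add: r_def quad_conv_sesq)
    show "{y \<in> V. \<rho> y = 0} = {y. Re (sesq (H (base y)) (fib y)) = 1} \<inter> V"
      using G0[OF VW(2)] by (auto simp: \<rho>_def r1)
    fix y assume "y \<in> {y. Re (sesq (H (base y)) (fib y)) = 1} \<inter> V"
    then have y: "y \<in> V" and ry: "r y = 1" by (auto simp: r1)
    note yW = VW(1)[OF y] and yr = VW(2)[OF y] and yZ = VW(3)[OF y]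
    have Gy: "G (r y) = 0" using G0[OF yr] ry by simp
    have G1y: "G1 (r y) < 0" by (rule G1neg[OF yr])
    show "frechet_derivative \<rho> (at y) \<noteq> (\<lambda>v. 0)"
    proof
      assume "frechet_derivative \<rho> (at y) = (\<lambda>v. 0)"
      then have "dz (Inr \<alpha>) (\<lambda>x. complex_of_real (\<rho> x)) y = 0" for \<alpha>
        using dz_of_real_frechet[OF smooth_on_differentiable[OF s\<rho> y]] by blast
      then have "c y $ \<alpha> = 0" for \<alpha>
        using warped_first_derivatives(1)[OF warp y, of "Inr \<alpha>"] Gy G1y
        by (simp add: \<rho>_def first[OF yW])
      then have "?R y = 0" by (simp add: rc[OF yW])
      with ry show False by simp
    qed
    fix w :: "complex^('n + 'k)"
    assume w: "w \<noteq> 0 \<and> (\<Sum>i\<in>UNIV. dz i (\<lambda>x. complex_of_real (\<rho> x)) y * w $ i) = 0"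
    have "sesq (\<chi> i j. dz i (dzbar j (\<lambda>x. complex_of_real (- \<rho> x))) y) w
       = - (?m y * G1 (r y)) * sesq (\<chi> i j. dz i (dzbar j ?R) y) w"
      unfolding \<rho>_def using w Gy G1y
      by (intro levi_form_warped(2)[OF warp y]) (auto simp: \<rho>_def)
    also have "(\<chi> i j. dz i (dzbar j ?R) y) = block (S y + \<Gamma> y ** H (base y) ** \<Gamma>' y) (\<Gamma> y ** H (base y)) (H (base y) ** \<Gamma>' y) (H (base y))"
      unfolding ES[OF yW, symmetric] unfolding \<Gamma>H[OF yW] H\<Gamma>[OF yW]
      by (rule block_eqI) (simp_all add: second[OF yW])
    also have "sesq (block (S y + \<Gamma> y ** H (base y) ** \<Gamma>' y) (\<Gamma> y ** H (base y)) (H (base y) ** \<Gamma>' y) (H (base y))) w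
      = sesq (S y) (\<chi> i. w $ Inl i) + sesq (H (base y)) (\<chi> b. w $ Inr b + (\<Sum>i\<in>UNIV. w $ Inl i * \<Gamma> y $ i $ b))"
    proof (rule sesq_block_schur)
      \<comment> \<open>both \<open>\<Gamma>'\<close> and the conjugate transpose of \<open>\<Gamma>\<close> solve \<open>H X = D2\<close>, as \<open>H\<close> is Hermitian\<close>
      let ?A = "(\<chi> p j. cnj (\<Gamma> y $ j $ p)) :: complex^'n^'k"
      have hc: "cnj (H x $ \<alpha> $ \<beta>) = H x $ \<beta> $ \<alpha>" if "x \<in> Z" for x \<alpha> \<beta>
        using pdH[OF that] by (simp add: pos_def_def hermitian_cnj)
      have dc: "cnj (dzm j H (base y) $ \<beta> $ \<alpha>) = dzbm j H (base y) $ \<alpha> $ \<beta>" for j \<alpha> \<beta>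
      proof -
        have "dzbar j (\<lambda>x. cnj (H x $ \<beta> $ \<alpha>)) (base y) = dzbar j (\<lambda>x. H x $ \<alpha> $ \<beta>) (base y)"
          by (rule wirtinger_cong(2)[OF Z yZ hc]) (auto intro: differentiable_cnj dH[OF yZ])
        then show ?thesis by (simp add: dzbar_cnj[OF dH[OF yZ]] dzm_def dzbm_def)
      qed
      have "H (base y) ** ?A = D2 y"
      proof -
        have "(H (base y) ** ?A) $ \<alpha> $ j = cnj ((\<Gamma> y ** H (base y)) $ j $ \<alpha>)" for \<alpha> j
          by (simp add: matrix_matrix_mult_def cnj_sum hc[OF yZ] mult.commute)
        then show ?thesis
          unfolding \<Gamma>H[OF yW] by (simp add: vec_eq_iff D1_def D2_def \<xi>'_def cnj_sum dc mult.commute)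
      qed
      then have "matrix_inv (H (base y)) ** (H (base y) ** ?A) = \<Gamma>' y" by (simp add: \<Gamma>'_def)
      then have "?A = \<Gamma>' y" by (simp add: matrix_inv_works[OF nzH[OF yZ]] matrix_mul_assoc)
      then show "\<Gamma>' y $ p $ j = cnj (\<Gamma> y $ j $ p)" for p j by (auto simp: vec_eq_iff)
    qed
    finally have eq: "sesq (\<chi> i j. dz i (dzbar j (\<lambda>x. complex_of_real (- \<rho> x))) y) w
       = complex_of_real (- (exp (- \<psi> y) * G1 (r y))) * (sesq (S y) (\<chi> i. w $ Inl i)
           + sesq (H (base y)) (\<chi> b. w $ Inr b + (\<Sum>i\<in>UNIV. w $ Inl i * \<Gamma> y $ i $ b)))"
      by simp
    let ?v = "(\<chi> i. w $ Inl i) :: complex^'n"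
    let ?e = "(\<chi> b. w $ Inr b + (\<Sum>i\<in>UNIV. w $ Inl i * \<Gamma> y $ i $ b)) :: complex^'k"
    have S0: "sesq (S y) ?v = complex_of_real (r y / kk) * sesq (g (base y)) ?v"
      by (simp add: sesq_def S_def sum_distrib_left mult_ac)
    have ge0: "Re (sesq A u) \<ge> 0" if "pos_def A" for A :: "complex^'q::finite^'q" and u
      using that by (cases "u = 0") (auto simp: pos_def_def sesq_def less_imp_le)
    have "Re (sesq (S y) ?v) + Re (sesq (H (base y)) ?e) > 0"
    proof (cases "?v = 0")
      case True
      then have v0: "w $ Inl i = 0" for i by (auto simp: vec_eq_iff)
      have "?e \<noteq> 0"
      proof
        assume e0: "?e = 0"
        have "w $ Inr b = 0" for b using arg_cong[OF e0, of "\<lambda>x. x $ b"] by (simp add: v0)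
        then have "w $ s = 0" for s using v0 by (cases s) auto
        with w show False by (auto simp: vec_eq_iff)
      qed
      then have "Re (sesq (H (base y)) ?e) > 0" using pdH[OF yZ] by (auto simp: pos_def_def)
      moreover have "Re (sesq (S y) ?v) = 0" unfolding True by (simp add: sesq_def)
      ultimately show ?thesis by simp
    next
      case False
      then have "Re (sesq (g (base y)) ?v) > 0" using pdg[OF yZ] by (auto simp: pos_def_def)
      then have "Re (sesq (S y) ?v) > 0" unfolding S0 using ry kk by simp
      then show ?thesis using ge0[OF pdH[OF yZ], of ?e] by linarith
    qed
    moreover have "- (exp (- \<psi> y) * G1 (r y)) > 0" using G1y by (simp add: mult_pos_neg)
    ultimately show "Re (sesq (\<chi> i j. dz i (dzbar j (\<lambda>x. complex_of_real (- \<rho> x))) y) w) > 0"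
      unfolding eq Re_complex_of_real times_complex.sel by (simp only: Re_complex_of_real Im_complex_of_real plus_complex.sel) (simp add: mult_neg_pos)
  qed
  have "r (vjoin z0 \<xi>0) = 1" using \<xi>0 by (simp add: r_def quad_conv_sesq)
  then have "vjoin z0 \<xi>0 \<in> V" using z0 ab by (simp add: V_def W_def)
  moreover have "V \<subseteq> {y. base y \<in> Z}" using VW' by (simp add: W_def)
  ultimately show ?thesis using V pc J by blast
qed

section \<open>Biholomorphic invariance\<close>

lemma dzbar_dz_commute:
  fixes f :: "complex^'a \<Rightarrow> complex"
  assumes S: "open S" and f: "smooth_on S f" and z: "z \<in> S"
  shows "dzbar j (dz k f) z = dz k (dzbar j f) z"
proof -
  let ?D = "\<lambda>u x. frechet_derivative f (at x) u"
  have D: "((\<lambda>x. ?D u x) has_derivative frechet_derivative (?D u) (at z)) (at z)" for u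
    using smooth_on_differentiable[OF smooth_on_frechet[OF f] z] by (simp add: frechet_derivative_works[symmetric])
  have sym: "frechet_derivative (?D u) (at z) v = frechet_derivative (?D v) (at z) u" for u v
    by (rule second_derivative_symmetric[OF S f z])
  have d1: "(dz k f has_derivative (\<lambda>v. (frechet_derivative (?D (axis k 1)) (at z) v
      - \<i> * frechet_derivative (?D (axis k \<i>)) (at z) v) / 2)) (at z)"
    unfolding dz_def
    by (rule bounded_linear.has_derivative[OF bounded_linear_divide], intro has_derivative_diff has_derivative_mult_right D)
  have d2: "(dzbar j f has_derivative (\<lambda>v. (frechet_derivative (?D (axis j 1)) (at z) v
      + \<i> * frechet_derivative (?D (axis j \<i>)) (at z) v) / 2)) (at z)"
    unfolding dzbar_def
    by (rule bounded_linear.has_derivative[OF bounded_linear_divide], intro has_derivative_add has_derivative_mult_right D)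
  show ?thesis
    by (simp add: dz_eqI[OF d2] dzbar_eqI[OF d1] sym[of "axis k 1"] sym[of "axis k \<i>"] algebra_simps diff_divide_distrib add_divide_distrib)
qed

text \<open>Holomorphy of scalar functions in terms of \<open>dzbar\<close>; by symmetry of second derivatives this class is
  closed under \<open>dz\<close>.\<close>

definition hol_on :: "(complex^'a) set \<Rightarrow> (complex^'a \<Rightarrow> complex) \<Rightarrow> bool" where
  "hol_on S f \<longleftrightarrow> smooth_on S f \<and> (\<forall>z\<in>S. \<forall>j. dzbar j f z = 0)"

context
  fixes S :: "(complex^'a) set"
  assumes S: "open S"
begin

lemma hol_on_const: "hol_on S (\<lambda>x. c)"
  using S by (simp add: hol_on_def smooth_on_const)

lemma hol_on_mult: "hol_on S f \<Longrightarrow> hol_on S g \<Longrightarrow> hol_on S (\<lambda>x. f x * g x)"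
  using S by (auto simp: hol_on_def smooth_on_mult dzbar_mult[OF smooth_on_differentiable smooth_on_differentiable])

lemma hol_on_add: "hol_on S f \<Longrightarrow> hol_on S g \<Longrightarrow> hol_on S (\<lambda>x. f x + g x)"
  using S by (auto simp: hol_on_def smooth_on_add dzbar_add[OF smooth_on_differentiable smooth_on_differentiable])

lemma hol_on_sum: "finite I \<Longrightarrow> (\<And>i. i \<in> I \<Longrightarrow> hol_on S (f i)) \<Longrightarrow> hol_on S (\<lambda>x. \<Sum>i\<in>I. f i x)"
  by (induction I rule: finite_induct) (auto intro: hol_on_const hol_on_add)

lemma hol_on_prod: "finite I \<Longrightarrow> (\<And>i. i \<in> I \<Longrightarrow> hol_on S (f i)) \<Longrightarrow> hol_on S (\<lambda>x. \<Prod>i\<in>I. f i x)"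
  by (induction I rule: finite_induct) (auto intro: hol_on_const hol_on_mult)

lemma hol_on_det: "(\<And>i j. hol_on S (\<lambda>x. A x $ i $ j)) \<Longrightarrow> hol_on S (\<lambda>x. det (A x))"
  unfolding det_def by (intro hol_on_sum hol_on_mult hol_on_const hol_on_prod) auto

lemma hol_on_dz: "hol_on S f \<Longrightarrow> hol_on S (dz k f)"
proof -
  assume f: "hol_on S f"
  then have s: "smooth_on S f" by (simp add: hol_on_def)
  have "dzbar j (dz k f) z = 0" if z: "z \<in> S" for j z
  proof -
    have "dz k (dzbar j f) z = dz k (\<lambda>x. 0) z"
      by (rule wirtinger_cong(1)[OF S z])
         (use f smooth_on_differentiable[OF smooth_on_dzbar[OF S s] z] in \<open>auto simp: hol_on_def\<close>)
    then show ?thesis by (simp add: dzbar_dz_commute[OF S s z])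
  qed
  then show ?thesis using smooth_on_dz[OF S s] by (simp add: hol_on_def)
qed

lemma hol_on_inverse:
  assumes f: "hol_on S f" and nz: "\<And>x. x \<in> S \<Longrightarrow> f x \<noteq> 0"
  shows "hol_on S (\<lambda>x. inverse (f x))"
proof -
  have s: "smooth_on S f" using f by (simp add: hol_on_def)
  have si: "smooth_on S (\<lambda>x. inverse (f x))" by (rule smooth_on_inverse[OF S s nz])
  have "dzbar j (\<lambda>x. inverse (f x)) z = 0" if z: "z \<in> S" for j z
  proof -
    have "dzbar j (\<lambda>x. f x * inverse (f x)) z = dzbar j (\<lambda>x. 1) z"
      by (rule wirtinger_cong(2)[OF S z])
         (use nz smooth_on_differentiable[OF smooth_on_mult[OF S s si] z] in auto)
    moreover have "dzbar j (\<lambda>x. f x * inverse (f x)) z = f z * dzbar j (\<lambda>x. inverse (f x)) z"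
      using f z by (simp add: dzbar_mult[OF smooth_on_differentiable[OF s z] smooth_on_differentiable[OF si z]] hol_on_def)
    ultimately show ?thesis using nz[OF z] by simp
  qed
  with si show ?thesis by (simp add: hol_on_def)
qed

text \<open>The antiholomorphic derivative of \<open>log \<bar>D\<bar>\<^sup>2\<close> is the conjugate of the holomorphic function \<open>D\<^sub>k / D\<close>.\<close>

lemma hessian_log_hol:
  assumes D: "hol_on S D" and nz: "\<And>x. x \<in> S \<Longrightarrow> D x \<noteq> 0"
  shows "smooth_on S (\<lambda>x. ln (Re (D x * cnj (D x))))"
    and "z \<in> S \<Longrightarrow> dz j (dzbar k (\<lambda>x. complex_of_real (ln (Re (D x * cnj (D x)))))) z = 0"
proof -
  have s: "smooth_on S D" using D by (simp add: hol_on_def)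
  have sc: "smooth_on S (\<lambda>x. cnj (D x))" by (rule smooth_on_linear[OF bounded_linear_cnj S s])
  have sq: "smooth_on S (\<lambda>x. Re (D x * cnj (D x)))"
    by (rule smooth_on_linear[OF bounded_linear_Re S smooth_on_mult[OF S s sc]])
  have real: "complex_of_real (Re (D x * cnj (D x))) = D x * cnj (D x)" for x
    by (simp add: complex_eq_iff)
  have pos: "Re (D x * cnj (D x)) > 0" if "x \<in> S" for x
    using nz[OF that] by (simp add: complex_neq_0 flip: power2_eq_square)
  show s_ln: "smooth_on S (\<lambda>x. ln (Re (D x * cnj (D x))))" by (rule smooth_on_ln[OF S sq pos])
  assume z: "z \<in> S"
  let ?f = "\<lambda>x. dz k D x * inverse (D x)"
  have hf: "hol_on S ?f" by (intro hol_on_mult hol_on_dz hol_on_inverse D nz)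
  have e: "dzbar k (\<lambda>x. complex_of_real (ln (Re (D x * cnj (D x))))) x = cnj (?f x)" if x: "x \<in> S" for x
  proof -
    have "dzbar k (\<lambda>x. complex_of_real (ln (Re (D x * cnj (D x))))) x
      = of_real (inverse (Re (D x * cnj (D x)))) * dzbar k (\<lambda>x. complex_of_real (Re (D x * cnj (D x)))) x"
      by (rule wirtinger_real_chain(2)[OF smooth_on_differentiable[OF sq x] DERIV_ln[OF pos[OF x]]])
    also have "dzbar k (\<lambda>x. complex_of_real (Re (D x * cnj (D x)))) x = D x * cnj (dz k D x)"
      unfolding real dzbar_mult[OF smooth_on_differentiable[OF s x] smooth_on_differentiable[OF sc x]]
        dzbar_cnj[OF smooth_on_differentiable[OF s x]]
      using D x by (simp add: hol_on_def)
    also have "complex_of_real (inverse (Re (D x * cnj (D x)))) = inverse (D x * cnj (D x))"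
      by (simp only: of_real_inverse real)
    finally show ?thesis using nz[OF x] by (simp add: field_simps)
  qed
  have "dz j (dzbar k (\<lambda>x. complex_of_real (ln (Re (D x * cnj (D x)))))) z = dz j (\<lambda>x. cnj (?f x)) z"
    by (rule wirtinger_cong(1)[OF S z e])
       (use smooth_on_differentiable[OF smooth_on_dzbar[OF S smooth_on_of_real[OF S s_ln]] z] in auto)
  also have "\<dots> = cnj (dzbar j ?f z)"
    by (rule dz_cnj) (use hf z in \<open>auto simp: hol_on_def intro: smooth_on_differentiable\<close>)
  also have "\<dots> = 0" using hf z by (simp add: hol_on_def)
  finally show "dz j (dzbar k (\<lambda>x. complex_of_real (ln (Re (D x * cnj (D x)))))) z = 0" .
qed

end

lemma dz_dzbar_uminus:
  fixes u :: "complex^'a \<Rightarrow> real"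
  assumes S: "open S" and u: "smooth_on S u" and z: "z \<in> S"
  shows "dz i (dzbar j (\<lambda>x. complex_of_real (- u x))) z = - dz i (dzbar j (\<lambda>x. complex_of_real (u x))) z"
proof -
  let ?u = "\<lambda>x. complex_of_real (u x)"
  have su: "smooth_on S ?u" by (rule smooth_on_of_real[OF S u])
  have "dzbar j (\<lambda>x. complex_of_real (- u x)) x = - dzbar j ?u x" if "x \<in> S" for x
    using dzbar_minus[OF smooth_on_differentiable[OF su that], of j] by simp
  then have "dz i (dzbar j (\<lambda>x. complex_of_real (- u x))) z = dz i (\<lambda>x. - dzbar j ?u x) z"
    by (intro wirtinger_cong(1)[OF S z] smooth_on_differentiable[OF smooth_on_dzbar[OF S smooth_on_of_real[OF S smooth_on_minus[OF S u]]] z])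
  then show ?thesis
    by (simp add: dz_minus[OF smooth_on_differentiable[OF smooth_on_dzbar[OF S su] z]])
qed

definition jacobian :: "(complex^'a \<Rightarrow> complex^'b) \<Rightarrow> complex^'a \<Rightarrow> complex^'a^'b" where
  "jacobian F x = (\<chi> a j. frechet_derivative F (at x) (axis j 1) $ a)"

lemma holomorphic_map_component:
  fixes F :: "complex^'a \<Rightarrow> complex^'b"
  assumes X: "open X" and F: "holomorphic_map_on X F"
  shows "hol_on X (\<lambda>x. F x $ a)" and "x \<in> X \<Longrightarrow> dz j (\<lambda>x. F x $ a) x = jacobian F x $ a $ j"
proof -
  have s: "smooth_on X F" using F by (simp add: holomorphic_map_on_def)
  have D: "((\<lambda>x. F x $ a) has_derivative (\<lambda>v. frechet_derivative F (at x) v $ a)) (at x)" if "x \<in> X" for x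
    by (rule bounded_linear.has_derivative[OF bounded_linear_vec_nth])
       (use smooth_on_differentiable[OF s that] in \<open>simp add: frechet_derivative_works[symmetric]\<close>)
  have ax: "axis j \<i> = \<i> *s (axis j 1 :: complex^'a)" for j
    by (simp add: vec_eq_iff axis_def)
  have lin: "frechet_derivative F (at x) (axis j \<i>) = \<i> *s frechet_derivative F (at x) (axis j 1)" if "x \<in> X" for x j
    using F that unfolding holomorphic_map_on_def ax by blast
  have "dzbar j (\<lambda>x. F x $ a) x = 0" if "x \<in> X" for x j
    by (simp add: dzbar_eqI[OF D[OF that]] lin[OF that] flip: mult.assoc)
  then show "hol_on X (\<lambda>x. F x $ a)"
    using smooth_on_linear[OF bounded_linear_vec_nth X s] by (simp add: hol_on_def)
  show "dz j (\<lambda>x. F x $ a) x = jacobian F x $ a $ j" if "x \<in> X"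
    by (simp add: dz_eqI[OF D[OF that]] lin[OF that] jacobian_def flip: mult.assoc)
qed

text \<open>The second derivatives of \<open>F\<close> drop out because its first derivatives are holomorphic.\<close>

lemma bordered_hessian_pullback:
  fixes F :: "complex^'N \<Rightarrow> complex^'N" and f :: "complex^'N \<Rightarrow> complex"
  assumes X: "open X" and F: "holomorphic_map_on X F" and Y: "open Y" and f: "smooth_on Y f"
    and FX: "F ` X \<subseteq> Y" and x: "x \<in> X"
  shows "dz j (\<lambda>x. f (F x)) x = (\<Sum>a\<in>UNIV. dz a f (F x) * jacobian F x $ a $ j)"
    and "dzbar j (\<lambda>x. f (F x)) x = (\<Sum>a\<in>UNIV. dzbar a f (F x) * cnj (jacobian F x $ a $ j))"
    and "(\<chi> j k. dz j (dzbar k (\<lambda>x. f (F x))) x)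
       = (\<chi> j a. jacobian F x $ a $ j) ** (\<chi> a b. dz a (dzbar b f) (F x)) ** (\<chi> b k. cnj (jacobian F x $ b $ k))"
    and "bordered_hessian (\<lambda>x. f (F x)) x
       = block (mat 1) 0 0 (\<chi> j a. jacobian F x $ a $ j) ** bordered_hessian f (F x) ** block (mat 1) 0 0 (\<chi> b k. cnj (jacobian F x $ b $ k))"
proof -
  have s: "smooth_on X F" using F by (simp add: holomorphic_map_on_def)
  have DF: "(F has_derivative frechet_derivative F (at x)) (at x)" if "x \<in> X" for x
    using smooth_on_differentiable[OF s that] by (simp add: frechet_derivative_works[symmetric])
  have lin: "frechet_derivative F (at x) (c *s v) = c *s frechet_derivative F (at x) v" if "x \<in> X" for x c v
    using F that by (simp add: holomorphic_map_on_def)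
  have FY: "F x \<in> Y" if "x \<in> X" for x using FX that by auto
  have chain: "dz j (\<lambda>x. h (F x)) x = (\<Sum>a\<in>UNIV. dz a h (F x) * jacobian F x $ a $ j)"
    "dzbar j (\<lambda>x. h (F x)) x = (\<Sum>a\<in>UNIV. dzbar a h (F x) * cnj (jacobian F x $ a $ j))"
    if "x \<in> X" "smooth_on Y h" for h x j
    using wirtinger_holomorphic_chain[OF DF[OF that(1)] lin[OF that(1)] smooth_on_differentiable[OF that(2) FY[OF that(1)]]]
    by (simp_all add: jacobian_def)
  show c1: "dz j (\<lambda>x. f (F x)) x = (\<Sum>a\<in>UNIV. dz a f (F x) * jacobian F x $ a $ j)" for j
    by (rule chain(1)[OF x f])
  show c2: "dzbar j (\<lambda>x. f (F x)) x = (\<Sum>a\<in>UNIV. dzbar a f (F x) * cnj (jacobian F x $ a $ j))" for j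
    by (rule chain(2)[OF x f])
  have sfF: "smooth_on X (\<lambda>x. f (F x))" by (rule smooth_on_compose[OF X Y f s FX])
  have hess: "dz j (dzbar k (\<lambda>x. f (F x))) x
      = (\<Sum>b\<in>UNIV. (\<Sum>a\<in>UNIV. dz a (dzbar b f) (F x) * jacobian F x $ a $ j) * cnj (jacobian F x $ b $ k))" for j k
  proof -
    let ?J = "\<lambda>b. dz k (\<lambda>x. F x $ b)"
    have hJ: "hol_on X (?J b)" for b
      by (rule hol_on_dz[OF X holomorphic_map_component(1)[OF X F]])
    have dJ: "?J b differentiable (at x)" for b
      using hJ[of b] x by (auto simp: hol_on_def intro: smooth_on_differentiable)
    have J: "?J b y = jacobian F y $ b $ k" if "y \<in> X" for b y by (rule holomorphic_map_component(2)[OF X F that])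
    have df: "(\<lambda>x. dzbar b f (F x)) differentiable (at x)" for b
      by (rule smooth_on_differentiable[OF smooth_on_compose[OF X Y smooth_on_dzbar[OF Y f] s FX] x])
    have p: "(\<lambda>x. dzbar b f (F x) * cnj (?J b x)) differentiable (at x)" for b
      by (rule differentiable_mult[OF df differentiable_cnj[OF dJ]])
    have "dz j (dzbar k (\<lambda>x. f (F x))) x = dz j (\<lambda>x. \<Sum>b\<in>UNIV. dzbar b f (F x) * cnj (?J b x)) x"
      by (rule wirtinger_cong(1)[OF X x])
         (simp_all add: chain(2)[OF _ f] J smooth_on_differentiable[OF smooth_on_dzbar[OF X sfF] x])
    also have "\<dots> = (\<Sum>b\<in>UNIV. dz j (\<lambda>x. dzbar b f (F x) * cnj (?J b x)) x)"
      by (rule wirtinger_sum(1)[OF finite p])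
    also have "\<dots> = (\<Sum>b\<in>UNIV. (\<Sum>a\<in>UNIV. dz a (dzbar b f) (F x) * jacobian F x $ a $ j) * cnj (jacobian F x $ b $ k))"
      by (rule sum.cong[OF refl])
         (use hJ x in \<open>simp add: dz_mult[OF df differentiable_cnj[OF dJ]] dz_cnj[OF dJ] hol_on_def chain(1)[OF x smooth_on_dzbar[OF Y f]] J\<close>)
    finally show ?thesis .
  qed
  show H: "(\<chi> j k. dz j (dzbar k (\<lambda>x. f (F x))) x)
       = (\<chi> j a. jacobian F x $ a $ j) ** (\<chi> a b. dz a (dzbar b f) (F x)) ** (\<chi> b k. cnj (jacobian F x $ b $ k))"
    by (simp add: vec_eq_iff matrix_matrix_mult_def hess mult.commute)
  have H': "dz j (dzbar k (\<lambda>x. f (F x))) x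
     = ((\<chi> j a. jacobian F x $ a $ j) ** (\<chi> a b. dz a (dzbar b f) (F x)) ** (\<chi> b k. cnj (jacobian F x $ b $ k))) $ j $ k" for j k
    by (simp flip: H)
  show "bordered_hessian (\<lambda>x. f (F x)) x
       = block (mat 1) 0 0 (\<chi> j a. jacobian F x $ a $ j) ** bordered_hessian f (F x) ** block (mat 1) 0 0 (\<chi> b k. cnj (jacobian F x $ b $ k))"
    unfolding bordered_hessian_def bordered_def block_mult H'
    by (simp, rule block_eqI) (simp_all add: c1 c2, simp_all add: matrix_matrix_mult_def mult.commute)
qed

text \<open>Pulling back multiplies the bordered determinant by \<open>\<bar>det F'\<bar>\<^sup>2\<close>. The weight \<open>\<bar>det F'\<bar> powr (- 2 / (N + 1))\<close>
  compensates this factor, and as its logarithm is pluriharmonic it does not change the bordered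
  matrix otherwise.\<close>

lemma defining_function_pullback:
  fixes F :: "complex^'N \<Rightarrow> complex^'N" and \<rho> :: "complex^'N \<Rightarrow> real"
  assumes X: "open X" and F: "holomorphic_map_on X F" and nz: "\<And>x. x \<in> X \<Longrightarrow> det (jacobian F x) \<noteq> 0"
    and V: "open V" and \<rho>: "pseudoconvex_defining_function V \<Sigma> \<rho>" and J: "\<And>y. y \<in> V \<Longrightarrow> fefferman_J \<rho> y = 1"
    and x0: "x0 \<in> X" "F x0 \<in> V"
  shows "\<exists>V' \<rho>'. open V' \<and> x0 \<in> V' \<and> V' \<subseteq> X \<and> F ` V' \<subseteq> V \<and>
    pseudoconvex_defining_function V' {x. F x \<in> \<Sigma>} \<rho>' \<and> (\<forall>x\<in>V'. fefferman_J \<rho>' x = 1)"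
proof -
  define V' where "V' = X \<inter> F -` V"
  have sF: "smooth_on X F" using F by (simp add: holomorphic_map_on_def)
  have V': "open V'"
    unfolding V'_def by (rule continuous_open_preimage[OF smooth_on_continuous[OF sF] X V])
  have V'X: "V' \<subseteq> X" and FV': "F ` V' \<subseteq> V" by (auto simp: V'_def)
  have F': "holomorphic_map_on V' F"
    using F V'X smooth_on_subset[OF sF V'X] by (auto simp: holomorphic_map_on_def)
  have s\<rho>: "smooth_on V \<rho>" using \<rho> by (simp add: pseudoconvex_defining_function_def)
  define N1 where "N1 = real (CARD('N) + 1)"
  have N1: "N1 > 0" by (simp add: N1_def)
  define D where "D x = det (jacobian F x)" for x
  have hD: "hol_on V' (\<lambda>x. det (\<chi> a j. dz j (\<lambda>x. F x $ a) x))"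
    by (intro hol_on_det[OF V']) (simp add: hol_on_dz[OF V' holomorphic_map_component(1)[OF V' F']])
  have Deq: "det (\<chi> a j. dz j (\<lambda>x. F x $ a) x) = D x" if "x \<in> V'" for x
    using holomorphic_map_component(2)[OF V' F' that] by (simp add: D_def vec_lambda_eta)
  define D' where "D' x = det (\<chi> a j. dz j (\<lambda>x. F x $ a) x)" for x
  have hD': "hol_on V' D'" using hD by (simp add: D'_def[abs_def])
  have D'nz: "D' x \<noteq> 0" if "x \<in> V'" for x using that nz V'X Deq by (auto simp: D'_def D_def)
  define \<psi> where "\<psi> x = ln (Re (D' x * cnj (D' x))) * (1 / N1)" for x
  note logD = hessian_log_hol[OF V' hD' D'nz]
  have s\<psi>: "smooth_on V' \<psi>" unfolding \<psi>_def by (intro smooth_on_mult V' logD(1) smooth_on_const)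
  have hess\<psi>: "dz j (dzbar k (\<lambda>x. complex_of_real (\<psi> x))) x = 0" if x: "x \<in> V'" for j k x
  proof -
    let ?l = "\<lambda>x. complex_of_real (ln (Re (D' x * cnj (D' x))))" and ?c = "complex_of_real (1 / N1)"
    have sl: "smooth_on V' ?l" by (rule smooth_on_of_real[OF V' logD(1)])
    have c: "(\<lambda>x. ?c) differentiable (at x)" for x :: "complex^'N" by simp
    have e: "(\<lambda>x. complex_of_real (\<psi> x)) = (\<lambda>x. ?l x * ?c)" by (simp add: \<psi>_def fun_eq_iff)
    have "dzbar k (\<lambda>x. complex_of_real (\<psi> x)) y = dzbar k ?l y * ?c" if "y \<in> V'" for y
      unfolding e dzbar_mult[OF smooth_on_differentiable[OF sl that] c] by simp
    then have "dz j (dzbar k (\<lambda>x. complex_of_real (\<psi> x))) x = dz j (\<lambda>y. dzbar k ?l y * ?c) x"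
      by (intro wirtinger_cong(1)[OF V' x] smooth_on_differentiable[OF smooth_on_dzbar[OF V' smooth_on_of_real[OF V' s\<psi>]] x])
    also have "\<dots> = dz j (dzbar k ?l) x * ?c"
      unfolding dz_mult[OF smooth_on_differentiable[OF smooth_on_dzbar[OF V' sl] x] c] by simp
    finally show ?thesis using logD(2)[OF _ x, of j k] by simp
  qed
  define r where "r x = \<rho> (F x)" for x
  have sr: "smooth_on V' r"
    unfolding r_def by (rule smooth_on_compose[OF V' V s\<rho> smooth_on_subset[OF sF V'X] FV'])
  define \<rho>' where "\<rho>' x = r x * exp (- \<psi> x)" for x
  have id1: "((\<lambda>t. t) has_real_derivative (\<lambda>t. 1) (r x)) (at (r x))" for x by simp
  have id2: "((\<lambda>t. 1) has_real_derivative (\<lambda>t. 0) (r x)) (at (r x))" for x by simp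
  note warp = V' sr s\<psi> id1 id2
  let ?R = "\<lambda>x. complex_of_real (r x)" and ?X = "\<lambda>x. complex_of_real (\<psi> x)"
  let ?m = "\<lambda>x. complex_of_real (exp (- \<psi> x))" and ?f = "\<lambda>y. complex_of_real (\<rho> y)"
  let ?L = "\<lambda>x. (\<chi> j a. jacobian F x $ a $ j) :: complex^'N^'N" and ?L' = "\<lambda>x. (\<chi> b k. cnj (jacobian F x $ b $ k)) :: complex^'N^'N"
  have sf: "smooth_on V ?f" by (rule smooth_on_of_real[OF V s\<rho>])
  note pull = bordered_hessian_pullback[OF V' F' V sf FV', folded r_def]
  have "fefferman_J \<rho>' x = 1" if x: "x \<in> V'" for x
  proof -
    have "fefferman_J \<rho>' x = (- 1) ^ CARD('N) * ?m x ^ Suc CARD('N) * det (bordered_hessian ?R x)"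
      unfolding \<rho>'_def using fefferman_J_warped[OF warp x] by (simp add: hess\<psi>[OF x] bordered_hessian_def)
    also have "det (bordered_hessian ?R x) = det (?L x) * det (?L' x) * det (bordered_hessian ?f (F x))"
      unfolding pull(4)[OF x] by (simp add: det_mul det_block_lower)
    also have "det (?L x) = D x"
      using det_transpose[of "jacobian F x"] by (simp add: D_def Finite_Cartesian_Product.transpose_def)
    also have "det (?L' x) = cnj (D x)"
      by (simp add: D_def det_def cnj_sum cnj_prod)
    also have "?m x ^ Suc CARD('N) = inverse (D x * cnj (D x))"
    proof -
      have DD: "D' x = D x" using Deq[OF x] by (simp add: D'_def)
      have eqr: "complex_of_real (Re (D x * cnj (D x))) = D x * cnj (D x)"
        by (simp add: complex_eq_iff)
      have pos: "Re (D x * cnj (D x)) > 0"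
        using D'nz[OF x] by (simp add: DD complex_neq_0 flip: power2_eq_square)
      have "?m x ^ Suc CARD('N) = complex_of_real (exp (N1 * (- \<psi> x)))"
        unfolding N1_def exp_of_nat_mult by simp
      also have "N1 * (- \<psi> x) = - ln (Re (D x * cnj (D x)))" using N1 by (simp add: \<psi>_def DD)
      also have "exp (- ln (Re (D x * cnj (D x)))) = inverse (Re (D x * cnj (D x)))"
        using pos by (simp only: exp_minus exp_ln)
      also have "complex_of_real (inverse (Re (D x * cnj (D x)))) = inverse (D x * cnj (D x))"
        by (simp only: of_real_inverse eqr)
      finally show ?thesis .
    qed
    finally have "fefferman_J \<rho>' x = inverse (D x * cnj (D x)) * (D x * cnj (D x)) * fefferman_J \<rho> (F x)"
      by (simp add: fefferman_J_bordered)
    moreover have "D x * cnj (D x) \<noteq> 0" using D'nz[OF x] Deq[OF x] by (simp add: D'_def)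
    moreover have "F x \<in> V" using x by (simp add: V'_def)
    ultimately show ?thesis using J by (simp add: field_simps)
  qed
  moreover have "pseudoconvex_defining_function V' {x. F x \<in> \<Sigma>} \<rho>'"
    unfolding pseudoconvex_defining_function_def
  proof (intro conjI ballI allI impI)
    have zero: "\<rho> y = 0 \<longleftrightarrow> y \<in> \<Sigma>" if "y \<in> V" for y
      using \<rho> that unfolding pseudoconvex_defining_function_def by blast
    show "smooth_on V' \<rho>'"
      unfolding \<rho>'_def by (intro smooth_on_mult V' sr smooth_on_exp smooth_on_minus s\<psi>)
    then have d\<rho>': "\<rho>' differentiable (at x)" if "x \<in> V'" for x using that by (rule smooth_on_differentiable)
    show "{x \<in> V'. \<rho>' x = 0} = {x. F x \<in> \<Sigma>} \<inter> V'"
      using zero FV' by (auto simp: \<rho>'_def r_def)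
    fix x assume "x \<in> {x. F x \<in> \<Sigma>} \<inter> V'"
    then have x: "x \<in> V'" and Fx: "F x \<in> V" "F x \<in> \<Sigma>" by (auto simp: V'_def)
    have rx: "r x = 0" using zero[OF Fx(1)] Fx by (simp add: r_def)
    have Dx: "det (jacobian F x) \<noteq> 0" using nz V'X x by auto
    have fr: "frechet_derivative \<rho> (at (F x)) \<noteq> (\<lambda>v. 0)"
      and levi: "\<And>w. w \<noteq> 0 \<Longrightarrow> (\<Sum>i\<in>UNIV. dz i ?f (F x) * w $ i) = 0 \<Longrightarrow>
           Re (sesq (\<chi> i j. dz i (dzbar j (\<lambda>y. complex_of_real (- \<rho> y))) (F x)) w) > 0"
      using \<rho> Fx unfolding pseudoconvex_defining_function_def by blast+
    have dR: "dz j ?R x = (\<Sum>a\<in>UNIV. dz a ?f (F x) * jacobian F x $ a $ j)" for j by (rule pull(1)[OF x])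
    show "frechet_derivative \<rho>' (at x) \<noteq> (\<lambda>v. 0)"
    proof
      assume "frechet_derivative \<rho>' (at x) = (\<lambda>v. 0)"
      then have "dz j (\<lambda>x. complex_of_real (\<rho>' x)) x = 0" for j
        using dz_of_real_frechet[OF d\<rho>'[OF x]] by blast
      then have "dz j ?R x = 0" for j
        using warped_first_derivatives(1)[OF warp x, of j] rx by (simp add: \<rho>'_def)
      then have "(\<chi> a. dz a ?f (F x)) v* jacobian F x = 0"
        unfolding dR by (simp add: vec_eq_iff vector_matrix_mult_def mult.commute)
      then have "((\<chi> a. dz a ?f (F x)) v* jacobian F x) v* matrix_inv (jacobian F x) = 0" by simp
      then have "(\<chi> a. dz a ?f (F x)) = 0"
        by (simp add: vector_matrix_mul_assoc matrix_inv_works[OF Dx])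
      then have "dz a ?f (F x) = 0" for a by (simp add: vec_eq_iff)
      then show False using dz_of_real_frechet[OF smooth_on_differentiable[OF s\<rho> Fx(1)]] fr by blast
    qed
    fix w :: "complex^'N"
    assume w: "w \<noteq> 0 \<and> (\<Sum>i\<in>UNIV. dz i (\<lambda>x. complex_of_real (\<rho>' x)) x * w $ i) = 0"
    let ?w = "jacobian F x *v w"
    have wL: "w v* ?L x = ?w"
      by (simp add: vec_eq_iff vector_matrix_mult_def matrix_vector_mult_def mult.commute)
    have w0: "(\<Sum>i\<in>UNIV. dz i ?R x * w $ i) = 0"
      by (rule levi_form_warped(1)[OF warp x]) (use w rx in \<open>auto simp: \<rho>'_def\<close>)
    have "(\<Sum>a\<in>UNIV. dz a ?f (F x) * ?w $ a) = (\<Sum>a\<in>UNIV. \<Sum>i\<in>UNIV. dz a ?f (F x) * jacobian F x $ a $ i * w $ i)"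
      by (simp add: matrix_vector_mult_def sum_distrib_left mult.assoc)
    also have "\<dots> = (\<Sum>i\<in>UNIV. \<Sum>a\<in>UNIV. dz a ?f (F x) * jacobian F x $ a $ i * w $ i)" by (rule sum.swap)
    also have "\<dots> = 0" using w0 by (simp add: dR sum_distrib_right)
    finally have "(\<Sum>a\<in>UNIV. dz a ?f (F x) * ?w $ a) = 0" .
    moreover have "?w \<noteq> 0"
    proof
      assume "?w = 0"
      then have "matrix_inv (jacobian F x) *v ?w = 0" by simp
      then have "w = 0" by (simp add: matrix_vector_mul_assoc matrix_inv_works[OF Dx])
      with w show False by simp
    qed
    ultimately have "Re (sesq (\<chi> i j. dz i (dzbar j (\<lambda>y. complex_of_real (- \<rho> y))) (F x)) ?w) > 0" by (rule levi[rotated])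
    also have "sesq (\<chi> i j. dz i (dzbar j (\<lambda>y. complex_of_real (- \<rho> y))) (F x)) ?w
      = - sesq (\<chi> i j. dz i (dzbar j ?f) (F x)) ?w"
      unfolding dz_dzbar_uminus[OF V s\<rho> Fx(1)] by (simp add: sesq_def sum_negf)
    also have "sesq (\<chi> i j. dz i (dzbar j ?f) (F x)) ?w = sesq (\<chi> i j. dz i (dzbar j ?R) x) w"
      unfolding pull(3)[OF x] wL[symmetric] by (rule sesq_congruence[symmetric]) simp
    finally have neg: "Re (sesq (\<chi> i j. dz i (dzbar j ?R) x) w) < 0" by simp
    have "sesq (\<chi> i j. dz i (dzbar j (\<lambda>x. complex_of_real (- \<rho>' x))) x) w
       = - (?m x * complex_of_real 1) * sesq (\<chi> i j. dz i (dzbar j ?R) x) w"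
      unfolding \<rho>'_def by (rule levi_form_warped(2)[OF warp x]) (use w rx in \<open>auto simp: \<rho>'_def\<close>)
    also have "\<dots> = complex_of_real (- exp (- \<psi> x)) * sesq (\<chi> i j. dz i (dzbar j ?R) x) w" by simp
    finally show "Re (sesq (\<chi> i j. dz i (dzbar j (\<lambda>x. complex_of_real (- \<rho>' x))) x) w) > 0"
      using neg by (simp add: mult_pos_neg)
  qed
  moreover have "x0 \<in> V'" using x0 by (simp add: V'_def)
  ultimately show ?thesis using V' V'X FV' by blast
qed

section \<open>Sphere bundles of Hermitian vector bundles\<close>

lemma jacobian_mult:
  fixes F :: "complex^'a \<Rightarrow> complex^'b"
  assumes X: "open X" and F: "holomorphic_map_on X F" and x: "x \<in> X"
  shows "frechet_derivative F (at x) v = jacobian F x *v v"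
proof -
  have s: "smooth_on X F" using F by (simp add: holomorphic_map_on_def)
  have "frechet_derivative F (at x) v $ a = (jacobian F x *v v) $ a" for a
  proof -
    have d: "(\<lambda>x. F x $ a) differentiable (at x)"
      by (rule smooth_on_differentiable[OF smooth_on_linear[OF bounded_linear_vec_nth X s] x])
    have "frechet_derivative F (at x) v $ a = frechet_derivative (\<lambda>x. F x $ a) (at x) v"
      by (rule frechet_linear_comp[OF bounded_linear_vec_nth smooth_on_differentiable[OF s x], symmetric])
    also have "\<dots> = (\<Sum>j\<in>UNIV. jacobian F x $ a $ j * v $ j)"
      using holomorphic_map_component(1)[OF X F, of a] holomorphic_map_component(2)[OF X F x] x by (simp add: frechet_wirtinger[OF d] hol_on_def)
    finally show ?thesis by (simp add: matrix_vector_mult_def)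
  qed
  then show ?thesis by (simp add: vec_eq_iff)
qed

text \<open>A kernel vector of the Jacobian would be annihilated by the differential of \<open>F' \<circ> F\<close>, the identity.\<close>

lemma jacobian_biholomorphic_nonzero:
  fixes F F' :: "complex^'a \<Rightarrow> complex^'a"
  assumes X: "open X" and F: "holomorphic_map_on X F" and Y: "open Y" and F': "holomorphic_map_on Y F'"
    and FX: "F ` X \<subseteq> Y" and inv: "\<And>x. x \<in> X \<Longrightarrow> F' (F x) = x" and x: "x \<in> X"
  shows "det (jacobian F x) \<noteq> 0"
proof
  assume "det (jacobian F x) = 0"
  then have "\<not> (\<exists>B. B ** jacobian F x = mat 1)"
    using invertible_det_nz[of "jacobian F x"] by (simp add: invertible_left_inverse)
  then obtain w where w: "jacobian F x *v w = 0" "w \<noteq> 0" by (auto simp: matrix_left_invertible_ker)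
  have D: "(F has_derivative frechet_derivative F (at x)) (at x)"
    using F x by (auto simp: holomorphic_map_on_def frechet_derivative_works[symmetric] intro: smooth_on_differentiable)
  have D': "(F' has_derivative frechet_derivative F' (at (F x))) (at (F x))"
    using F' FX x by (auto simp: holomorphic_map_on_def frechet_derivative_works[symmetric] intro: smooth_on_differentiable)
  have "((\<lambda>x. F' (F x)) has_derivative (\<lambda>v. frechet_derivative F' (at (F x)) (frechet_derivative F (at x) v))) (at x)"
    using has_derivative_compose[of F "frechet_derivative F (at x)" x UNIV F'] D D' by simp
  then have "((\<lambda>x. x) has_derivative (\<lambda>v. frechet_derivative F' (at (F x)) (frechet_derivative F (at x) v))) (at x)"
    by (rule has_derivative_transform_within_open[OF _ X x inv])
  then have "(\<lambda>v. frechet_derivative F' (at (F x)) (frechet_derivative F (at x) v)) = (\<lambda>v. v)"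
    by (rule has_derivative_unique) (rule has_derivative_ident)
  then have "w = frechet_derivative F' (at (F x)) (frechet_derivative F (at x) w)" by (metis (no_types))
  also have "\<dots> = 0"
    unfolding jacobian_mult[OF X F x] w(1) using linear_0[OF has_derivative_linear[OF D']] by simp
  finally show False using w(2) by simp
qed

lemma open_chart_image:
  assumes c: "holomorphic_chart A c" and W: "open W"
  shows "open (snd c ` (fst c \<inter> W))"
proof -
  have hom: "homeomorphism (fst c) (snd c ` fst c) (snd c) (chart_inv c)"
    and op: "open (snd c ` fst c)" using c by (auto simp: holomorphic_chart_def)
  have "openin (top_of_set (snd c ` fst c)) (snd c ` (fst c \<inter> W))"
    by (rule homeomorphism_imp_open_map[OF hom openin_open_Int[OF W]])
  then show ?thesis using op openin_open_eq by blast
qed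

lemma chart_inv_left:
  assumes "holomorphic_chart A c" "e \<in> fst c"
  shows "chart_inv c (snd c e) = e"
  using assms by (auto simp: holomorphic_chart_def homeomorphism_def)

lemma chart_image_iff:
  assumes c: "holomorphic_chart A c" and e: "e \<in> fst c"
  shows "snd c e \<in> snd c ` (\<Sigma> \<inter> fst c) \<longleftrightarrow> e \<in> \<Sigma>"
proof
  assume "snd c e \<in> snd c ` (\<Sigma> \<inter> fst c)"
  then obtain f where f: "f \<in> \<Sigma>" "f \<in> fst c" "snd c e = snd c f" by blast
  have "e = chart_inv c (snd c e)" by (rule chart_inv_left[OF c e, symmetric])
  also have "\<dots> = f" unfolding f(3) by (rule chart_inv_left[OF c f(2)])
  finally have "e = f" .
  with f show "e \<in> \<Sigma>" by simp
qed (use e in blast)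

lemma chart_transition_pullback:
  fixes c d :: "('x::topological_space, 'N::finite) chart" and \<rho> :: "complex^'N \<Rightarrow> real"
  assumes c: "holomorphic_chart A c" and d: "holomorphic_chart A d" and cA: "c \<in> A"
    and p: "p \<in> fst c" "p \<in> fst d"
    and V: "open V" "snd d p \<in> V" "V \<subseteq> snd d ` fst d"
    and \<rho>: "pseudoconvex_defining_function V (snd d ` (\<Sigma> \<inter> fst d)) \<rho>"
    and J: "\<And>y. y \<in> V \<Longrightarrow> fefferman_J \<rho> y = 1"
  shows "\<exists>V' \<rho>'. open V' \<and> snd c p \<in> V' \<and> V' \<subseteq> snd c ` fst c \<and>
     pseudoconvex_defining_function V' (snd c ` (\<Sigma> \<inter> fst c)) \<rho>' \<and> (\<forall>x\<in>V'. fefferman_J \<rho>' x = 1)"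
proof -
  let ?F = "snd d \<circ> chart_inv c" and ?F' = "snd c \<circ> chart_inv d"
  let ?X = "snd c ` (fst c \<inter> fst d)" and ?Y = "snd d ` (fst d \<inter> fst c)"
  have comp: "compatible_charts d c" using d cA by (simp add: holomorphic_chart_def)
  have F: "holomorphic_map_on ?X ?F" and F': "holomorphic_map_on ?Y ?F'"
    using comp by (simp_all add: compatible_charts_def Int_commute)
  have X: "open ?X" and Y: "open ?Y"
    using open_chart_image[OF c] open_chart_image[OF d] c d by (simp_all add: holomorphic_chart_def)
  have Fc: "?F (snd c e) = snd d e" if "e \<in> fst c" for e
    by (simp add: chart_inv_left[OF c that])
  have nz: "det (jacobian ?F x) \<noteq> 0" if x: "x \<in> ?X" for x
  proof (rule jacobian_biholomorphic_nonzero[OF X F Y F' _ _ x])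
    show "?F ` ?X \<subseteq> ?Y"
    proof (rule image_subsetI)
      fix x assume "x \<in> ?X"
      then obtain e where "e \<in> fst c" "e \<in> fst d" "x = snd c e" by blast
      then show "?F x \<in> ?Y" by (simp only: Fc) blast
    qed
    show "?F' (?F x) = x" if "x \<in> ?X" for x
      using that chart_inv_left[OF c] chart_inv_left[OF d] by auto
  qed
  have "snd c p \<in> ?X" "?F (snd c p) \<in> V" using p V Fc by auto
  from defining_function_pullback[OF X F nz V(1) \<rho> J this]
  obtain V' \<rho>' where V': "open V'" "snd c p \<in> V'" "V' \<subseteq> ?X" "?F ` V' \<subseteq> V"
    and pc: "pseudoconvex_defining_function V' {x. ?F x \<in> snd d ` (\<Sigma> \<inter> fst d)} \<rho>'"
    and J': "\<forall>x\<in>V'. fefferman_J \<rho>' x = 1" by blast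
  have "x \<in> snd c ` (\<Sigma> \<inter> fst c) \<longleftrightarrow> ?F x \<in> snd d ` (\<Sigma> \<inter> fst d)" if xV: "x \<in> V'" for x
  proof -
    obtain e where e: "e \<in> fst c" "e \<in> fst d" "x = snd c e" using xV V'(3) by blast
    show ?thesis
      unfolding e(3) Fc[OF e(1)] chart_image_iff[OF c e(1)] chart_image_iff[OF d e(2)] by (rule refl)
  qed
  then have "snd c ` (\<Sigma> \<inter> fst c) \<inter> V' = {x. ?F x \<in> snd d ` (\<Sigma> \<inter> fst d)} \<inter> V'"
    by (intro set_eqI) (simp only: Int_iff mem_Collect_eq, metis)
  then have "pseudoconvex_defining_function V' (snd c ` (\<Sigma> \<inter> fst c)) \<rho>'"
    using pc by (simp add: pseudoconvex_defining_function_def)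
  moreover have "V' \<subseteq> snd c ` fst c" using V'(3) by auto
  ultimately show ?thesis using V'(1,2) J' by (intro exI[of _ V'] exI[of _ \<rho>'] conjI)
qed

lemma linear_form_expansion:
  fixes L :: "complex^'k \<Rightarrow> complex"
  assumes add: "\<And>x y. L (x + y) = L x + L y" and scale: "\<And>c x. L (c *s x) = c * L x"
  shows "L \<xi> = (\<Sum>\<alpha>\<in>UNIV. \<xi> $ \<alpha> * L (axis \<alpha> 1))"
proof -
  have 0: "L 0 = 0" using scale[of 0 0] by simp
  have "L (\<Sum>\<alpha>\<in>A. \<xi> $ \<alpha> *s axis \<alpha> 1) = (\<Sum>\<alpha>\<in>A. \<xi> $ \<alpha> * L (axis \<alpha> 1))" if "finite A" for A
    using that by (induction A rule: finite_induct) (simp_all add: 0 add scale)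
  from this[of UNIV] show ?thesis by (simp add: basis_expansion)
qed

context
  fixes E :: "('m::{t2_space,second_countable_topology},
               'e::{t2_space,second_countable_topology}, 'n::finite, 'k::finite) vbundle"
    and h :: "'e \<Rightarrow> 'e \<Rightarrow> complex"
  assumes E: "holomorphic_vector_bundle E" and h: "hermitian_metric E h"
begin

lemma metric_hermitian: "proj E f = proj E e \<Longrightarrow> h f e = cnj (h e f)"
  using h unfolding hermitian_metric_def by blast

lemma metric_positive: "e \<noteq> vscale E 0 e \<Longrightarrow> Re (h e e) > 0"
  using h unfolding hermitian_metric_def by blast

lemma trivialization_point:
  assumes "local_trivialization E U \<phi>" "q \<in> U"
  shows "\<exists>!e. proj E e = q \<and> \<phi> e = \<xi>"
proof -
  have bij: "bij_betw (\<lambda>e. (proj E e, \<phi> e)) (proj E -` U) (U \<times> UNIV)"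
    using assms by (simp add: local_trivialization_def)
  have "(q, \<xi>) \<in> (\<lambda>e. (proj E e, \<phi> e)) ` (proj E -` U)"
    using bij assms(2) by (simp add: bij_betw_def)
  then obtain e where "proj E e = q" "\<phi> e = \<xi>" by auto
  moreover have "e = f" if "proj E e = q" "\<phi> e = \<xi>" "proj E f = q" "\<phi> f = \<xi>" for e f
    using bij_betw_imp_inj_on[OF bij] that assms(2) by (auto dest!: inj_onD)
  ultimately show ?thesis by blast
qed

lemma frame_point:
  assumes "local_trivialization E U \<phi>" "q \<in> U"
  shows "proj E (frame E \<phi> \<alpha> q) = q" "\<phi> (frame E \<phi> \<alpha> q) = axis \<alpha> 1"
  using theI'[OF trivialization_point[OF assms, of "axis \<alpha> 1"]] by (simp_all add: frame_def)

text \<open>The fibre operations correspond under \<open>\<phi>\<close> to those of \<open>\<complex>\<^sup>k\<close>, so that \<open>e \<mapsto> h e g\<close> becomes a linear form on \<open>\<complex>\<^sup>k\<close>.\<close>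

lemma metric_in_frame:
  assumes t: "local_trivialization E U \<phi>" and q: "q \<in> U" and e: "proj E e = q" and f: "proj E f = q"
  shows "h e f = (\<Sum>\<alpha>\<in>UNIV. \<Sum>\<beta>\<in>UNIV. h (frame E \<phi> \<alpha> q) (frame E \<phi> \<beta> q) * \<phi> e $ \<alpha> * cnj (\<phi> f $ \<beta>))"
proof -
  have pa: "proj E (vadd E e f) = proj E e" if "proj E f = proj E e" for e f
    using E that by (simp add: holomorphic_vector_bundle_def)
  have ps: "proj E (vscale E c e) = proj E e" for c e
    using E by (simp add: holomorphic_vector_bundle_def)
  have \<phi>a: "\<phi> (vadd E e f) = \<phi> e + \<phi> f" if "proj E e \<in> U" "proj E f = proj E e" for e f
    using t that by (simp add: local_trivialization_def)
  have \<phi>s: "\<phi> (vscale E c e) = c *s \<phi> e" if "proj E e \<in> U" for c e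
    using t that by (simp add: local_trivialization_def)
  have ha: "h (vadd E e f) g = h e g + h f g" if "proj E f = proj E e" "proj E g = proj E e" for e f g
    using h that unfolding hermitian_metric_def by blast
  have hs: "h (vscale E c e) f = c * h e f" if "proj E f = proj E e" for c e f
    using h that unfolding hermitian_metric_def by blast
  define T where "T \<xi> = (THE e. proj E e = q \<and> \<phi> e = \<xi>)" for \<xi>
  have T: "proj E (T \<xi>) = q" "\<phi> (T \<xi>) = \<xi>" for \<xi>
    using theI'[OF trivialization_point[OF t q, of \<xi>]] by (simp_all add: T_def)
  have Teq: "T (\<phi> e) = e" if "proj E e = q" for e
    using trivialization_point[OF t q, of "\<phi> e"] T[of "\<phi> e"] that by blast
  have Tf: "T (axis \<alpha> 1) = frame E \<phi> \<alpha> q" for \<alpha> by (simp add: T_def frame_def)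
  have lin: "h e g = (\<Sum>\<alpha>\<in>UNIV. \<phi> e $ \<alpha> * h (frame E \<phi> \<alpha> q) g)" if e: "proj E e = q" and g: "proj E g = q" for e g
  proof -
    have "h (T (x + y)) g = h (T x) g + h (T y) g" for x y
    proof -
      have "T (x + y) = vadd E (T x) (T y)"
        using Teq[of "vadd E (T x) (T y)"] by (simp add: pa T \<phi>a q)
      then show ?thesis by (simp add: ha T g)
    qed
    moreover have "h (T (c *s x)) g = c * h (T x) g" for c x
    proof -
      have "T (c *s x) = vscale E c (T x)"
        using Teq[of "vscale E c (T x)"] by (simp add: ps T \<phi>s q)
      then show ?thesis by (simp add: hs T g)
    qed
    ultimately have "h (T \<xi>) g = (\<Sum>\<alpha>\<in>UNIV. \<xi> $ \<alpha> * h (T (axis \<alpha> 1)) g)" for \<xi>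
      by (rule linear_form_expansion)
    from this[of "\<phi> e"] show ?thesis by (simp add: Teq[OF e] Tf)
  qed
  have fr: "proj E (frame E \<phi> \<alpha> q) = q" for \<alpha> by (rule frame_point(1)[OF t q])
  have "h (frame E \<phi> \<alpha> q) f = (\<Sum>\<beta>\<in>UNIV. h (frame E \<phi> \<alpha> q) (frame E \<phi> \<beta> q) * cnj (\<phi> f $ \<beta>))" for \<alpha>
  proof -
    have "h (frame E \<phi> \<alpha> q) f = cnj (h f (frame E \<phi> \<alpha> q))"
      by (rule metric_hermitian) (simp only: fr f)
    also have "\<dots> = (\<Sum>\<beta>\<in>UNIV. cnj (\<phi> f $ \<beta>) * cnj (h (frame E \<phi> \<beta> q) (frame E \<phi> \<alpha> q)))"
      by (simp add: lin[OF f fr] cnj_sum)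
    also have "\<dots> = (\<Sum>\<beta>\<in>UNIV. h (frame E \<phi> \<alpha> q) (frame E \<phi> \<beta> q) * cnj (\<phi> f $ \<beta>))"
    proof (rule sum.cong[OF refl])
      fix \<beta>
      have "h (frame E \<phi> \<alpha> q) (frame E \<phi> \<beta> q) = cnj (h (frame E \<phi> \<beta> q) (frame E \<phi> \<alpha> q))"
        by (rule metric_hermitian) (simp only: fr)
      then show "cnj (\<phi> f $ \<beta>) * cnj (h (frame E \<phi> \<beta> q) (frame E \<phi> \<alpha> q))
          = h (frame E \<phi> \<alpha> q) (frame E \<phi> \<beta> q) * cnj (\<phi> f $ \<beta>)" by (simp only: mult.commute)
    qed
    finally show ?thesis .
  qed
  then show ?thesis unfolding lin[OF e f] by (simp add: sum_distrib_left mult_ac)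
qed

lemma metric_matrix_positive:
  assumes t: "local_trivialization E U \<phi>" and b: "holomorphic_chart A b" and q: "q \<in> U" "q \<in> fst b"
  shows "proj E e = q \<Longrightarrow> h e e = sesq (metric_matrix E h b \<phi> (snd b q)) (\<phi> e)"
    and "pos_def (metric_matrix E h b \<phi> (snd b q))"
proof -
  let ?H = "metric_matrix E h b \<phi> (snd b q)"
  have ci: "chart_inv b (snd b q) = q" by (rule chart_inv_left[OF b q(2)])
  have Hn: "?H $ \<alpha> $ \<beta> = h (frame E \<phi> \<alpha> q) (frame E \<phi> \<beta> q)" for \<alpha> \<beta>
    by (simp add: metric_matrix_def ci)
  show he: "h e e = sesq ?H (\<phi> e)" if "proj E e = q" for e
    unfolding sesq_def Hn by (rule metric_in_frame[OF t q(1) that that])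
  show "pos_def ?H"
    unfolding pos_def_def hermitian_matrix_def
  proof (intro conjI allI impI)
    show "?H $ \<alpha> $ \<beta> = cnj (?H $ \<beta> $ \<alpha>)" for \<alpha> \<beta>
      unfolding Hn by (rule metric_hermitian) (simp only: frame_point(1)[OF t q(1)])
    fix \<xi> :: "complex^'k" assume \<xi>: "\<xi> \<noteq> 0"
    obtain e where e: "proj E e = q" "\<phi> e = \<xi>" using trivialization_point[OF t q(1), of \<xi>] by blast
    have "\<phi> (vscale E 0 e) = 0" using t e q by (simp add: local_trivialization_def)
    then have "e \<noteq> vscale E 0 e" using e \<xi> by auto
    then have "Re (h e e) > 0" by (rule metric_positive)
    then show "Re (sesq ?H \<xi>) > 0" using he[OF e(1)] e(2) by simp
  qed
qed

text \<open>Polarization in the tangent vector and then in the fibre vector turns the splitting into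
  \<open>\<Theta> = h \<otimes> K\<close>. The trace over the fibre is \<open>Ric(E, h) = k K\<close>, so that \<open>g = - k K\<close>. Griffiths negativity, applied to
  a single nonzero vector of the fibre, makes \<open>K\<close> negative.\<close>

lemma split_curvature_metric:
  assumes neg: "griffiths_negative E h" and split: "curvature_splits E h"
    and t: "local_trivialization E U \<phi>" and b: "b \<in> base_atlas E" and q: "q \<in> U" "q \<in> fst b"
  shows "chern_curvature (metric_matrix E h b \<phi>) (snd b q) \<alpha> \<beta> i j
      = - (metric_matrix E h b \<phi> (snd b q) $ \<alpha> $ \<beta> * induced_metric E h b q $ i $ j / of_nat CARD('k))"
    and "pos_def (induced_metric E h b q)"
proof -
  have bc: "holomorphic_chart (base_atlas E) b"
    using E b by (simp add: holomorphic_vector_bundle_def complex_manifold_def)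
  from split[unfolded curvature_splits_def, rule_format, OF b q(2)]
  obtain K where K: "hermitian_matrix K"
    and K': "\<forall>U \<phi>. local_trivialization E U \<phi> \<and> q \<in> U \<longrightarrow>
        (\<forall>e v. proj E e = q \<longrightarrow> curvature_form E h b \<phi> e v = h e e * sesq K v)" by (elim exE conjE)
  have Ks: "curvature_form E h b \<phi> e v = h e e * sesq K v"
    if "local_trivialization E U \<phi>" "q \<in> U" "proj E e = q" for U \<phi> e v
    using K'[rule_format, OF conjI[OF that(1,2)] that(3)] .
  have \<Theta>: "chern_curvature (metric_matrix E h b \<phi>) (snd b q) \<alpha> \<beta> i j
      = metric_matrix E h b \<phi> (snd b q) $ \<alpha> $ \<beta> * K $ i $ j"
    if t: "local_trivialization E U \<phi>" and q': "q \<in> U" for U \<phi> \<alpha> \<beta> i j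
  proof -
    let ?H = "metric_matrix E h b \<phi> (snd b q)"
    let ?C = "chern_curvature (metric_matrix E h b \<phi>) (snd b q)"
    have "sesq (\<chi> \<alpha> \<beta>. ?C \<alpha> \<beta> i j) \<xi> = sesq (\<chi> \<alpha> \<beta>. ?H $ \<alpha> $ \<beta> * K $ i $ j) \<xi>" for \<xi> i j
    proof -
      obtain e where e: "proj E e = q" "\<phi> e = \<xi>" using trivialization_point[OF t q', of \<xi>] by blast
      have "(\<chi> i j. sesq (\<chi> \<alpha> \<beta>. ?C \<alpha> \<beta> i j) \<xi>) = (\<chi> i j. h e e * K $ i $ j)"
      proof (rule sesq_determines)
        fix v :: "complex^'n"
        let ?t = "\<lambda>\<alpha> \<beta> i j. ?C \<alpha> \<beta> i j * \<xi> $ \<alpha> * cnj (\<xi> $ \<beta>) * v $ i * cnj (v $ j)"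
        have "sesq (\<chi> i j. sesq (\<chi> \<alpha> \<beta>. ?C \<alpha> \<beta> i j) \<xi>) v = (\<Sum>i\<in>UNIV. \<Sum>j\<in>UNIV. \<Sum>\<alpha>\<in>UNIV. \<Sum>\<beta>\<in>UNIV. ?t \<alpha> \<beta> i j)"
          by (simp add: sesq_def sum_distrib_right)
        also have "\<dots> = (\<Sum>i\<in>UNIV. \<Sum>\<alpha>\<in>UNIV. \<Sum>j\<in>UNIV. \<Sum>\<beta>\<in>UNIV. ?t \<alpha> \<beta> i j)"
          by (rule sum.cong[OF refl], rule sum.swap)
        also have "\<dots> = (\<Sum>\<alpha>\<in>UNIV. \<Sum>i\<in>UNIV. \<Sum>j\<in>UNIV. \<Sum>\<beta>\<in>UNIV. ?t \<alpha> \<beta> i j)"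
          by (rule sum.swap)
        also have "\<dots> = (\<Sum>\<alpha>\<in>UNIV. \<Sum>i\<in>UNIV. \<Sum>\<beta>\<in>UNIV. \<Sum>j\<in>UNIV. ?t \<alpha> \<beta> i j)"
          by (rule sum.cong[OF refl], rule sum.cong[OF refl], rule sum.swap)
        also have "\<dots> = (\<Sum>\<alpha>\<in>UNIV. \<Sum>\<beta>\<in>UNIV. \<Sum>i\<in>UNIV. \<Sum>j\<in>UNIV. ?t \<alpha> \<beta> i j)"
          by (rule sum.cong[OF refl], rule sum.swap)
        also have "\<dots> = curvature_form E h b \<phi> e v"
          by (simp add: curvature_form_def e)
        also have "\<dots> = h e e * sesq K v" by (rule Ks[OF t q' e(1)])
        also have "\<dots> = sesq (\<chi> i j. h e e * K $ i $ j) v"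
          by (simp add: sesq_def sum_distrib_left mult.assoc)
        finally show "sesq (\<chi> i j. sesq (\<chi> \<alpha> \<beta>. ?C \<alpha> \<beta> i j) \<xi>) v = sesq (\<chi> i j. h e e * K $ i $ j) v" .
      qed
      then have "sesq (\<chi> \<alpha> \<beta>. ?C \<alpha> \<beta> i j) \<xi> = h e e * K $ i $ j" by (simp add: vec_eq_iff)
      also have "\<dots> = sesq (\<chi> \<alpha> \<beta>. ?H $ \<alpha> $ \<beta> * K $ i $ j) \<xi>"
        unfolding metric_matrix_positive(1)[OF t bc q' q(2) e(1)] e(2)
        by (simp add: sesq_def sum_distrib_left mult_ac)
      finally show ?thesis .
    qed
    then have "(\<chi> \<alpha> \<beta>. ?C \<alpha> \<beta> i j) = (\<chi> \<alpha> \<beta>. ?H $ \<alpha> $ \<beta> * K $ i $ j)" by (rule sesq_determines)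
    then show ?thesis by (simp add: vec_eq_iff)
  qed
  have Ric: "bundle_ricci_in_frame E h b \<phi> q = (\<chi> i j. of_nat CARD('k) * K $ i $ j)"
    if t: "local_trivialization E U \<phi>" and q': "q \<in> U" for U \<phi>
  proof -
    let ?H = "metric_matrix E h b \<phi> (snd b q)"
    have nz: "det ?H \<noteq> 0" by (rule pos_def_det_nonzero[OF metric_matrix_positive(2)[OF t bc q' q(2)]])
    have "(\<Sum>\<alpha>\<in>UNIV. \<Sum>\<beta>\<in>UNIV. matrix_inv ?H $ \<beta> $ \<alpha> * (?H $ \<alpha> $ \<beta> * K $ i $ j))
        = (\<Sum>\<beta>\<in>UNIV. (matrix_inv ?H ** ?H) $ \<beta> $ \<beta>) * K $ i $ j" for i j
      by (subst sum.swap) (simp add: matrix_matrix_mult_def sum_distrib_right mult.assoc)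
    then show ?thesis
      by (simp add: bundle_ricci_in_frame_def \<Theta>[OF t q'] matrix_inv_works[OF nz] mat_def)
  qed
  have "bundle_ricci E h b q = (\<chi> i j. of_nat CARD('k) * K $ i $ j)"
    unfolding bundle_ricci_def
  proof (rule the_equality)
    show "\<forall>U \<phi>. local_trivialization E U \<phi> \<and> q \<in> U \<longrightarrow> (\<chi> i j. of_nat CARD('k) * K $ i $ j) = bundle_ricci_in_frame E h b \<phi> q"
      using Ric by auto
    show "R = (\<chi> i j. of_nat CARD('k) * K $ i $ j)"
      if "\<forall>U \<phi>. local_trivialization E U \<phi> \<and> q \<in> U \<longrightarrow> R = bundle_ricci_in_frame E h b \<phi> q" for R
      using that t q(1) Ric by metis
  qed
  then have g: "induced_metric E h b q $ i $ j = - (of_nat CARD('k) * K $ i $ j)" for i j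
    by (simp add: induced_metric_def)
  show "chern_curvature (metric_matrix E h b \<phi>) (snd b q) \<alpha> \<beta> i j
      = - (metric_matrix E h b \<phi> (snd b q) $ \<alpha> $ \<beta> * induced_metric E h b q $ i $ j / of_nat CARD('k))"
    unfolding \<Theta>[OF t q(1)] g by simp
  show "pos_def (induced_metric E h b q)"
    unfolding pos_def_def
  proof (intro conjI allI impI)
    show "hermitian_matrix (induced_metric E h b q)"
      unfolding hermitian_matrix_def g using hermitian_cnj[OF K] by simp
    fix v :: "complex^'n" assume v: "v \<noteq> 0"
    define e where "e = frame E \<phi> undefined q"
    have e: "proj E e = q" "\<phi> e = axis undefined 1" using frame_point[OF t q(1)] by (simp_all add: e_def)
    have "\<phi> (vscale E 0 e) = 0" using t e q by (simp add: local_trivialization_def)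
    then have ne: "e \<noteq> vscale E 0 e" using e by (auto simp: axis_eq_0_iff)
    have cf: "curvature_form E h b \<phi> e v = h e e * sesq K v" by (rule Ks[OF t q(1) e(1)])
    have le: "Re (curvature_form E h b \<phi> e v) \<le> 0" and n0: "curvature_form E h b \<phi> e v \<noteq> 0"
      using neg[unfolded griffiths_negative_def, rule_format, OF b t, of e v] e(1) q ne v by simp_all
    have hp: "Re (h e e) > 0" by (rule metric_positive[OF ne])
    have hI: "Im (h e e) = 0" using arg_cong[OF metric_hermitian[OF refl, of e], of Im] by simp
    have KI: "Im (sesq K v) = 0" by (rule sesq_hermitian_real[OF K])
    have "Re (h e e) * Re (sesq K v) \<le> 0" "sesq K v \<noteq> 0" using le n0 hI KI by (auto simp: cf)
    then have "Re (sesq K v) < 0" using hp KI by (auto simp: mult_le_0_iff complex_eq_iff less_le)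
    moreover have "sesq (induced_metric E h b q) v = - (of_nat CARD('k) * sesq K v)"
      by (simp add: sesq_def g sum_negf sum_distrib_left mult.assoc)
    ultimately show "Re (sesq (induced_metric E h b q) v) > 0"
      by (simp add: mult_pos_neg)
  qed
qed

lemma unit_sphere_bundle_local:
  assumes neg: "griffiths_negative E h" and split: "curvature_splits E h"
    and ev: "constant_ricci_eigenvalues (base_atlas E) (induced_metric E h)"
    and t: "local_trivialization E U \<phi>" and b: "b \<in> base_atlas E"
    and p: "p \<in> unit_sphere_bundle h" "proj E p \<in> U" "proj E p \<in> fst b"
    and d: "d = (proj E -` (U \<inter> fst b), \<lambda>e. vjoin (snd b (proj E e)) (\<phi> e))"
  shows "\<exists>V \<rho>. open V \<and> snd d p \<in> V \<and> V \<subseteq> snd d ` fst d \<and>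
    pseudoconvex_defining_function V (snd d ` (unit_sphere_bundle h \<inter> fst d)) \<rho> \<and> (\<forall>y\<in>V. fefferman_J \<rho> y = 1)"
proof -
  have bc: "holomorphic_chart (base_atlas E) b"
    using E b by (simp add: holomorphic_vector_bundle_def complex_manifold_def)
  have U: "open U" using t by (simp add: local_trivialization_def)
  define Z where "Z = snd b ` (fst b \<inter> U)"
  define H where "H = metric_matrix E h b \<phi>"
  define g where "g z = induced_metric E h b (chart_inv b z)" for z
  have Z: "open Z" unfolding Z_def by (rule open_chart_image[OF bc U])
  have ci: "chart_inv b (snd b q) = q" if "q \<in> fst b" for q by (rule chart_inv_left[OF bc that])
  obtain ls where ls: "\<And>q. q \<in> fst b \<Longrightarrow>
      ordered_eigenvalues (ricci_tensor (induced_metric E h) b q ** matrix_inv (induced_metric E h b q)) ls"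
    using ev b unfolding constant_ricci_eigenvalues_def by blast
  have sphere: "e \<in> unit_sphere_bundle h \<longleftrightarrow> Re (sesq (H (snd b (proj E e))) (\<phi> e)) = 1"
    if "proj E e \<in> U" "proj E e \<in> fst b" for e
    unfolding H_def metric_matrix_positive(1)[OF t bc that refl, symmetric]
    by (simp add: unit_sphere_bundle_def hnorm_def)
  have "\<exists>V \<rho>. open V \<and> vjoin (snd b (proj E p)) (\<phi> p) \<in> V \<and> V \<subseteq> {y. base y \<in> Z} \<and>
    pseudoconvex_defining_function V {y. Re (sesq (H (base y)) (fib y)) = 1} \<rho> \<and> (\<forall>y\<in>V. fefferman_J \<rho> y = 1)"
  proof (rule sphere_bundle_local_defining_function[where g = g and ls = ls])
    show "open Z" by (rule Z)
    show "smooth_on Z (\<lambda>z. H z $ \<alpha> $ \<beta>)" for \<alpha> \<beta>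
      using h b t unfolding hermitian_metric_def Z_def H_def by blast
    fix z assume "z \<in> Z"
    then obtain q where q: "q \<in> U" "q \<in> fst b" "z = snd b q" by (auto simp: Z_def)
    have gz: "g z = induced_metric E h b q" by (simp add: g_def q(3) ci[OF q(2)])
    show "pos_def (H z)" unfolding H_def q(3) by (rule metric_matrix_positive(2)[OF t bc q(1,2)])
    show "pos_def (g z)" unfolding gz by (rule split_curvature_metric(2)[OF neg split t b q(1,2)])
    show "chern_curvature H z \<alpha> \<beta> i j = - (H z $ \<alpha> $ \<beta> * g z $ i $ j / of_nat CARD('k))" for \<alpha> \<beta> i j
      unfolding H_def gz unfolding q(3) by (rule split_curvature_metric(1)[OF neg split t b q(1,2)])
    show "ordered_eigenvalues ((\<chi> i j. - dz i (dzbar j (\<lambda>x. complex_of_real (ln (Re (det (g x)))))) z) ** matrix_inv (g z)) ls"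
      using ls[OF q(2)] by (simp add: gz ricci_tensor_def g_def[abs_def] q(3) ci[OF q(2)])
  next
    show "snd b (proj E p) \<in> Z" using p by (auto simp: Z_def)
    show "Re (sesq (H (snd b (proj E p))) (\<phi> p)) = 1" using sphere[OF p(2,3)] p(1) by simp
  qed
  then obtain V \<rho> where V: "open V" "snd d p \<in> V" "V \<subseteq> {y. base y \<in> Z}"
    and pc: "pseudoconvex_defining_function V {y. Re (sesq (H (base y)) (fib y)) = 1} \<rho>"
    and J: "\<forall>y\<in>V. fefferman_J \<rho> y = 1" by (auto simp: d)
  have im: "\<exists>e\<in>fst d. y = snd d e" if y: "y \<in> V" for y
  proof -
    obtain q where q: "q \<in> U" "q \<in> fst b" "base y = snd b q" using V(3) y by (auto simp: Z_def)
    obtain e where e: "proj E e = q" "\<phi> e = fib y" using trivialization_point[OF t q(1), of "fib y"] by blast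
    have "snd d e = vjoin (base y) (fib y)" by (simp add: d e q(3))
    then have "y = snd d e" by (simp only: vjoin_base_fib)
    moreover have "e \<in> fst d" using e q by (simp add: d)
    ultimately show ?thesis by blast
  qed
  have "y \<in> snd d ` (unit_sphere_bundle h \<inter> fst d) \<longleftrightarrow> Re (sesq (H (base y)) (fib y)) = 1" if y: "y \<in> V" for y
  proof
    assume "y \<in> snd d ` (unit_sphere_bundle h \<inter> fst d)"
    then obtain e where "e \<in> unit_sphere_bundle h" "e \<in> fst d" "y = snd d e" by blast
    then show "Re (sesq (H (base y)) (fib y)) = 1" using sphere[of e] by (simp add: d)
  next
    assume 1: "Re (sesq (H (base y)) (fib y)) = 1"
    obtain e where e: "e \<in> fst d" "y = snd d e" using im[OF y] by blast
    then have "e \<in> unit_sphere_bundle h" using sphere[of e] 1 by (simp add: d)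
    with e show "y \<in> snd d ` (unit_sphere_bundle h \<inter> fst d)" by blast
  qed
  then have "snd d ` (unit_sphere_bundle h \<inter> fst d) \<inter> V = {y. Re (sesq (H (base y)) (fib y)) = 1} \<inter> V" by blast
  then have "pseudoconvex_defining_function V (snd d ` (unit_sphere_bundle h \<inter> fst d)) \<rho>"
    using pc by (simp add: pseudoconvex_defining_function_def)
  moreover have "V \<subseteq> snd d ` fst d" using im by blast
  ultimately show ?thesis using V J by blast
qed

end

theorem theorem1p2:
  fixes E :: "('m::{t2_space,second_countable_topology},
               'e::{t2_space,second_countable_topology}, 'n::finite, 'k::finite) vbundle"
    and h :: "'e \<Rightarrow> 'e \<Rightarrow> complex"
  assumes "holomorphic_vector_bundle E"
    and "hermitian_metric E h"
    and "griffiths_negative E h"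
    and "curvature_splits E h"
    and "constant_ricci_eigenvalues (base_atlas E) (induced_metric E h)"
  shows "obstruction_flat (total_atlas E) (unit_sphere_bundle h)"
  unfolding obstruction_flat_def
proof (intro ballI impI)
  fix p c assume p: "p \<in> unit_sphere_bundle h" and c: "c \<in> total_atlas E" and pc: "p \<in> fst c"
  have cc: "holomorphic_chart (total_atlas E) c"
    using assms(1) c by (simp add: holomorphic_vector_bundle_def complex_manifold_def)
  have "proj E p \<in> (\<Union>b\<in>base_atlas E. fst b)"
    using assms(1) by (simp add: holomorphic_vector_bundle_def complex_manifold_def)
  then obtain b where b: "b \<in> base_atlas E" "proj E p \<in> fst b" by blast
  obtain U \<phi> where U: "proj E p \<in> U" and t: "local_trivialization E U \<phi>"
    using assms(1) by (metis holomorphic_vector_bundle_def)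
  define d where "d = (proj E -` (U \<inter> fst b), \<lambda>e. vjoin (snd b (proj E e)) (\<phi> e))"
  have dc: "holomorphic_chart (total_atlas E) d"
    using t b(1) unfolding local_trivialization_def d_def by (auto split: prod.splits)
  obtain V \<rho> where V: "open V" "snd d p \<in> V" "V \<subseteq> snd d ` fst d"
    and \<rho>: "pseudoconvex_defining_function V (snd d ` (unit_sphere_bundle h \<inter> fst d)) \<rho>"
    and J: "\<And>y. y \<in> V \<Longrightarrow> fefferman_J \<rho> y = 1"
    using unit_sphere_bundle_local[OF assms t b(1) p U b(2) d_def] by blast
  have "p \<in> fst d" using U b by (simp add: d_def)
  from chart_transition_pullback[OF cc dc c pc this V \<rho> J]
  obtain V' \<rho>' where V': "open V'" "snd c p \<in> V'" "V' \<subseteq> snd c ` fst c"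
    "pseudoconvex_defining_function V' (snd c ` (unit_sphere_bundle h \<inter> fst c)) \<rho>'"
    and J': "\<forall>x\<in>V'. fefferman_J \<rho>' x = 1" by blast
  \<comment> \<open>the solution is exact, so the constant in the error bound is 0\<close>
  have "\<forall>x\<in>V'. cmod (fefferman_J \<rho>' x - 1) \<le> 0 * \<bar>\<rho>' x\<bar> ^ (CARD('n + 'k) + 2)"
    using J' by simp
  with V' show "\<exists>V \<rho>. open V \<and> snd c p \<in> V \<and> V \<subseteq> snd c ` fst c \<and>
      pseudoconvex_defining_function V (snd c ` (unit_sphere_bundle h \<inter> fst c)) \<rho> \<and>
      (\<exists>C. \<forall>z\<in>V. cmod (fefferman_J \<rho> z - 1) \<le> C * \<bar>\<rho> z\<bar> ^ (CARD('n + 'k) + 2))"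
    by blast
qed

end
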